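(* Let $\Lambda\subset\Sigma\times\mathbb R^{n+1,1}$ be an immersed surface in $S^n$ and let $q\in C^\infty(\Sigma,S^2_0T^*\Sigma)$ be a nonzero quadratic differential. Then the following conditions are equivalent: (i) $\Lambda$ is isothermic with holomorphic commuting quadratic differential $q$, i.e. $dq=0$ and $q\wedge\mathbb S^0=0$; (ii) there is a $1$-form $\eta\in\Omega^1(\Sigma,\mathfrak{stab}(\Lambda)^\perp)$ with $[\eta]=q$ such that $d\eta=0$; (iii) there is a $1$-form $\eta\in\Omega^1(\Sigma,\mathfrak{stab}(\Lambda)^\perp\cap\mathfrak{so}(V_\Sigma))$ with $[\eta]=q$ such that $d+r\eta$ is a flat connection on $\Sigma\times\mathbb R^{n+1,1}$ for all $r\in\mathbb R$.
   Context: $\mathbb R^{n+1,1}$ has inner product $(\cdot,\cdot)$ of signature $(n+1,1)$; $S^n$ is the set of its null lines; a half of the light-cone is fixed; $d$ denotes flat differentiation (and the exterior derivative of $\mathfrak{so}(n+1,1)$-valued forms). $\Sigma$ is a surface ($n>2$), $L$ its bundle of weight-one densities ($L^{-2}=|\Lambda^2T^*\Sigma|$); tensor signs with line bundles are omitted. An immersion in $S^n$ is a null line subbundle $\Lambda\subset\Sigma\times\mathbb R^{n+1,1}$, oriented by the half light-cone, with $X\mapsto d_X\sigma$ mod $\Lambda$ injective. It induces the conformal metric $c=\langle\cdot,\cdot\rangle\in S^2T^*\Sigma\,L^2$, $(d_X\sigma,d_Y\sigma)=\langle X,Y\rangle\sigma^2$, with $\Lambda=L^{-1}$ so that $c$ has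 volume form of modulus one. $\Lambda^{(1)}$ is the span of $\sigma,d\sigma$; $N\Sigma=\mathrm{Hom}(\Lambda,\Lambda^\perp/\Lambda^{(1)})$. An enveloped sphere congruence is a signature $(3,1)$ subbundle $V\supset\Lambda^{(1)}$; $V^\perp\cong N\Sigma\,\Lambda=\Lambda^\perp/\Lambda^{(1)}$. For such $V$, $\mathrm{II}^V_XY\,\sigma=-(d_Xd_Y\sigma)^{\perp}$, the $V^\perp$-component, symmetric in $X,Y$. The central sphere congruence $V_\Sigma$ is the unique $V$ with $\mathrm{II}^V$ tracefree; $\mathrm{II}^0=\mathrm{II}^{V_\Sigma}$ and $\mathbb S^0$ is its transpose, $\langle\mathbb S^0_XU,Y\rangle=\langle U,\mathrm{II}^0_XY\rangle$. A quadratic differential is a section $q$ of $S^2_0T^*\Sigma$ (symmetric, tracefree). $(dq)_{X,Y}=(D_Xq)(Y,\cdot)-(D_Yq)(X,\cdot)$ with $D$ the Levi-Civita connection of any compatible metric (independent of choice); $q\wedge\mathbb S^0=0$ means $q(X,\mathbb S^0_YU)=q(Y,\mathbb S^0_XU)$ for all tangent $X,Y$, normal $U$. An immersed surface is isothermic if there is a nonzero $q$ with $dq=0$ and $q\wedge\mathbb S^0=0$. $\mathfrak{stab}(\Lambda)^\perp=\{S\in\mathfrak{so}(n+1,1):S|_\Lambda=0,\ S(\Lambda^\perp)\subset\Lambda\}$, a bundle over $\Sigma$ (isomorphic to $T^*S^n|_\Sigma$); for $\eta\in\Omega^1(\Sigma,\mathfrak{stab}(\Lambda)^\perp)$ write $\eta_X\cdot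 d_Y\sigma=-\eta(X,Y)\sigma$ for $X,Y\in T\Sigma$; $[\eta]$ is the symmetric tracefree part of $\eta(\cdot,\cdot)$ on $T\Sigma$ (its Lie algebra homology class). $\mathfrak{so}(V_\Sigma)$ consists of the elements of $\mathfrak{so}(n+1,1)$ vanishing on $V_\Sigma^\perp$. *)

theory Defs
  imports "HOL-Analysis.Analysis"
begin

section \<open>Smooth functions on open subsets of Euclidean space\<close>

primrec C_k_on :: "nat \<Rightarrow> 'a::euclidean_space set \<Rightarrow> ('a \<Rightarrow> 'b::real_normed_vector) \<Rightarrow> bool" where
  "C_k_on 0 S f \<longleftrightarrow> continuous_on S f"
| "C_k_on (Suc k) S f \<longleftrightarrow>
     f differentiable_on S \<and> (\<forall>v. C_k_on k S (\<lambda>x. frechet_derivative f (at x) v))"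

definition smooth_on :: "'a::euclidean_space set \<Rightarrow> ('a \<Rightarrow> 'b::real_normed_vector) \<Rightarrow> bool" where
  "smooth_on S f \<longleftrightarrow> (\<forall>k. C_k_on k S f)"


section \<open>Surfaces\<close>

text \<open>A chart is a pair (domain, coordinate map); the values of the coordinate map off the domain
  are irrelevant.\<close>

type_synonym 'a chart = "'a set \<times> ('a \<Rightarrow> real^2)"

abbreviation dom_of :: "'a chart \<Rightarrow> 'a set" where "dom_of \<equiv> fst"
abbreviation coord :: "'a chart \<Rightarrow> 'a \<Rightarrow> real^2" where "coord \<equiv> snd"

definition param :: "'a chart \<Rightarrow> real^2 \<Rightarrow> 'a" where
  "param \<kappa> = inv_into (dom_of \<kappa>) (coord \<kappa>)"

definition smooth_surface :: "'a topology \<Rightarrow> 'a chart set \<Rightarrow> bool" where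
  "smooth_surface T A \<longleftrightarrow>
     Hausdorff_space T \<and> second_countable T \<and>
     (\<Union>\<kappa>\<in>A. dom_of \<kappa>) = topspace T \<and>
     (\<forall>\<kappa>\<in>A. openin T (dom_of \<kappa>) \<and> open (coord \<kappa> ` dom_of \<kappa>) \<and>
        homeomorphic_map (subtopology T (dom_of \<kappa>))
          (top_of_set (coord \<kappa> ` dom_of \<kappa>)) (coord \<kappa>)) \<and>
     (\<forall>\<kappa>\<in>A. \<forall>\<kappa>'\<in>A.
        smooth_on (coord \<kappa> ` (dom_of \<kappa> \<inter> dom_of \<kappa>')) (coord \<kappa>' \<circ> param \<kappa>))"

definition smooth_map_on ::
    "'a chart set \<Rightarrow> 'a set \<Rightarrow> ('a \<Rightarrow> 'b::real_normed_vector) \<Rightarrow> bool" where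
  "smooth_map_on A W f \<longleftrightarrow>
     (\<forall>\<kappa>\<in>A. smooth_on (coord \<kappa> ` (W \<inter> dom_of \<kappa>)) (f \<circ> param \<kappa>))"

text \<open>The tangent vector at \<open>p\<close> with components \<open>u\<close> in the chart \<open>\<kappa>\<close> is written \<open>(\<kappa>, p, u)\<close>.
  \<open>dird \<kappa> f p u\<close> is the (flat) derivative of the vector-valued function \<open>f\<close> along it.
  As \<open>p\<close> varies and \<open>u\<close> is fixed, \<open>(\<kappa>, p, u)\<close> is a coordinate vector field of \<open>\<kappa>\<close> (with
  constant coefficients); any two of these commute.\<close>

definition dird ::
    "'a chart \<Rightarrow> ('a \<Rightarrow> 'b::real_normed_vector) \<Rightarrow> 'a \<Rightarrow> real^2 \<Rightarrow> 'b" where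
  "dird \<kappa> f p u = frechet_derivative (f \<circ> param \<kappa>) (at (coord \<kappa> p)) u"

definition change_coord :: "'a chart \<Rightarrow> 'a chart \<Rightarrow> 'a \<Rightarrow> real^2 \<Rightarrow> real^2" where
  "change_coord \<kappa> \<kappa>' p u = dird \<kappa> (coord \<kappa>') p u"

text \<open>Covariant tensor fields are families of component functions, one for each chart of the
  atlas, related by the transition maps.\<close>

type_synonym ('a, 'b) form1 = "'a chart \<Rightarrow> 'a \<Rightarrow> real^2 \<Rightarrow> 'b"
type_synonym ('a, 'b) form2 = "'a chart \<Rightarrow> 'a \<Rightarrow> real^2 \<Rightarrow> real^2 \<Rightarrow> 'b"

definition smooth_1form ::
    "'a chart set \<Rightarrow> ('a, 'b::real_normed_vector) form1 \<Rightarrow> bool" where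
  "smooth_1form A \<omega> \<longleftrightarrow>
     (\<forall>\<kappa>\<in>A. \<forall>p\<in>dom_of \<kappa>. linear (\<omega> \<kappa> p)) \<and>
     (\<forall>\<kappa>\<in>A. \<forall>u. smooth_on (coord \<kappa> ` dom_of \<kappa>) ((\<lambda>x. \<omega> \<kappa> x u) \<circ> param \<kappa>)) \<and>
     (\<forall>\<kappa>\<in>A. \<forall>\<kappa>'\<in>A. \<forall>p\<in>dom_of \<kappa> \<inter> dom_of \<kappa>'. \<forall>u.
        \<omega> \<kappa> p u = \<omega> \<kappa>' p (change_coord \<kappa> \<kappa>' p u))"

definition smooth_2tensor ::
    "'a chart set \<Rightarrow> ('a, 'b::real_normed_vector) form2 \<Rightarrow> bool" where
  "smooth_2tensor A b \<longleftrightarrow>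
     (\<forall>\<kappa>\<in>A. \<forall>p\<in>dom_of \<kappa>. bilinear (b \<kappa> p)) \<and>
     (\<forall>\<kappa>\<in>A. \<forall>u v. smooth_on (coord \<kappa> ` dom_of \<kappa>) ((\<lambda>x. b \<kappa> x u v) \<circ> param \<kappa>)) \<and>
     (\<forall>\<kappa>\<in>A. \<forall>\<kappa>'\<in>A. \<forall>p\<in>dom_of \<kappa> \<inter> dom_of \<kappa>'. \<forall>u v.
        b \<kappa> p u v = b \<kappa>' p (change_coord \<kappa> \<kappa>' p u) (change_coord \<kappa> \<kappa>' p v))"

text \<open>Exterior derivative of a 1-form, on coordinate vector fields of \<open>\<kappa>\<close>.\<close>

definition ext_deriv :: "('a, 'b::real_normed_vector) form1 \<Rightarrow> ('a, 'b) form2" where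
  "ext_deriv \<omega> \<kappa> p u v =
     dird \<kappa> (\<lambda>x. \<omega> \<kappa> x v) p u - dird \<kappa> (\<lambda>x. \<omega> \<kappa> x u) p v"


section \<open>Metrics on the tangent spaces\<close>

definition metric_trace ::
    "(real^2 \<Rightarrow> real^2 \<Rightarrow> real) \<Rightarrow> (real^2 \<Rightarrow> real^2 \<Rightarrow> 'b::real_vector) \<Rightarrow> 'b" where
  "metric_trace g b =
     (THE t. \<forall>e1 e2. g e1 e1 = 1 \<and> g e2 e2 = 1 \<and> g e1 e2 = 0 \<longrightarrow> t = b e1 e1 + b e2 e2)"

definition sym_tracefree ::
    "(real^2 \<Rightarrow> real^2 \<Rightarrow> real) \<Rightarrow> (real^2 \<Rightarrow> real^2 \<Rightarrow> real) \<Rightarrow> real^2 \<Rightarrow> real^2 \<Rightarrow> real" where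
  "sym_tracefree g b u v = (b u v + b v u) / 2 - metric_trace g b / 2 * g u v"

text \<open>Levi-Civita connection \<open>D\<close> of a metric in a chart: \<open>christoffel g \<kappa> p u v\<close> is \<open>D_u v\<close> for the
  coordinate vector fields \<open>u\<close>, \<open>v\<close>; the conditions are bilinearity, vanishing torsion and
  \<open>D g = 0\<close>.\<close>

definition christoffel :: "('a, real) form2 \<Rightarrow> 'a chart \<Rightarrow> 'a \<Rightarrow> real^2 \<Rightarrow> real^2 \<Rightarrow> real^2" where
  "christoffel g \<kappa> p = (THE \<Gamma>. bilinear \<Gamma> \<and> (\<forall>u v. \<Gamma> u v = \<Gamma> v u) \<and>
     (\<forall>u v w. dird \<kappa> (\<lambda>x. g \<kappa> x v w) p u = g \<kappa> p (\<Gamma> u v) w + g \<kappa> p v (\<Gamma> u w)))"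

definition cov_deriv_2tensor ::
    "('a, real) form2 \<Rightarrow> ('a, real) form2 \<Rightarrow> 'a chart \<Rightarrow> 'a \<Rightarrow> real^2 \<Rightarrow> real^2 \<Rightarrow> real^2 \<Rightarrow> real" where
  "cov_deriv_2tensor g b \<kappa> p u v w =
     dird \<kappa> (\<lambda>x. b \<kappa> x v w) p u
       - b \<kappa> p (christoffel g \<kappa> p u v) w - b \<kappa> p v (christoffel g \<kappa> p u w)"


section \<open>Lorentzian space and the conformal sphere\<close>

text \<open>\<open>(real^'m) \<times> real\<close> with this form is the inner product space of signature \<open>(CARD('m), 1)\<close>;
  for the \<open>n\<close>-sphere, \<open>CARD('m) = n + 1\<close>.\<close>

definition lor :: "(real^'m) \<times> real \<Rightarrow> (real^'m) \<times> real \<Rightarrow> real" where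
  "lor v w = fst v \<bullet> fst w - snd v * snd w"

definition lor_perp :: "((real^'m) \<times> real) set \<Rightarrow> ((real^'m) \<times> real) set" where
  "lor_perp W = {v. \<forall>w\<in>W. lor v w = 0}"

definition half_cone :: "((real^'m) \<times> real) set" where
  "half_cone = {v. lor v v = 0 \<and> snd v > 0}"

definition null_line :: "((real^'m) \<times> real) set \<Rightarrow> bool" where
  "null_line L \<longleftrightarrow> subspace L \<and> dim L = 1 \<and> (\<forall>v\<in>L. lor v v = 0)"

definition has_signature :: "((real^'m) \<times> real) set \<Rightarrow> nat \<Rightarrow> nat \<Rightarrow> bool" where
  "has_signature W k l \<longleftrightarrow> (\<exists>P N. subspace P \<and> subspace N \<and> dim P = k \<and> dim N = l \<and>
     (\<forall>v\<in>P. v \<noteq> 0 \<longrightarrow> lor v v > 0) \<and> (\<forall>v\<in>N. v \<noteq> 0 \<longrightarrow> lor v v < 0) \<and>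
     (\<forall>v\<in>P. \<forall>w\<in>N. lor v w = 0) \<and> W = {v + w | v w. v \<in> P \<and> w \<in> N})"

text \<open>Component of \<open>w\<close> in the second summand of \<open>V \<oplus> lor_perp V\<close> (for nondegenerate \<open>V\<close>).\<close>

definition perp_part ::
    "((real^'m) \<times> real) set \<Rightarrow> (real^'m) \<times> real \<Rightarrow> (real^'m) \<times> real" where
  "perp_part V w = (THE z. z \<in> lor_perp V \<and> w - z \<in> V)"

definition so_lor :: "(((real^'m) \<times> real) \<Rightarrow>\<^sub>L ((real^'m) \<times> real)) set" where
  "so_lor = {S. \<forall>v w. lor (blinfun_apply S v) w + lor v (blinfun_apply S w) = 0}"

text \<open>The nilradical (polar) of the stabiliser of a null line \<open>L\<close>.\<close>

definition stab_perp :: "((real^'m) \<times> real) set \<Rightarrow> (((real^'m) \<times> real) \<Rightarrow>\<^sub>L ((real^'m) \<times> real)) set" where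
  "stab_perp L = {S \<in> so_lor. (\<forall>v\<in>L. blinfun_apply S v = 0) \<and>
                              (\<forall>v\<in>lor_perp L. blinfun_apply S v \<in> L)}"

definition so_sub :: "((real^'m) \<times> real) set \<Rightarrow> (((real^'m) \<times> real) \<Rightarrow>\<^sub>L ((real^'m) \<times> real)) set" where
  "so_sub V = {S \<in> so_lor. \<forall>v\<in>lor_perp V. blinfun_apply S v = 0}"


section \<open>Immersed surfaces in the conformal sphere\<close>

definition smooth_subbundle ::
    "'a topology \<Rightarrow> 'a chart set \<Rightarrow> nat \<Rightarrow> ('a \<Rightarrow> ((real^'m) \<times> real) set) \<Rightarrow> bool" where
  "smooth_subbundle T A k V \<longleftrightarrow>
     (\<forall>p\<in>topspace T. \<exists>W s. openin T W \<and> p \<in> W \<and>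
        (\<forall>i<k. smooth_map_on A W (s i)) \<and>
        (\<forall>x\<in>W. V x = span ((\<lambda>i. s i x) ` {..<k}) \<and> dim (V x) = k))"

text \<open>Local sections of \<open>\<Lambda>\<close> that are positive for the orientation by the half light-cone.\<close>

definition positive_section ::
    "'a topology \<Rightarrow> 'a chart set \<Rightarrow> ('a \<Rightarrow> ((real^'m) \<times> real) set) \<Rightarrow> 'a set \<Rightarrow>
     ('a \<Rightarrow> (real^'m) \<times> real) \<Rightarrow> bool" where
  "positive_section T A \<Lambda> W \<sigma> \<longleftrightarrow>
     openin T W \<and> smooth_map_on A W \<sigma> \<and> (\<forall>p\<in>W. \<sigma> p \<in> \<Lambda> p \<inter> half_cone)"

definition immersed_surface ::
    "'a topology \<Rightarrow> 'a chart set \<Rightarrow> ('a \<Rightarrow> ((real^'m) \<times> real) set) \<Rightarrow> bool" where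
  "immersed_surface T A \<Lambda> \<longleftrightarrow>
     smooth_subbundle T A 1 \<Lambda> \<and> (\<forall>p\<in>topspace T. null_line (\<Lambda> p)) \<and>
     (\<forall>W \<sigma>. positive_section T A \<Lambda> W \<sigma> \<longrightarrow>
        (\<forall>\<kappa>\<in>A. \<forall>p\<in>W \<inter> dom_of \<kappa>. \<forall>u. dird \<kappa> \<sigma> p u \<in> \<Lambda> p \<longrightarrow> u = 0))"

text \<open>A positive section \<open>\<sigma>\<close> of \<open>\<Lambda>\<close> trivialises the weight-one densities, and turns the conformal
  metric into the compatible metric below. All compatible metrics arise in this way (locally), so
  conditions on weightless tensors are stated for all positive local sections.\<close>

definition ind_metric :: "('a \<Rightarrow> (real^'m) \<times> real) \<Rightarrow> ('a, real) form2" where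
  "ind_metric \<sigma> \<kappa> p u v = lor (dird \<kappa> \<sigma> p u) (dird \<kappa> \<sigma> p v)"

text \<open>The fibre at \<open>p\<close> of the bundle spanned by the sections of \<open>\<Lambda>\<close> and their first
  derivatives.\<close>

definition Lambda1 ::
    "'a topology \<Rightarrow> 'a chart set \<Rightarrow> ('a \<Rightarrow> ((real^'m) \<times> real) set) \<Rightarrow> 'a \<Rightarrow> ((real^'m) \<times> real) set" where
  "Lambda1 T A \<Lambda> p =
     span ({\<sigma> p | W \<sigma>. positive_section T A \<Lambda> W \<sigma> \<and> p \<in> W} \<union>
           {dird \<kappa> \<sigma> p u | W \<sigma> \<kappa> u.
              positive_section T A \<Lambda> W \<sigma> \<and> p \<in> W \<and> \<kappa> \<in> A \<and> p \<in> dom_of \<kappa>})"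

definition sphere_congruence ::
    "'a topology \<Rightarrow> 'a chart set \<Rightarrow> ('a \<Rightarrow> ((real^'m) \<times> real) set) \<Rightarrow>
     ('a \<Rightarrow> ((real^'m) \<times> real) set) \<Rightarrow> bool" where
  "sphere_congruence T A \<Lambda> V \<longleftrightarrow>
     smooth_subbundle T A 4 V \<and>
     (\<forall>p\<in>topspace T. has_signature (V p) 3 1 \<and> Lambda1 T A \<Lambda> p \<subseteq> V p)"

text \<open>\<open>second_form V \<sigma> \<kappa> p u v\<close> is the value on \<open>\<sigma> p\<close> of the second fundamental form of \<open>V\<close> at the
  tangent vectors \<open>u\<close>, \<open>v\<close>. It is tensorial, so it may be computed from coordinate vector fields.\<close>

definition second_form ::
    "('a \<Rightarrow> ((real^'m) \<times> real) set) \<Rightarrow> ('a \<Rightarrow> (real^'m) \<times> real) \<Rightarrow> ('a, (real^'m) \<times> real) form2" where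
  "second_form V \<sigma> \<kappa> p u v = - perp_part (V p) (dird \<kappa> (\<lambda>x. dird \<kappa> \<sigma> x v) p u)"

definition central_congruence ::
    "'a topology \<Rightarrow> 'a chart set \<Rightarrow> ('a \<Rightarrow> ((real^'m) \<times> real) set) \<Rightarrow>
     ('a \<Rightarrow> ((real^'m) \<times> real) set) \<Rightarrow> bool" where
  "central_congruence T A \<Lambda> V \<longleftrightarrow>
     sphere_congruence T A \<Lambda> V \<and>
     (\<forall>W \<sigma>. positive_section T A \<Lambda> W \<sigma> \<longrightarrow>
        (\<forall>\<kappa>\<in>A. \<forall>p\<in>W \<inter> dom_of \<kappa>.
           metric_trace (ind_metric \<sigma> \<kappa> p) (second_form V \<sigma> \<kappa> p) = 0))"

text \<open>The unique central congruence, described fibrewise because functions on the surface are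
  unconstrained off \<open>topspace T\<close>.\<close>

definition central_sphere ::
    "'a topology \<Rightarrow> 'a chart set \<Rightarrow> ('a \<Rightarrow> ((real^'m) \<times> real) set) \<Rightarrow> 'a \<Rightarrow> ((real^'m) \<times> real) set" where
  "central_sphere T A \<Lambda> p = (THE S. \<exists>V. central_congruence T A \<Lambda> V \<and> V p = S)"

text \<open>Normal vectors at \<open>p\<close> are linear maps from \<open>\<Lambda> p\<close> to \<open>lor_perp (V p)\<close>, the latter being
  isomorphic to the quotient of \<open>lor_perp (\<Lambda> p)\<close> by \<open>Lambda1 T A \<Lambda> p\<close>. They are represented
  by linear maps on the whole space, of which only the restriction to \<open>\<Lambda> p\<close> is used.\<close>

definition normal_vectors ::
    "((real^'m) \<times> real) set \<Rightarrow> ((real^'m) \<times> real) set \<Rightarrow> ((real^'m) \<times> real \<Rightarrow> (real^'m) \<times> real) set" where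
  "normal_vectors L V = {U. linear U \<and> U ` L \<subseteq> lor_perp V}"

text \<open>The transpose of the second fundamental form: \<open>shape_op V \<sigma> \<kappa> p v U\<close> is the shape operator
  at the tangent vector \<open>v\<close> and the normal vector \<open>U\<close>. Rescaling \<open>\<sigma>\<close> rescales both
  inner products alike, so the result does not depend on \<open>\<sigma>\<close>.\<close>

definition shape_op ::
    "('a \<Rightarrow> ((real^'m) \<times> real) set) \<Rightarrow> ('a \<Rightarrow> (real^'m) \<times> real) \<Rightarrow> 'a chart \<Rightarrow> 'a \<Rightarrow> real^2 \<Rightarrow>
     ((real^'m) \<times> real \<Rightarrow> (real^'m) \<times> real) \<Rightarrow> real^2" where
  "shape_op V \<sigma> \<kappa> p v U =
     (THE w. \<forall>y. ind_metric \<sigma> \<kappa> p w y = lor (U (\<sigma> p)) (second_form V \<sigma> \<kappa> p v y))"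


section \<open>Quadratic differentials and isothermic surfaces\<close>

definition quadratic_differential ::
    "'a topology \<Rightarrow> 'a chart set \<Rightarrow> ('a \<Rightarrow> ((real^'m) \<times> real) set) \<Rightarrow> ('a, real) form2 \<Rightarrow> bool" where
  "quadratic_differential T A \<Lambda> q \<longleftrightarrow>
     smooth_2tensor A q \<and>
     (\<forall>\<kappa>\<in>A. \<forall>p\<in>dom_of \<kappa>. \<forall>u v. q \<kappa> p u v = q \<kappa> p v u) \<and>
     (\<forall>W \<sigma>. positive_section T A \<Lambda> W \<sigma> \<longrightarrow>
        (\<forall>\<kappa>\<in>A. \<forall>p\<in>W \<inter> dom_of \<kappa>. metric_trace (ind_metric \<sigma> \<kappa> p) (q \<kappa> p) = 0))"

definition nonzero_tensor :: "'a chart set \<Rightarrow> ('a, real) form2 \<Rightarrow> bool" where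
  "nonzero_tensor A q \<longleftrightarrow> (\<exists>\<kappa>\<in>A. \<exists>p\<in>dom_of \<kappa>. \<exists>u v. q \<kappa> p u v \<noteq> 0)"

definition holomorphic_qd ::
    "'a topology \<Rightarrow> 'a chart set \<Rightarrow> ('a \<Rightarrow> ((real^'m) \<times> real) set) \<Rightarrow> ('a, real) form2 \<Rightarrow> bool" where
  "holomorphic_qd T A \<Lambda> q \<longleftrightarrow>
     (\<forall>W \<sigma>. positive_section T A \<Lambda> W \<sigma> \<longrightarrow>
        (\<forall>\<kappa>\<in>A. \<forall>p\<in>W \<inter> dom_of \<kappa>. \<forall>u v w.
           cov_deriv_2tensor (ind_metric \<sigma>) q \<kappa> p u v w
             - cov_deriv_2tensor (ind_metric \<sigma>) q \<kappa> p v u w = 0))"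

definition commuting_qd ::
    "'a topology \<Rightarrow> 'a chart set \<Rightarrow> ('a \<Rightarrow> ((real^'m) \<times> real) set) \<Rightarrow> ('a, real) form2 \<Rightarrow> bool" where
  "commuting_qd T A \<Lambda> q \<longleftrightarrow>
     (\<forall>W \<sigma>. positive_section T A \<Lambda> W \<sigma> \<longrightarrow>
        (\<forall>\<kappa>\<in>A. \<forall>p\<in>W \<inter> dom_of \<kappa>. \<forall>u v.
           \<forall>U\<in>normal_vectors (\<Lambda> p) (central_sphere T A \<Lambda> p).
             q \<kappa> p u (shape_op (central_sphere T A \<Lambda>) \<sigma> \<kappa> p v U)
               = q \<kappa> p v (shape_op (central_sphere T A \<Lambda>) \<sigma> \<kappa> p u U)))"

definition isothermic_with ::
    "'a topology \<Rightarrow> 'a chart set \<Rightarrow> ('a \<Rightarrow> ((real^'m) \<times> real) set) \<Rightarrow> ('a, real) form2 \<Rightarrow> bool" where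
  "isothermic_with T A \<Lambda> q \<longleftrightarrow> holomorphic_qd T A \<Lambda> q \<and> commuting_qd T A \<Lambda> q"


section \<open>Forms with values in the orthogonal Lie algebra\<close>

definition form_in ::
    "'a chart set \<Rightarrow> ('a, 'b) form1 \<Rightarrow> ('a \<Rightarrow> 'b set) \<Rightarrow> bool" where
  "form_in A \<omega> F \<longleftrightarrow> (\<forall>\<kappa>\<in>A. \<forall>p\<in>dom_of \<kappa>. \<forall>u. \<omega> \<kappa> p u \<in> F p)"

text \<open>For a form \<open>\<eta>\<close> with values in \<open>stab_perp (\<Lambda> p)\<close>, the endomorphism \<open>\<eta> \<kappa> p u\<close> sends the derivative
  of \<open>\<sigma>\<close> along \<open>v\<close> to \<open>- c \<sigma>\<close>; the number \<open>c\<close> does not depend on \<open>\<sigma>\<close>.\<close>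

definition soldered ::
    "('a \<Rightarrow> (real^'m) \<times> real) \<Rightarrow> ('a, ((real^'m) \<times> real) \<Rightarrow>\<^sub>L ((real^'m) \<times> real)) form1 \<Rightarrow> ('a, real) form2" where
  "soldered \<sigma> \<eta> \<kappa> p u v =
     (THE c. blinfun_apply (\<eta> \<kappa> p u) (dird \<kappa> \<sigma> p v) = - (c *\<^sub>R \<sigma> p))"

definition homology_class_eq ::
    "'a topology \<Rightarrow> 'a chart set \<Rightarrow> ('a \<Rightarrow> ((real^'m) \<times> real) set) \<Rightarrow>
     ('a, ((real^'m) \<times> real) \<Rightarrow>\<^sub>L ((real^'m) \<times> real)) form1 \<Rightarrow> ('a, real) form2 \<Rightarrow> bool" where
  "homology_class_eq T A \<Lambda> \<eta> q \<longleftrightarrow>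
     (\<forall>W \<sigma>. positive_section T A \<Lambda> W \<sigma> \<longrightarrow>
        (\<forall>\<kappa>\<in>A. \<forall>p\<in>W \<inter> dom_of \<kappa>. \<forall>u v.
           sym_tracefree (ind_metric \<sigma> \<kappa> p) (soldered \<sigma> \<eta> \<kappa> p) u v = q \<kappa> p u v))"

definition closed_1form :: "'a chart set \<Rightarrow> ('a, 'b::real_normed_vector) form1 \<Rightarrow> bool" where
  "closed_1form A \<omega> \<longleftrightarrow> (\<forall>\<kappa>\<in>A. \<forall>p\<in>dom_of \<kappa>. \<forall>u v. ext_deriv \<omega> \<kappa> p u v = 0)"

text \<open>The connection \<open>d + \<omega>\<close> on the trivial bundle, and its flatness: covariant derivatives along
  commuting vector fields commute on all local sections.\<close>

definition conn ::
    "('a, 'e \<Rightarrow>\<^sub>L 'e) form1 \<Rightarrow> 'a chart \<Rightarrow> ('a \<Rightarrow> 'e::real_normed_vector) \<Rightarrow> 'a \<Rightarrow> real^2 \<Rightarrow> 'e" where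
  "conn \<omega> \<kappa> s p u = dird \<kappa> s p u + blinfun_apply (\<omega> \<kappa> p u) (s p)"

definition flat_connection ::
    "'a topology \<Rightarrow> 'a chart set \<Rightarrow> ('a, 'e \<Rightarrow>\<^sub>L 'e::real_normed_vector) form1 \<Rightarrow> bool" where
  "flat_connection T A \<omega> \<longleftrightarrow>
     (\<forall>W s. openin T W \<and> smooth_map_on A W s \<longrightarrow>
        (\<forall>\<kappa>\<in>A. \<forall>p\<in>W \<inter> dom_of \<kappa>. \<forall>u v.
           conn \<omega> \<kappa> (\<lambda>x. conn \<omega> \<kappa> s x v) p u = conn \<omega> \<kappa> (\<lambda>x. conn \<omega> \<kappa> s x u) p v))"

end

theory Submission
  imports Defs
begin

text \<open>Each form with values in the nilradical of the stabiliser of \<open>\<Lambda>\<close> can be written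
  \<open>\<eta> = \<sigma> \<and> \<alpha>\<close> with \<open>\<sigma>\<close> a section of \<open>\<Lambda>\<close> and \<open>\<alpha>\<close> orthogonal to \<open>\<Lambda>\<close>. Pairing \<open>d\<eta> = 0\<close> with \<open>\<sigma>\<close>,
  \<open>d\<sigma>\<close> and vectors orthogonal to \<open>\<Lambda>\<^sup>(\<^sup>1\<^sup>)\<close> shows that the tensor \<open>(\<alpha>, d\<sigma>)\<close> is symmetric and tracefree and
  that \<open>\<alpha>\<close> has no normal part; so a closed \<open>\<eta>\<close> with \<open>[\<eta>] = q\<close> is \<open>\<sigma> \<and> d\<sigma>(Q)\<close>, where \<open>Q\<close> represents \<open>q\<close>
  with respect to the metric of \<open>\<sigma>\<close>. In two dimensions \<open>d\<sigma>(u) \<and> d\<sigma>(Q v)\<close> is symmetric in \<open>u\<close> and \<open>v\<close>, hence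
  \<open>d(\<sigma> \<and> d\<sigma>(Q)) = \<sigma> \<and> d(d\<sigma>(Q))\<close>; it vanishes iff \<open>d(d\<sigma>(Q))\<close> is a multiple of \<open>\<sigma>\<close>. The components of
  the latter along \<open>d\<sigma>\<close> and along the orthogonal complement of the central sphere congruence are \<open>dq\<close> and
  \<open>q \<and> S\<^sup>0\<close>. Finally the nilradical is abelian, so \<open>d + r\<eta>\<close> is flat for all \<open>r\<close> iff \<open>d\<eta> = 0\<close>.\<close>

section \<open>Calculus of smooth functions\<close>

text \<open>The central sphere congruence is specified only by uniqueness, so it has to be
  constructed. The trace of the second fundamental form of V is minus the V-orthogonal part of the
  trace of the second derivatives of \<sigma>. Hence V is central iff it contains that trace, and
  the span of \<sigma>, d\<sigma> and the trace is the only candidate. Rescaling \<sigma> or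
  changing the chart rescales the trace and adds terms in the span of \<sigma> and d\<sigma>, so the
  candidate is well defined. Condition (i) is quantified over all positive sections, whereas (ii)
  and (iii) ask for one form on the whole surface. Normalising the time component to 1 selects a
  global section, and its form \<sigma> \<and> d\<sigma>(Q) serves as \<eta>. Conversely, a closed
  \<eta> with class q equals \<sigma> \<and> d\<sigma>(Q) for every \<sigma> at once, which returns
  (i) for all sections. In \<eta> = \<sigma> \<and> \<alpha> the factor \<alpha> is determined only
  modulo \<sigma>; evaluating \<eta> at the fixed timelike vector (0, 1), which is never orthogonal
  to the cone, selects a smooth representative. The condition on so(V) in (iii) is automatic for the
  constructed form, since \<sigma> and d\<sigma>(Q) both lie in V.\<close>

lemma C_k_on_subset: "C_k_on k S f \<Longrightarrow> U \<subseteq> S \<Longrightarrow> C_k_on k U f"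
  by (induction k arbitrary: f) (auto intro: continuous_on_subset differentiable_on_subset)

lemma C_k_on_SucD: "C_k_on (Suc k) S f \<Longrightarrow> C_k_on k S f"
  by (induction k arbitrary: f) (auto simp: differentiable_imp_continuous_on)

text \<open>\<open>frechet_derivative\<close> is a choice among the derivatives at \<open>x\<close>,
  and \<open>f\<close> and \<open>g\<close> have the same ones; this covers points without a
  derivative as well.\<close>

lemma frechet_derivative_cong_open:
  assumes "open S" "x \<in> S" "\<And>y. y \<in> S \<Longrightarrow> f y = g y"
  shows "frechet_derivative f (at x) = frechet_derivative g (at x)"
proof -
  have "(f has_derivative D) (at x) \<longleftrightarrow> (g has_derivative D) (at x)" for D
    by (rule iffI; erule has_derivative_transform_within_open) (use assms in auto)
  then show ?thesis by (simp add: frechet_derivative_def)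
qed

lemma C_k_on_cong:
  assumes "open S" "\<And>y. y \<in> S \<Longrightarrow> f y = g y"
  shows "C_k_on k S f \<longleftrightarrow> C_k_on k S g"
  using assms(2)
proof (induction k arbitrary: f g)
  case 0
  then show ?case by (auto cong: continuous_on_cong)
next
  case (Suc k)
  have "f differentiable_on S \<longleftrightarrow> g differentiable_on S"
    using Suc.prems by (auto simp: differentiable_on_def intro: differentiable_transform_within[OF _ zero_less_one])
  moreover have "C_k_on k S (\<lambda>x. frechet_derivative f (at x) v) \<longleftrightarrow>
      C_k_on k S (\<lambda>x. frechet_derivative g (at x) v)" for v
    by (rule Suc.IH) (metis Suc.prems assms(1) frechet_derivative_cong_open)
  ultimately show ?case by simp
qed

lemma C_k_on_local:
  assumes "\<And>x. x \<in> S \<Longrightarrow> \<exists>N. open N \<and> x \<in> N \<and> N \<subseteq> S \<and> C_k_on k N f"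
  shows "C_k_on k S f"
  using assms
proof (induction k arbitrary: f)
  case 0
  then have "isCont f x" if "x \<in> S" for x
    using that by (metis C_k_on.simps(1) continuous_on_eq_continuous_at)
  then show ?case by (simp add: continuous_at_imp_continuous_on)
next
  case (Suc k)
  have "f differentiable at x" if "x \<in> S" for x
    using Suc.prems[OF that] by (auto simp: differentiable_on_eq_differentiable_at)
  moreover have "C_k_on k S (\<lambda>x. frechet_derivative f (at x) v)" for v
    by (rule Suc.IH) (use Suc.prems in fastforce)
  ultimately show ?case by (simp add: differentiable_at_imp_differentiable_on)
qed

lemma C_k_on_const: "C_k_on k S (\<lambda>x. c)"
  by (induction k arbitrary: c) auto

lemma C_k_on_add:
  assumes "open S" "C_k_on k S f" "C_k_on k S g"
  shows "C_k_on k S (\<lambda>x. f x + g x)"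
  using assms(2,3)
proof (induction k arbitrary: f g)
  case 0
  then show ?case by (simp add: continuous_on_add)
next
  case (Suc k)
  have "C_k_on k S (\<lambda>x. frechet_derivative (\<lambda>x. f x + g x) (at x) v)" for v
  proof -
    have "frechet_derivative (\<lambda>x. f x + g x) (at x) v
        = frechet_derivative f (at x) v + frechet_derivative g (at x) v" if "x \<in> S" for x
      using Suc.prems that assms(1)
      by (intro fun_cong[OF frechet_derivative_at[symmetric], THEN trans])
         (auto intro!: has_derivative_add simp: frechet_derivative_works[symmetric]
            differentiable_on_eq_differentiable_at)
    then show ?thesis
      using C_k_on_cong[OF assms(1), of "\<lambda>x. frechet_derivative (\<lambda>x. f x + g x) (at x) v"
          "\<lambda>x. frechet_derivative f (at x) v + frechet_derivative g (at x) v" k]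
        Suc by simp
  qed
  then show ?case using Suc.prems by (simp add: differentiable_on_add)
qed

lemma frechet_derivative_bounded_linear:
  assumes "bounded_linear h" "f differentiable at x"
  shows "frechet_derivative (\<lambda>x. h (f x)) (at x) v = h (frechet_derivative f (at x) v)"
  by (metis assms bounded_linear.has_derivative frechet_derivative_at frechet_derivative_works)

lemma C_k_on_bounded_linear:
  assumes "bounded_linear h" "open S" "C_k_on k S f"
  shows "C_k_on k S (\<lambda>x. h (f x))"
  using assms(3)
proof (induction k arbitrary: f)
  case 0
  then show ?case by (simp add: assms(1) bounded_linear.continuous_on)
next
  case (Suc k)
  have d: "f differentiable at x" if "x \<in> S" for x
    using Suc.prems assms(2) that by (simp add: differentiable_on_eq_differentiable_at)
  have "C_k_on k S (\<lambda>x. frechet_derivative (\<lambda>x. h (f x)) (at x) v)" for v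
    using C_k_on_cong[OF assms(2), of "\<lambda>x. frechet_derivative (\<lambda>x. h (f x)) (at x) v"
        "\<lambda>x. h (frechet_derivative f (at x) v)" k]
      Suc by (simp add: frechet_derivative_bounded_linear[OF assms(1) d])
  moreover have "(\<lambda>x. h (f x)) differentiable at x" if "x \<in> S" for x
    using d[OF that] assms(1) unfolding differentiable_def by (blast intro: bounded_linear.has_derivative)
  ultimately show ?case by (simp add: differentiable_at_imp_differentiable_on)
qed

lemma frechet_derivative_bounded_bilinear:
  assumes "bounded_bilinear h" "f differentiable at x" "g differentiable at x"
  shows "frechet_derivative (\<lambda>x. h (f x) (g x)) (at x) v
    = h (f x) (frechet_derivative g (at x) v) + h (frechet_derivative f (at x) v) (g x)"
proof -
  have "((\<lambda>x. h (f x) (g x)) has_derivative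
     (\<lambda>v. h (f x) (frechet_derivative g (at x) v) + h (frechet_derivative f (at x) v) (g x))) (at x)"
    using assms(2,3) by (intro bounded_bilinear.FDERIV[OF assms(1)]) (simp_all add: frechet_derivative_works[symmetric])
  from frechet_derivative_at[OF this] show ?thesis by metis
qed

lemma differentiable_bounded_bilinear:
  assumes "bounded_bilinear h" "f differentiable at x" "g differentiable at x"
  shows "(\<lambda>x. h (f x) (g x)) differentiable at x"
  using bounded_bilinear.FDERIV[OF assms(1)] assms(2,3) unfolding differentiable_def by blast

text \<open>Induction through the Leibniz rule; the undifferentiated factors enter with one order
  less, which \<open>C_k_on_SucD\<close> supplies.\<close>

lemma C_k_on_bounded_bilinear:
  assumes "bounded_bilinear h" "open S" "C_k_on k S f" "C_k_on k S g"
  shows "C_k_on k S (\<lambda>x. h (f x) (g x))"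
  using assms(3,4)
proof (induction k arbitrary: f g)
  case 0
  then show ?case by (simp add: assms(1) bounded_bilinear.continuous_on)
next
  case (Suc k)
  have d: "f differentiable at x" "g differentiable at x" if "x \<in> S" for x
    using Suc.prems assms(2) that by (simp_all add: differentiable_on_eq_differentiable_at)
  have "C_k_on k S (\<lambda>x. h (f x) (frechet_derivative g (at x) v) + h (frechet_derivative f (at x) v) (g x))" for v
    using Suc.prems Suc.IH C_k_on_SucD[OF Suc.prems(1)] C_k_on_SucD[OF Suc.prems(2)]
    by (intro C_k_on_add[OF assms(2)] Suc.IH) auto
  then have "C_k_on k S (\<lambda>x. frechet_derivative (\<lambda>x. h (f x) (g x)) (at x) v)" for v
    using C_k_on_cong[OF assms(2), of "\<lambda>x. frechet_derivative (\<lambda>x. h (f x) (g x)) (at x) v"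
        "\<lambda>x. h (f x) (frechet_derivative g (at x) v) + h (frechet_derivative f (at x) v) (g x)" k]
    by (simp add: frechet_derivative_bounded_bilinear[OF assms(1) d])
  then show ?case
    by (simp add: differentiable_at_imp_differentiable_on differentiable_bounded_bilinear[OF assms(1) d])
qed

lemma frechet_derivative_real_inverse:
  fixes f :: "'a::real_normed_vector \<Rightarrow> real"
  assumes "f differentiable at x" "f x \<noteq> 0"
  shows "frechet_derivative (\<lambda>x. inverse (f x)) (at x) v
    = - (inverse (f x) * frechet_derivative f (at x) v * inverse (f x))"
proof -
  have "((\<lambda>x. inverse (f x)) has_derivative
     (\<lambda>v. - (inverse (f x) * frechet_derivative f (at x) v * inverse (f x)))) (at x)"
    using assms by (intro Deriv.has_derivative_inverse) (simp_all add: frechet_derivative_works[symmetric])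
  from frechet_derivative_at[OF this] show ?thesis by metis
qed

text \<open>The derivative contains only \<open>inverse (f x)\<close> itself and the derivative of
  \<open>f\<close>, so the induction hypothesis on the inverse closes the step.\<close>

lemma C_k_on_inverse:
  fixes f :: "'a::euclidean_space \<Rightarrow> real"
  assumes "open S" "C_k_on k S f" "\<And>x. x \<in> S \<Longrightarrow> f x \<noteq> 0"
  shows "C_k_on k S (\<lambda>x. inverse (f x))"
  using assms(2)
proof (induction k)
  case 0
  then show ?case using assms(3) by (simp add: continuous_on_inverse)
next
  case (Suc k)
  have d: "f differentiable at x" if "x \<in> S" for x
    using Suc.prems assms(1) that by (simp add: differentiable_on_eq_differentiable_at)
  have i: "C_k_on k S (\<lambda>x. inverse (f x))"
    using Suc.IH C_k_on_SucD Suc.prems by blast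
  have "C_k_on k S (\<lambda>x. - (inverse (f x) * frechet_derivative f (at x) v * inverse (f x)))" for v
    using i Suc.prems
    by (intro C_k_on_bounded_linear[OF bounded_linear_minus[OF bounded_linear_ident]]
          C_k_on_bounded_bilinear[OF bounded_bilinear_mult] assms(1)) auto
  then have "C_k_on k S (\<lambda>x. frechet_derivative (\<lambda>x. inverse (f x)) (at x) v)" for v
    using C_k_on_cong[OF assms(1), of "\<lambda>x. frechet_derivative (\<lambda>x. inverse (f x)) (at x) v"
        "\<lambda>x. - (inverse (f x) * frechet_derivative f (at x) v * inverse (f x))" k]
    by (simp add: frechet_derivative_real_inverse[OF d assms(3)])
  moreover have "(\<lambda>x. inverse (f x)) differentiable at x" if "x \<in> S" for x
    using d[OF that] assms(3)[OF that] by simp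
  ultimately show ?case by (simp add: differentiable_at_imp_differentiable_on)
qed

lemma C_k_on_sum:
  assumes "open S" "\<And>i. i \<in> I \<Longrightarrow> C_k_on k S (f i)"
  shows "C_k_on k S (\<lambda>x. \<Sum>i\<in>I. f i x)"
proof (cases "finite I")
  case True
  then show ?thesis using assms(2)
    by (induction rule: finite_induct) (auto intro: C_k_on_add assms(1) C_k_on_const)
qed (simp add: C_k_on_const)

lemma frechet_derivative_chain:
  assumes "g differentiable at x" "f differentiable at (g x)"
  shows "frechet_derivative (\<lambda>x. f (g x)) (at x) v
    = frechet_derivative f (at (g x)) (frechet_derivative g (at x) v)"
  using frechet_derivative_compose[OF assms] by (simp add: comp_def)

text \<open>The class is defined through derivatives in fixed directions, but the chain rule
  differentiates \<open>f\<close> in a direction that varies with \<open>x\<close>. Expanding this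
  direction in \<open>Basis\<close> restores fixed directions with smooth coefficients.\<close>

lemma C_k_on_compose:
  fixes g :: "'a::euclidean_space \<Rightarrow> 'b::euclidean_space"
  assumes "open S" "open U" "g ` S \<subseteq> U" "C_k_on k S g" "C_k_on k U f"
  shows "C_k_on k S (\<lambda>x. f (g x))"
  using assms(4,5)
proof (induction k arbitrary: f)
  case 0
  then show ?case using assms(3) by (simp add: continuous_on_compose2)
next
  case (Suc k)
  have d: "g differentiable at x" "f differentiable at (g x)" if "x \<in> S" for x
    using Suc.prems assms(1-3) that by (auto simp: differentiable_on_eq_differentiable_at)
  have eq: "frechet_derivative (\<lambda>x. f (g x)) (at x) v =
      (\<Sum>b\<in>Basis. (frechet_derivative g (at x) v \<bullet> b) *\<^sub>R frechet_derivative f (at (g x)) b)"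
    if "x \<in> S" for x v
  proof -
    let ?w = "frechet_derivative g (at x) v"
    have "frechet_derivative f (at (g x)) ?w
        = frechet_derivative f (at (g x)) (\<Sum>b\<in>Basis. (?w \<bullet> b) *\<^sub>R b)"
      by (simp add: euclidean_representation)
    also have "\<dots> = (\<Sum>b\<in>Basis. (?w \<bullet> b) *\<^sub>R frechet_derivative f (at (g x)) b)"
      using linear_frechet_derivative[OF d(2)[OF that]] by (simp add: linear_sum linear_cmul)
    finally show ?thesis using frechet_derivative_chain[OF d[OF that]] by simp
  qed
  have "C_k_on k S (\<lambda>x. (frechet_derivative g (at x) v \<bullet> b) *\<^sub>R frechet_derivative f (at (g x)) b)"
    for v b
    using Suc.prems C_k_on_SucD[OF Suc.prems(1)]
    by (intro C_k_on_bounded_bilinear[OF bounded_bilinear_scaleR]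
        C_k_on_bounded_linear[OF bounded_linear_inner_left] assms(1) Suc.IH) auto
  then have "C_k_on k S (\<lambda>x. \<Sum>b\<in>Basis. (frechet_derivative g (at x) v \<bullet> b) *\<^sub>R
      frechet_derivative f (at (g x)) b)" for v
    by (intro C_k_on_sum assms(1))
  then have "C_k_on k S (\<lambda>x. frechet_derivative (\<lambda>x. f (g x)) (at x) v)" for v
    using C_k_on_cong[OF assms(1), of "\<lambda>x. frechet_derivative (\<lambda>x. f (g x)) (at x) v", OF eq]
    by simp
  moreover have "(\<lambda>x. f (g x)) differentiable at x" if "x \<in> S" for x
    using differentiable_chain_at[OF d[OF that]] by (simp add: comp_def)
  ultimately show ?case by (simp add: differentiable_at_imp_differentiable_on)
qed

lemma smooth_on_subset: "smooth_on S f \<Longrightarrow> U \<subseteq> S \<Longrightarrow> smooth_on U f"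
  unfolding smooth_on_def using C_k_on_subset by blast

lemma smooth_on_cong:
  assumes "open S" "\<And>y. y \<in> S \<Longrightarrow> f y = g y"
  shows "smooth_on S f \<longleftrightarrow> smooth_on S g"
  unfolding smooth_on_def using C_k_on_cong[OF assms] by simp

lemma smooth_on_local:
  assumes "\<And>x. x \<in> S \<Longrightarrow> \<exists>N. open N \<and> x \<in> N \<and> N \<subseteq> S \<and> smooth_on N f"
  shows "smooth_on S f"
proof -
  have "C_k_on k S f" for k
    by (rule C_k_on_local) (metis assms smooth_on_def)
  then show ?thesis by (simp add: smooth_on_def)
qed

lemma smooth_on_const: "smooth_on S (\<lambda>x. c)"
  by (simp add: smooth_on_def C_k_on_const)

lemma smooth_on_add:
  "open S \<Longrightarrow> smooth_on S f \<Longrightarrow> smooth_on S g \<Longrightarrow> smooth_on S (\<lambda>x. f x + g x)"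
  by (simp add: smooth_on_def C_k_on_add)

lemma smooth_on_bounded_linear:
  "bounded_linear h \<Longrightarrow> open S \<Longrightarrow> smooth_on S f \<Longrightarrow> smooth_on S (\<lambda>x. h (f x))"
  by (simp add: smooth_on_def C_k_on_bounded_linear)

lemma smooth_on_bounded_bilinear:
  "bounded_bilinear h \<Longrightarrow> open S \<Longrightarrow> smooth_on S f \<Longrightarrow> smooth_on S g \<Longrightarrow>
    smooth_on S (\<lambda>x. h (f x) (g x))"
  by (simp add: smooth_on_def C_k_on_bounded_bilinear)

lemmas smooth_on_scaleR = smooth_on_bounded_bilinear[OF bounded_bilinear_scaleR]
lemmas smooth_on_mult = smooth_on_bounded_bilinear[OF bounded_bilinear_mult]
lemmas smooth_on_minus = smooth_on_bounded_linear[OF bounded_linear_minus[OF bounded_linear_ident]]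

lemma smooth_on_diff:
  assumes "open S" "smooth_on S f" "smooth_on S g" 
  shows "smooth_on S (\<lambda>x. f x - g x)"
  using smooth_on_add[OF assms(1,2) smooth_on_minus[OF assms(1,3)]] by simp

lemma smooth_on_inverse:
  fixes f :: "'a::euclidean_space \<Rightarrow> real"
  shows "open S \<Longrightarrow> smooth_on S f \<Longrightarrow> (\<And>x. x \<in> S \<Longrightarrow> f x \<noteq> 0) \<Longrightarrow> smooth_on S (\<lambda>x. inverse (f x))"
  by (simp add: smooth_on_def C_k_on_inverse)

lemma smooth_on_compose:
  fixes g :: "'a::euclidean_space \<Rightarrow> 'b::euclidean_space"
  shows "open S \<Longrightarrow> open U \<Longrightarrow> g ` S \<subseteq> U \<Longrightarrow> smooth_on S g \<Longrightarrow> smooth_on U f \<Longrightarrow>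
    smooth_on S (\<lambda>x. f (g x))"
  by (simp add: smooth_on_def C_k_on_compose)

lemma smooth_on_deriv: "smooth_on S f \<Longrightarrow> smooth_on S (\<lambda>x. frechet_derivative f (at x) v)"
  unfolding smooth_on_def by (metis C_k_on.simps(2))

lemma smooth_on_differentiable:
  "open S \<Longrightarrow> smooth_on S f \<Longrightarrow> x \<in> S \<Longrightarrow> f differentiable at x"
  unfolding smooth_on_def by (metis C_k_on.simps(2) differentiable_on_eq_differentiable_at)

lemma smooth_on_continuous: "smooth_on S f \<Longrightarrow> continuous_on S f"
  unfolding smooth_on_def by (metis C_k_on.simps(1))

section \<open>Symmetry of second derivatives\<close>

lemma second_difference_eq:
  fixes f :: "'a::euclidean_space \<Rightarrow> real"
  assumes S: "open S" "smooth_on S f" and h: "h > 0"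
    and sub: "\<And>s t. \<bar>s\<bar> \<le> h \<Longrightarrow> \<bar>t\<bar> \<le> h \<Longrightarrow> x + s *\<^sub>R u + t *\<^sub>R v \<in> S"
  obtains s t where "0 < s" "s < h" "0 < t" "t < h"
    "f (x + h *\<^sub>R u + h *\<^sub>R v) - f (x + h *\<^sub>R u) - f (x + h *\<^sub>R v) + f x =
       h * h * frechet_derivative (\<lambda>y. frechet_derivative f (at y) u) (at (x + s *\<^sub>R u + t *\<^sub>R v)) v"
proof -
  have fd: "(f has_derivative frechet_derivative f (at y)) (at y)" if "y \<in> S" for y
    using smooth_on_differentiable[OF S that] frechet_derivative_works by blast
  let ?g = "\<lambda>y. frechet_derivative f (at y) u"
  have gd: "(?g has_derivative frechet_derivative ?g (at y)) (at y)" if "y \<in> S" for y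
    using smooth_on_differentiable[OF S(1) smooth_on_deriv[OF S(2)] that] frechet_derivative_works by blast
  \<comment> \<open>The second difference is the increment of \<open>\<phi>\<close> over
    \<open>[0, h]\<close>. The mean value theorem in the direction \<open>u\<close> turns it into an
    increment of the first derivative, to which the theorem is applied again in the direction
    \<open>v\<close>.\<close>
  define \<phi> where "\<phi> s = f (x + s *\<^sub>R u + h *\<^sub>R v) - f (x + s *\<^sub>R u)" for s
  have "(\<phi> has_real_derivative (?g (x + s *\<^sub>R u + h *\<^sub>R v) - ?g (x + s *\<^sub>R u))) (at s)"
    if "0 \<le> s" "s \<le> h" for s
  proof -
    have "x + s *\<^sub>R u + h *\<^sub>R v \<in> S" "x + s *\<^sub>R u + 0 *\<^sub>R v \<in> S"
      using that h by (intro sub; simp)+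
    then have in1: "x + s *\<^sub>R u + h *\<^sub>R v \<in> S" "x + s *\<^sub>R u \<in> S" by simp_all
    have l: "((\<lambda>s. x + s *\<^sub>R u + c) has_derivative (\<lambda>t. t *\<^sub>R u)) (at s)" for c
      by (auto intro!: derivative_eq_intros)
    have A: "((\<lambda>s. f (x + s *\<^sub>R u + h *\<^sub>R v)) has_derivative (\<lambda>t. frechet_derivative f (at (x + s *\<^sub>R u + h *\<^sub>R v)) (t *\<^sub>R u))) (at s)"
      using has_derivative_compose[OF l fd[OF in1(1)]] .
    have B: "((\<lambda>s. f (x + s *\<^sub>R u)) has_derivative (\<lambda>t. frechet_derivative f (at (x + s *\<^sub>R u)) (t *\<^sub>R u))) (at s)"
      using has_derivative_compose[OF l[of 0, simplified] fd[OF in1(2)]] .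
    have lin: "linear (frechet_derivative f (at y))" if "y \<in> S" for y
      using fd[OF that] has_derivative_linear by blast
    show ?thesis
      unfolding \<phi>_def has_field_derivative_def
      by (rule has_derivative_eq_rhs[OF has_derivative_diff[OF A B]])
         (simp add: fun_eq_iff linear_cmul[OF lin[OF in1(1)]] linear_cmul[OF lin[OF in1(2)]] right_diff_distrib mult.commute)
  qed
  then obtain s where s: "0 < s" "s < h"
    "\<phi> h - \<phi> 0 = (h - 0) * (?g (x + s *\<^sub>R u + h *\<^sub>R v) - ?g (x + s *\<^sub>R u))"
    using MVT2[OF h, of \<phi> "\<lambda>s. ?g (x + s *\<^sub>R u + h *\<^sub>R v) - ?g (x + s *\<^sub>R u)"] by auto
  define \<psi> where "\<psi> t = ?g (x + s *\<^sub>R u + t *\<^sub>R v)" for t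
  have "(\<psi> has_real_derivative (frechet_derivative ?g (at (x + s *\<^sub>R u + t *\<^sub>R v)) v)) (at t)"
    if "0 \<le> t" "t \<le> h" for t
  proof -
    have in1: "x + s *\<^sub>R u + t *\<^sub>R v \<in> S"
      using that h s by (intro sub; simp)
    have l: "((\<lambda>t. x + s *\<^sub>R u + t *\<^sub>R v) has_derivative (\<lambda>t. t *\<^sub>R v)) (at t)"
      by (auto intro!: derivative_eq_intros)
    have lin: "linear (frechet_derivative ?g (at (x + s *\<^sub>R u + t *\<^sub>R v)))"
      using gd[OF in1] has_derivative_linear by blast
    show ?thesis
      unfolding \<psi>_def has_field_derivative_def
      by (rule has_derivative_eq_rhs[OF has_derivative_compose[OF l gd[OF in1]]])
         (simp add: fun_eq_iff linear_cmul[OF lin] mult.commute)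
  qed
  then obtain t where t: "0 < t" "t < h"
    "\<psi> h - \<psi> 0 = (h - 0) * frechet_derivative ?g (at (x + s *\<^sub>R u + t *\<^sub>R v)) v"
    using MVT2[OF h, of \<psi> "\<lambda>t. frechet_derivative ?g (at (x + s *\<^sub>R u + t *\<^sub>R v)) v"] by auto
  show thesis
    by (rule that[of s t]) (use s t in \<open>auto simp: \<phi>_def \<psi>_def algebra_simps\<close>)
qed

text \<open>The second difference is symmetric in \<open>u\<close> and \<open>v\<close>, so both
  mixed derivatives take a common value, each at its own point of a small parallelogram at
  \<open>x\<close>. Continuity then compares their values at \<open>x\<close>.\<close>

lemma second_derivative_symmetric_real:
  fixes f :: "'a::euclidean_space \<Rightarrow> real"
  assumes S: "open S" "smooth_on S f" "x \<in> S"
  shows "frechet_derivative (\<lambda>y. frechet_derivative f (at y) u) (at x) v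
       = frechet_derivative (\<lambda>y. frechet_derivative f (at y) v) (at x) u"
proof -
  define P where "P u v y = frechet_derivative (\<lambda>y. frechet_derivative f (at y) u) (at y) v" for u v y
  have cont: "isCont (P u v) x" for u v
    using smooth_on_continuous[OF smooth_on_deriv[OF smooth_on_deriv[OF S(2)]]] S
    unfolding P_def by (metis continuous_on_eq_continuous_at)
  have "\<bar>P u v x - P v u x\<bar> < e" if "e > 0" for e
  proof -
    obtain d where d: "d > 0" "\<And>y. dist y x < d \<Longrightarrow> \<bar>P u v y - P u v x\<bar> < e/2"
        "\<And>y. dist y x < d \<Longrightarrow> \<bar>P v u y - P v u x\<bar> < e/2" "ball x d \<subseteq> S"
    proof -
      obtain d1 where "d1 > 0" "\<And>y. dist y x < d1 \<Longrightarrow> \<bar>P u v y - P u v x\<bar> < e/2"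
        using cont[of u v] \<open>e > 0\<close> unfolding continuous_at_eps_delta dist_real_def
        by (metis half_gt_zero)
      moreover obtain d2 where "d2 > 0" "\<And>y. dist y x < d2 \<Longrightarrow> \<bar>P v u y - P v u x\<bar> < e/2"
        using cont[of v u] \<open>e > 0\<close> unfolding continuous_at_eps_delta dist_real_def
        by (metis half_gt_zero)
      moreover obtain d3 where "d3 > 0" "ball x d3 \<subseteq> S" using S open_contains_ball by blast
      ultimately show thesis using that[of "min d1 (min d2 d3)"] by (auto simp: ball_def)
    qed
    \<comment> \<open>Small enough for the parallelogram to lie in the ball of radius
      \<open>d\<close>; the summand 1 keeps the denominator positive when \<open>u\<close> and
      \<open>v\<close> vanish.\<close>
    define h where "h = d / (2 * (norm u + norm v + 1))"
    have h: "h > 0" using d(1) by (simp add: h_def add_nonneg_pos)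
    have near: "dist (x + s *\<^sub>R u + t *\<^sub>R v) x < d" if "\<bar>s\<bar> \<le> h" "\<bar>t\<bar> \<le> h" for s t
    proof -
      have "dist (x + s *\<^sub>R u + t *\<^sub>R v) x \<le> \<bar>s\<bar> * norm u + \<bar>t\<bar> * norm v"
        by (simp add: dist_norm add.assoc) (metis norm_scaleR norm_triangle_ineq)
      also have "\<dots> \<le> h * norm u + h * norm v"
        using that by (intro add_mono mult_right_mono) auto
      also have "\<dots> < h * (2 * (norm u + norm v + 1))"
        using h mult_nonneg_nonneg[of h "norm u"] mult_nonneg_nonneg[of h "norm v"]
        unfolding distrib_left by (simp del: mult_nonneg_nonneg zero_le_mult_iff)
      also have "\<dots> = d"
        using norm_ge_zero[of u] norm_ge_zero[of v] unfolding h_def by (simp add: field_simps add_nonneg_eq_0_iff)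
      finally show ?thesis .
    qed
    have near': "dist (x + s *\<^sub>R v + t *\<^sub>R u) x < d" if "\<bar>s\<bar> \<le> h" "\<bar>t\<bar> \<le> h" for s t
      using near[OF that(2,1)] by (simp add: algebra_simps)
    have "x + s *\<^sub>R u + t *\<^sub>R v \<in> S" "x + s *\<^sub>R v + t *\<^sub>R u \<in> S" if "\<bar>s\<bar> \<le> h" "\<bar>t\<bar> \<le> h" for s t
      using near[OF that] near'[OF that] d(4) by (auto simp: ball_def dist_commute)
    note sub = this
    obtain s t where 1: "0 < s" "s < h" "0 < t" "t < h"
      "f (x + h *\<^sub>R u + h *\<^sub>R v) - f (x + h *\<^sub>R u) - f (x + h *\<^sub>R v) + f x =
       h * h * P u v (x + s *\<^sub>R u + t *\<^sub>R v)"
      unfolding P_def using second_difference_eq[OF S(1,2) h sub(1)] by metis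
    obtain s' t' where 2: "0 < s'" "s' < h" "0 < t'" "t' < h"
      "f (x + h *\<^sub>R v + h *\<^sub>R u) - f (x + h *\<^sub>R v) - f (x + h *\<^sub>R u) + f x =
       h * h * P v u (x + s' *\<^sub>R v + t' *\<^sub>R u)"
      unfolding P_def using second_difference_eq[OF S(1,2) h sub(2)] by metis
    have "x + h *\<^sub>R u + h *\<^sub>R v = x + h *\<^sub>R v + h *\<^sub>R u" by (simp add: algebra_simps)
    then have "h * h * P u v (x + s *\<^sub>R u + t *\<^sub>R v) = h * h * P v u (x + s' *\<^sub>R v + t' *\<^sub>R u)"
      using 1(5) 2(5) by (smt (verit))
    then have "P u v (x + s *\<^sub>R u + t *\<^sub>R v) = P v u (x + s' *\<^sub>R v + t' *\<^sub>R u)"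
      using h by simp
    moreover have "\<bar>P u v (x + s *\<^sub>R u + t *\<^sub>R v) - P u v x\<bar> < e/2"
      using 1 by (intro d(2) near) auto
    moreover have "\<bar>P v u (x + s' *\<^sub>R v + t' *\<^sub>R u) - P v u x\<bar> < e/2"
      using 2 by (intro d(3) near') auto
    ultimately show ?thesis by linarith
  qed
  then have "\<bar>P u v x - P v u x\<bar> \<le> 0" by (meson dual_order.irrefl not_le)
  then show ?thesis unfolding P_def by simp
qed

lemma second_derivative_symmetric:
  fixes f :: "'a::euclidean_space \<Rightarrow> 'b::euclidean_space"
  assumes S: "open S" "smooth_on S f" "x \<in> S"
  shows "frechet_derivative (\<lambda>y. frechet_derivative f (at y) u) (at x) v
       = frechet_derivative (\<lambda>y. frechet_derivative f (at y) v) (at x) u"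
proof (rule euclidean_eqI)
  fix b :: 'b
  have bl: "bounded_linear (\<lambda>y. y \<bullet> b)" by (rule bounded_linear_inner_left)
  have 1: "frechet_derivative (\<lambda>z. f z \<bullet> b) (at y) w = frechet_derivative f (at y) w \<bullet> b" if "y \<in> S" for y w
    using frechet_derivative_bounded_linear[OF bl smooth_on_differentiable[OF S(1,2) that]] .
  have 2: "frechet_derivative (\<lambda>y. frechet_derivative (\<lambda>z. f z \<bullet> b) (at y) u) (at x) v
     = frechet_derivative (\<lambda>y. frechet_derivative f (at y) u) (at x) v \<bullet> b" for u v
    using frechet_derivative_cong_open[OF S(1,3), of "\<lambda>y. frechet_derivative (\<lambda>z. f z \<bullet> b) (at y) u"
      "\<lambda>y. frechet_derivative f (at y) u \<bullet> b", OF 1]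
      frechet_derivative_bounded_linear[OF bl smooth_on_differentiable[OF S(1) smooth_on_deriv[OF S(2)] S(3)]]
    by simp
  show "frechet_derivative (\<lambda>y. frechet_derivative f (at y) u) (at x) v \<bullet> b
       = frechet_derivative (\<lambda>y. frechet_derivative f (at y) v) (at x) u \<bullet> b"
    using second_derivative_symmetric_real[OF S(1) smooth_on_bounded_linear[OF bl S(1,2)] S(3), of u v] 2
    by simp
qed

section \<open>Inner products on the plane\<close>

abbreviation (input) e1 :: "real^2" where "e1 \<equiv> axis 1 1"
abbreviation (input) e2 :: "real^2" where "e2 \<equiv> axis 2 1"

lemma real2_expand: "(u::real^2) = (u$1) *\<^sub>R e1 + (u$2) *\<^sub>R e2"
  by (simp add: vec_eq_iff axis_def forall_2)

lemma linear_real2: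
  assumes "linear f"
  shows "f (u::real^2) = (u$1) *\<^sub>R f e1 + (u$2) *\<^sub>R f e2"
  by (subst real2_expand) (simp add: linear_add[OF assms] linear_cmul[OF assms])

definition inner_prod2 :: "(real^2 \<Rightarrow> real^2 \<Rightarrow> real) \<Rightarrow> bool" where
  "inner_prod2 g \<longleftrightarrow> bilinear g \<and> (\<forall>u v. g u v = g v u) \<and> (\<forall>u. u \<noteq> 0 \<longrightarrow> g u u > 0)"

definition gdet :: "(real^2 \<Rightarrow> real^2 \<Rightarrow> real) \<Rightarrow> real" where
  "gdet g = g e1 e1 * g e2 e2 - g e1 e2 * g e1 e2"

text \<open>Cramer's rule for the vector representing \<open>\<phi>\<close>. The explicit formula,
  rather than a description by uniqueness, makes smooth dependence on \<open>g\<close> and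
  \<open>\<phi>\<close> visible.\<close>

definition riesz2 :: "(real^2 \<Rightarrow> real^2 \<Rightarrow> real) \<Rightarrow> (real^2 \<Rightarrow> real) \<Rightarrow> real^2" where
  "riesz2 g \<phi> = ((g e2 e2 * \<phi> e1 - g e1 e2 * \<phi> e2) / gdet g) *\<^sub>R e1
              + ((g e1 e1 * \<phi> e2 - g e1 e2 * \<phi> e1) / gdet g) *\<^sub>R e2"

lemmas bilinear_simps = bilinear_ladd bilinear_radd bilinear_lmul bilinear_rmul
  bilinear_lneg bilinear_rneg bilinear_lsub bilinear_rsub bilinear_lzero bilinear_rzero

lemma inner_prod2D:
  assumes "inner_prod2 g"
  shows "bilinear g" "g u v = g v u" "u \<noteq> 0 \<Longrightarrow> g u u > 0"
  using assms by (auto simp: inner_prod2_def)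

lemma inner_prod2_eq_0:
  assumes "inner_prod2 g" "\<And>y. g w y = 0"
  shows "w = 0"
  using assms unfolding inner_prod2_def by (metis less_irrefl)

lemma inner_prod2_cancel:
  assumes "inner_prod2 g" "\<And>y. g w y = g w' y"
  shows "w = w'"
  using inner_prod2_eq_0[OF assms(1), of "w - w'"] assms(2)
  by (simp add: bilinear_lsub[OF inner_prod2D(1)[OF assms(1)]])

text \<open>The component of \<open>e2\<close> orthogonal to \<open>e1\<close>, scaled by
  \<open>g e1 e1\<close>, has square length \<open>g e1 e1 * gdet g\<close>.\<close>

lemma gdet_pos:
  assumes "inner_prod2 g"
  shows "gdet g > 0"
proof -
  note bl = bilinear_simps[OF inner_prod2D(1)[OF assms]]
  have e: "e1 \<noteq> 0" by (simp add: axis_eq_0_iff)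
  have g11: "g e1 e1 > 0" using inner_prod2D(3)[OF assms e] .
  let ?u = "g e1 e1 *\<^sub>R e2 - g e1 e2 *\<^sub>R e1"
  have "?u $ 2 = g e1 e1" by (simp add: axis_def)
  then have "?u \<noteq> 0" using g11 by (metis less_irrefl zero_index)
  then have "g ?u ?u > 0" using inner_prod2D(3)[OF assms] by blast
  moreover have "g ?u ?u = g e1 e1 * gdet g"
    unfolding gdet_def using inner_prod2D(2)[OF assms, of e2 e1] by (simp add: bl algebra_simps)
  ultimately show ?thesis using g11 by (simp add: zero_less_mult_iff)
qed

lemma riesz2:
  assumes "inner_prod2 g" "linear \<phi>"
  shows "g (riesz2 g \<phi>) y = \<phi> y"
proof -
  note bl = bilinear_simps[OF inner_prod2D(1)[OF assms(1)]]
  have d: "gdet g \<noteq> 0" using gdet_pos[OF assms(1)] by simp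
  have s: "g e2 e1 = g e1 e2" using inner_prod2D(2)[OF assms(1)] .
  have "g (riesz2 g \<phi>) e1 = ((g e2 e2 * \<phi> e1 - g e1 e2 * \<phi> e2) * g e1 e1
      + (g e1 e1 * \<phi> e2 - g e1 e2 * \<phi> e1) * g e1 e2) / gdet g"
    "g (riesz2 g \<phi>) e2 = ((g e2 e2 * \<phi> e1 - g e1 e2 * \<phi> e2) * g e1 e2
      + (g e1 e1 * \<phi> e2 - g e1 e2 * \<phi> e1) * g e2 e2) / gdet g"
    by (simp_all add: riesz2_def bl s add_divide_distrib)
  moreover have "(g e2 e2 * \<phi> e1 - g e1 e2 * \<phi> e2) * g e1 e1
      + (g e1 e1 * \<phi> e2 - g e1 e2 * \<phi> e1) * g e1 e2 = \<phi> e1 * gdet g"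
    "(g e2 e2 * \<phi> e1 - g e1 e2 * \<phi> e2) * g e1 e2
      + (g e1 e1 * \<phi> e2 - g e1 e2 * \<phi> e1) * g e2 e2 = \<phi> e2 * gdet g"
    by (simp_all add: gdet_def algebra_simps)
  ultimately have "g (riesz2 g \<phi>) e1 = \<phi> e1 * gdet g / gdet g" "g (riesz2 g \<phi>) e2 = \<phi> e2 * gdet g / gdet g"
    by simp_all
  then have "g (riesz2 g \<phi>) e1 = \<phi> e1" "g (riesz2 g \<phi>) e2 = \<phi> e2" using d by simp_all
  moreover have "linear (g (riesz2 g \<phi>))"
    using inner_prod2D(1)[OF assms(1)] by (simp add: bilinear_def)
  ultimately show ?thesis
    using linear_real2[of "g (riesz2 g \<phi>)" y] linear_real2[OF assms(2), of y] by simp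
qed

lemma riesz2_unique:
  assumes "inner_prod2 g" "linear \<phi>" "\<And>y. g w y = \<phi> y"
  shows "w = riesz2 g \<phi>"
  by (rule inner_prod2_cancel[OF assms(1)]) (simp add: assms riesz2)

definition orthonormal2 :: "(real^2 \<Rightarrow> real^2 \<Rightarrow> real) \<Rightarrow> real^2 \<Rightarrow> real^2 \<Rightarrow> bool" where
  "orthonormal2 g x y \<longleftrightarrow> g x x = 1 \<and> g y y = 1 \<and> g x y = 0"

lemma orthonormal2_exists:
  assumes "inner_prod2 g"
  shows "\<exists>x y. orthonormal2 g x y"
proof -
  note bl = bilinear_simps[OF inner_prod2D(1)[OF assms]]
  have g11: "g e1 e1 > 0" using inner_prod2D(3)[OF assms] by (simp add: axis_eq_0_iff)
  let ?u = "g e1 e1 *\<^sub>R e2 - g e1 e2 *\<^sub>R e1"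
  have "?u $ 2 = g e1 e1" by (simp add: axis_def)
  then have "?u \<noteq> 0" using g11 by (metis less_irrefl zero_index)
  then have u: "g ?u ?u > 0" using inner_prod2D(3)[OF assms] by blast
  have o: "g e1 ?u = 0" by (simp add: bl)
  have "orthonormal2 g ((1 / sqrt (g e1 e1)) *\<^sub>R e1) ((1 / sqrt (g ?u ?u)) *\<^sub>R ?u)"
    unfolding orthonormal2_def using g11 u o by (simp only: bl(3,4)) simp
  then show ?thesis by blast
qed

lemma orthonormal2_expand:
  assumes "inner_prod2 g" "orthonormal2 g x y"
  shows "w = g w x *\<^sub>R x + g w y *\<^sub>R y"
proof -
  note bl = bilinear_simps[OF inner_prod2D(1)[OF assms(1)]]
  have o: "g x x = 1" "g y y = 1" "g x y = 0" "g y x = 0"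
    using assms(2) inner_prod2D(2)[OF assms(1), of y x] by (auto simp: orthonormal2_def)
  let ?L = "\<lambda>s::real^2. s$1 *\<^sub>R x + s$2 *\<^sub>R y"
  have lin: "linear ?L" by (auto intro!: linearI simp: algebra_simps)
  have c: "g (?L s) x = s$1" "g (?L s) y = s$2" for s by (simp_all add: bl o)
  \<comment> \<open>Pairing with \<open>x\<close> and \<open>y\<close> recovers the coefficients;
    injectivity between spaces of equal dimension then gives surjectivity.\<close>
  have "inj ?L"
  proof (rule injI)
    fix s t assume "?L s = ?L t"
    then have "s$1 = t$1" "s$2 = t$2" using c[of s] c[of t] by simp_all
    then show "s = t" by (simp add: vec_eq_iff forall_2)
  qed
  then obtain s where s: "w = ?L s" using linear_injective_imp_surjective[OF lin] by blast
  show ?thesis unfolding s by (simp add: bl o)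
qed

text \<open>The right side is the contraction of \<open>b\<close> with the inverse matrix of
  \<open>g\<close>, which does not mention the frame. Hence the value is the same for all
  orthonormal frames, as the description in \<open>metric_trace\<close> demands. In the proof
  \<open>e1\<close> and \<open>e2\<close> are expanded in the frame, and \<open>gdet g\<close>
  becomes the square of the determinant of the coefficients.\<close>

lemma orthonormal_trace:
  assumes g: "inner_prod2 g" "orthonormal2 g x y" and b: "bilinear b"
  shows "b x x + b y y = (1 / gdet g) *\<^sub>R
    (g e2 e2 *\<^sub>R b e1 e1 - g e1 e2 *\<^sub>R (b e1 e2 + b e2 e1) + g e1 e1 *\<^sub>R b e2 e2)"
proof -
  note bl = bilinear_simps[OF inner_prod2D(1)[OF g(1)]]
  have o: "g x x = 1" "g y y = 1" "g x y = 0" "g y x = 0"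
    using g(2) inner_prod2D(2)[OF g(1), of y x] by (auto simp: orthonormal2_def)
  obtain a1 c1 where E1: "e1 = a1 *\<^sub>R x + c1 *\<^sub>R y" using orthonormal2_expand[OF g] by blast
  obtain a2 c2 where E2: "e2 = a2 *\<^sub>R x + c2 *\<^sub>R y" using orthonormal2_expand[OF g] by blast
  have G: "g e1 e1 = a1 * a1 + c1 * c1" "g e1 e2 = a1 * a2 + c1 * c2" "g e2 e2 = a2 * a2 + c2 * c2"
    unfolding E1 E2 by (simp_all add: bl o)
  have D: "gdet g = (a1 * c2 - a2 * c1)\<^sup>2"
    unfolding gdet_def G by (simp add: power2_eq_square algebra_simps)
  have "g e2 e2 *\<^sub>R b e1 e1 - g e1 e2 *\<^sub>R (b e1 e2 + b e2 e1) + g e1 e1 *\<^sub>R b e2 e2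
     = gdet g *\<^sub>R (b x x + b y y)"
    unfolding G D unfolding E1 E2 bilinear_simps[OF b]
    by (simp add: algebra_simps power2_eq_square)
       (simp add: scaleR_2 scaleR_add_right add_ac flip: scaleR_scaleR)
  then show ?thesis using gdet_pos[OF g(1)] by simp
qed

lemma metric_trace_orthonormal:
  assumes "inner_prod2 g" "orthonormal2 g x y" "bilinear b"
  shows "metric_trace g b = b x x + b y y"
  unfolding metric_trace_def
proof (rule the_equality)
  show "\<forall>e1 e2. g e1 e1 = 1 \<and> g e2 e2 = 1 \<and> g e1 e2 = 0 \<longrightarrow> b x x + b y y = b e1 e1 + b e2 e2"
    unfolding orthonormal2_def[symmetric] orthonormal_trace[OF assms]
    by (intro allI impI orthonormal_trace[OF assms(1) _ assms(3), symmetric])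
next
  fix t assume "\<forall>e1 e2. g e1 e1 = 1 \<and> g e2 e2 = 1 \<and> g e1 e2 = 0 \<longrightarrow> t = b e1 e1 + b e2 e2"
  then show "t = b x x + b y y" using assms(2) by (simp add: orthonormal2_def)
qed

lemma metric_trace_coord:
  assumes "inner_prod2 g" "bilinear b"
  shows "metric_trace g b = (1 / gdet g) *\<^sub>R
    (g e2 e2 *\<^sub>R b e1 e1 - g e1 e2 *\<^sub>R (b e1 e2 + b e2 e1) + g e1 e1 *\<^sub>R b e2 e2)"
  using metric_trace_orthonormal[OF assms(1) _ assms(2)] orthonormal_trace[OF assms(1) _ assms(2)]
    orthonormal2_exists[OF assms(1)] by metis

lemma bilinear_compose_linear:
  assumes "bilinear b" "linear h"
  shows "bilinear (\<lambda>u v. h (b u v))"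
proof -
  have "linear (\<lambda>v. h (b u v))" "linear (\<lambda>u. h (b u v))" for u v
    using assms linear_compose[of "b u" h] linear_compose[of "\<lambda>u. b u v" h]
    by (simp_all add: bilinear_def comp_def)
  then show ?thesis by (simp add: bilinear_def)
qed

text \<open>Meant for the projection onto the complement of a sphere congruence, which is thereby
  moved out of the trace of its second fundamental form.\<close>

lemma metric_trace_linear:
  assumes "inner_prod2 g" "bilinear b" "linear h"
  shows "metric_trace g (\<lambda>u v. h (b u v)) = h (metric_trace g b)"
proof -
  obtain x y where "orthonormal2 g x y" using orthonormal2_exists[OF assms(1)] by blast
  then show ?thesis
    using metric_trace_orthonormal[OF assms(1) _ assms(2)] linear_add[OF assms(3)]
      metric_trace_orthonormal[OF assms(1) _ bilinear_compose_linear[OF assms(2,3)]] by simp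
qed

section \<open>Lorentzian algebra\<close>

lemma lor_commute: "lor v w = lor w v"
  by (simp add: lor_def inner_commute)

lemma bounded_bilinear_lor: "bounded_bilinear lor"
proof -
  have "bilinear lor"
    unfolding bilinear_def by (auto intro!: linearI simp: lor_def inner_simps algebra_simps)
  then show ?thesis by (simp add: bilinear_conv_bounded_bilinear)
qed

lemmas lor_simps =
  bounded_bilinear.add_left[OF bounded_bilinear_lor] bounded_bilinear.add_right[OF bounded_bilinear_lor]
  bounded_bilinear.diff_left[OF bounded_bilinear_lor] bounded_bilinear.diff_right[OF bounded_bilinear_lor]
  bounded_bilinear.minus_left[OF bounded_bilinear_lor] bounded_bilinear.minus_right[OF bounded_bilinear_lor]
  bounded_bilinear.scaleR_left[OF bounded_bilinear_lor, simplified]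
  bounded_bilinear.scaleR_right[OF bounded_bilinear_lor, simplified]
  bounded_bilinear.zero_left[OF bounded_bilinear_lor] bounded_bilinear.zero_right[OF bounded_bilinear_lor]

lemma linear_lor_right: "linear (lor v)"
  by (rule linearI) (simp_all add: lor_simps)

lemma lor_nondegenerate:
  assumes "\<And>y. lor x y = 0"
  shows "x = 0"
proof -
  \<comment> \<open>Reversing the time component of the second argument turns the form into the
    Euclidean square norm.\<close>
  have "lor x (fst x, - snd x) = fst x \<bullet> fst x + snd x * snd x" by (simp add: lor_def)
  then have "fst x \<bullet> fst x + snd x * snd x = 0" using assms by simp
  then show ?thesis by (simp add: add_nonneg_eq_0_iff prod_eq_iff)
qed

lemma lor_span_zero:
  assumes "x \<in> span S" "\<And>z. z \<in> S \<Longrightarrow> lor y z = 0"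
  shows "lor y x = 0"
  using assms(1) by (induction rule: span_induct_alt) (simp_all add: assms(2) lor_simps)

text \<open>Subtracting the multiple of \<open>s\<close> with the same time component leaves
  \<open>lor x x\<close> unchanged, because \<open>s\<close> is null and orthogonal to
  \<open>x\<close>, and yields a vector without time component, on which the form is positive
  definite.\<close>

lemma null_orthogonal:
  assumes "s \<in> half_cone" "lor s x = 0"
  shows "lor x x \<ge> 0" "lor x x = 0 \<Longrightarrow> x = (snd x / snd s) *\<^sub>R s"
proof -
  have s: "lor s s = 0" "snd s > 0" using assms(1) by (auto simp: half_cone_def)
  define y where "y = x - (snd x / snd s) *\<^sub>R s"
  have "snd y = 0" using s by (simp add: y_def)
  then have y: "lor y y = fst y \<bullet> fst y" by (simp add: lor_def)
  have x: "lor x x = lor y y"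
    unfolding y_def using s(1) assms(2) lor_commute[of x s] by (simp add: lor_simps)
  show "lor x x \<ge> 0" using x y by simp
  show "x = (snd x / snd s) *\<^sub>R s" if "lor x x = 0"
  proof -
    have "y = 0" using that x y \<open>snd y = 0\<close> by (simp add: prod_eq_iff)
    then show ?thesis by (simp add: y_def)
  qed
qed

text \<open>A basis of a space of signature (3,1) adapted to the null line of \<open>s\<close>: an
  orthonormal spacelike pair and a second null vector \<open>m\<close> paired with \<open>s\<close>
  to -1. In the application \<open>a\<close> and \<open>b\<close> are derivatives of the section
  \<open>s\<close>.\<close>

definition null_frame :: "(real^'m) \<times> real \<Rightarrow> (real^'m) \<times> real \<Rightarrow> (real^'m) \<times> real \<Rightarrow>
    (real^'m) \<times> real \<Rightarrow> bool" where
  "null_frame s a b m \<longleftrightarrow> lor s s = 0 \<and> lor m m = 0 \<and> lor s m = -1 \<and> lor a a = 1 \<and> lor b b = 1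
     \<and> lor a b = 0 \<and> lor s a = 0 \<and> lor s b = 0 \<and> lor m a = 0 \<and> lor m b = 0"

lemma null_frame_simps:
  assumes "null_frame s a b m"
  shows "lor s s = 0" "lor m m = 0" "lor s m = -1" "lor m s = -1" "lor a a = 1" "lor b b = 1"
    "lor a b = 0" "lor b a = 0" "lor s a = 0" "lor a s = 0" "lor s b = 0" "lor b s = 0"
    "lor m a = 0" "lor a m = 0" "lor m b = 0" "lor b m = 0"
  using assms lor_commute[of m s] lor_commute[of b a] lor_commute[of a s] lor_commute[of b s]
    lor_commute[of a m] lor_commute[of b m] unfolding null_frame_def by auto

text \<open>The orthogonal projection onto the span of a null frame. The coefficient of
  \<open>s\<close> is read off by pairing with \<open>m\<close> and vice versa, with a minus sign
  because \<open>lor s m = -1\<close>.\<close>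

definition frame_proj :: "(real^'m) \<times> real \<Rightarrow> (real^'m) \<times> real \<Rightarrow> (real^'m) \<times> real \<Rightarrow>
    (real^'m) \<times> real \<Rightarrow> (real^'m) \<times> real \<Rightarrow> (real^'m) \<times> real" where
  "frame_proj s a b m w =
     lor w a *\<^sub>R a + lor w b *\<^sub>R b - lor w m *\<^sub>R s - lor w s *\<^sub>R m"

lemma linear_frame_proj: "linear (frame_proj s a b m)"
  by (rule linearI) (simp_all add: frame_proj_def lor_simps algebra_simps)

lemma frame_proj_in: "frame_proj s a b m w \<in> span {s, a, b, m}"
  unfolding frame_proj_def by (intro span_add span_diff span_scale) (auto intro: span_base)

lemma lor_perp_span_iff: "v \<in> lor_perp (span S) \<longleftrightarrow> (\<forall>w\<in>S. lor v w = 0)"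
  unfolding lor_perp_def using lor_span_zero[of _ S v] by (auto intro: span_base)

lemma frame_proj_perp:
  assumes "null_frame s a b m"
  shows "w - frame_proj s a b m w \<in> lor_perp (span {s, a, b, m})"
  by (simp add: lor_perp_span_iff frame_proj_def lor_simps null_frame_simps[OF assms])

lemma frame_proj_id:
  assumes "null_frame s a b m" "w \<in> span {s, a, b, m}"
  shows "frame_proj s a b m w = w"
  using assms(2)
proof (induction rule: span_induct_alt)
  case base
  then show ?case by (simp add: frame_proj_def lor_simps)
next
  case (step c x y)
  then show ?case using linear_frame_proj[of s a b m]
    by (auto simp: linear_add linear_cmul frame_proj_def[of s a b m x] null_frame_simps[OF assms(1)])
qed

lemma frame_proj_of_perp:
  assumes "w \<in> lor_perp (span {s, a, b, m})"
  shows "frame_proj s a b m w = 0"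
  using assms by (simp add: lor_perp_span_iff frame_proj_def)

lemma perp_part_frame:
  assumes "null_frame s a b m"
  shows "perp_part (span {s, a, b, m}) w = w - frame_proj s a b m w"
  unfolding perp_part_def
proof (rule the_equality)
  show "w - frame_proj s a b m w \<in> lor_perp (span {s, a, b, m})
      \<and> w - (w - frame_proj s a b m w) \<in> span {s, a, b, m}"
    using frame_proj_perp[OF assms] frame_proj_in by simp
  fix z assume z: "z \<in> lor_perp (span {s, a, b, m}) \<and> w - z \<in> span {s, a, b, m}"
  then have "w - z = frame_proj s a b m (w - z)"
    by (simp add: frame_proj_id[OF assms])
  then show "z = w - frame_proj s a b m w"
    using z by (simp add: linear_diff[OF linear_frame_proj] frame_proj_of_perp algebra_simps)
qed

text \<open>Each vector is separated from the later ones by a pairing: \<open>a\<close> and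
  \<open>b\<close> with themselves, \<open>s\<close> with \<open>m\<close>.\<close>

lemma null_frame_independent:
  assumes "null_frame s a b m"
  shows "independent {s, a, b, m}" "card {s, a, b, m} = 4"
proof -
  note f = null_frame_simps[OF assms]
  have 1: "m \<notin> span {}" using f by (auto simp: lor_simps)
  have 2: "b \<notin> span {m}" using lor_span_zero[of b "{m}" b] f by auto
  have 3: "a \<notin> span {b, m}" using lor_span_zero[of a "{b, m}" a] f by auto
  have 4: "s \<notin> span {a, b, m}" using lor_span_zero[of s "{a, b, m}" m] f by auto
  show "independent {s, a, b, m}"
    using 1 2 3 4 by (intro independent_insertI) (auto simp: independent_empty)
  have "m \<noteq> b" "a \<notin> {b, m}" "s \<notin> {a, b, m}"
    using 2 3 4 by (metis insertI1 span_base, metis span_base, metis span_base)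
  then show "card {s, a, b, m} = 4" by auto
qed

lemma null_frame_dim:
  assumes "null_frame s a b m"
  shows "dim (span {s, a, b, m}) = 4"
  using null_frame_independent[OF assms] by (simp add: dim_eq_card_independent)

lemma null_frame_span_eq:
  assumes "null_frame s a b m" "subspace W" "dim W = 4" "{s, a, b, m} \<subseteq> W"
  shows "W = span {s, a, b, m}"
  using subspace_dim_equal[OF subspace_span assms(2)] assms null_frame_dim[OF assms(1)]
  by (metis order_refl span_minimal)

lemma null_frame_signature:
  assumes "null_frame s a b m"
  shows "has_signature (span {s, a, b, m}) 3 1"
proof -
  note f = null_frame_simps[OF assms]
  \<comment> \<open>The difference has square 2 and the sum has square -2, and they are orthogonal;
    the difference joins \<open>a\<close> and \<open>b\<close> in the positive part.\<close>
  let ?p = "s - m" and ?n = "s + m"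
  have g: "lor ?p ?p = 2" "lor ?n ?n = -2" "lor ?p ?n = 0" "lor a ?p = 0" "lor b ?p = 0"
      "lor a ?n = 0" "lor b ?n = 0" "lor ?p a = 0" "lor ?p b = 0"
    by (simp_all add: lor_simps f)
  have 1: "?p \<notin> span {}" using g by (auto simp: lor_simps)
  have 2: "b \<notin> span {?p}" using lor_span_zero[of b "{?p}" b] f g by force
  have 3: "a \<notin> span {b, ?p}" using lor_span_zero[of a "{b, ?p}" a] f g by force
  have ind: "independent {a, b, ?p}"
    using 1 2 3 by (intro independent_insertI) (auto simp: independent_empty)
  have "b \<noteq> ?p" "a \<notin> {b, ?p}" using 2 3 by (metis insertI1 span_base, metis span_base)
  then have "card {a, b, ?p} = 3" by auto
  then have dP: "dim (span {a, b, ?p}) = 3" using ind by (simp add: dim_eq_card_independent)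
  have n0: "?n \<noteq> 0" using g(2) lor_simps(9)[of ?n] by fastforce
  then have dN: "dim (span {?n}) = 1" by (simp add: dim_eq_card_independent)
  have P: "\<exists>x y z. v = x *\<^sub>R a + y *\<^sub>R b + z *\<^sub>R ?p" if "v \<in> span {a, b, ?p}" for v
  proof -
    have "\<exists>x y. v - x *\<^sub>R a - y *\<^sub>R b \<in> span {?p}"
      using that by (simp only: span_breakdown_eq[of _ a] span_breakdown_eq[of _ b])
    then obtain x y where "v - x *\<^sub>R a - y *\<^sub>R b \<in> span {?p}" by blast
    then obtain z where "v - x *\<^sub>R a - y *\<^sub>R b = z *\<^sub>R ?p" by (auto simp: span_singleton)
    then have "v = x *\<^sub>R a + y *\<^sub>R b + z *\<^sub>R ?p" by (simp add: algebra_simps)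
    then show ?thesis by blast
  qed
  have N: "\<exists>x. v = x *\<^sub>R ?n" if "v \<in> span {?n}" for v
    using that by (auto simp: span_singleton)
  have posP: "lor v v > 0" if v': "v \<in> span {a, b, ?p}" "v \<noteq> 0" for v
  proof -
    obtain x y z where v: "v = x *\<^sub>R a + y *\<^sub>R b + z *\<^sub>R ?p" using P[OF v'(1)] by blast
    have "lor v v = x * x + y * y + 2 * (z * z)"
      unfolding v by (simp add: lor_simps f algebra_simps)
    moreover have "x \<noteq> 0 \<or> y \<noteq> 0 \<or> z \<noteq> 0" using that(2) v by auto
    ultimately show ?thesis
      using not_real_square_gt_zero[of x] not_real_square_gt_zero[of y] not_real_square_gt_zero[of z]
        zero_le_square[of x] zero_le_square[of y] zero_le_square[of z] by linarith
  qed
  have negN: "lor v v < 0" if v': "v \<in> span {?n}" "v \<noteq> 0" for v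
  proof -
    obtain x where v: "v = x *\<^sub>R ?n" using N[OF v'(1)] by blast
    then have "lor v v = - 2 * (x * x)" using g by (simp only: lor_simps(7,8))
    moreover have "x \<noteq> 0" using that(2) v by auto
    ultimately show ?thesis using not_real_square_gt_zero[of x] by linarith
  qed
  have orth: "lor v w = 0" if vw: "v \<in> span {a, b, ?p}" "w \<in> span {?n}" for v w
  proof -
    obtain x y z where v: "v = x *\<^sub>R a + y *\<^sub>R b + z *\<^sub>R ?p" using P[OF vw(1)] by blast
    obtain t where w: "w = t *\<^sub>R ?n" using N[OF vw(2)] by blast
    show ?thesis unfolding v w using g by (simp only: lor_simps(1,7,8)) simp
  qed
  have "span {s, a, b, m} = span ({a, b, ?p} \<union> {?n})"
  proof (rule iffD2[OF span_eq], intro conjI)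
    have pn: "?p \<in> span ({a, b, ?p} \<union> {?n})" "?n \<in> span ({a, b, ?p} \<union> {?n})"
      by (auto intro: span_base)
    have "(1/2) *\<^sub>R ?p + (1/2) *\<^sub>R ?n \<in> span ({a, b, ?p} \<union> {?n})"
      "(1/2) *\<^sub>R ?n - (1/2) *\<^sub>R ?p \<in> span ({a, b, ?p} \<union> {?n})"
      using span_add[OF span_scale[OF pn(1)] span_scale[OF pn(2)]]
        span_diff[OF span_scale[OF pn(2)] span_scale[OF pn(1)]] by blast+
    moreover have "(1/2) *\<^sub>R ?p + (1/2) *\<^sub>R ?n = s" "(1/2) *\<^sub>R ?n - (1/2) *\<^sub>R ?p = m"
      by (simp_all add: algebra_simps flip: scaleR_add_left)
    ultimately show "{s, a, b, m} \<subseteq> span ({a, b, ?p} \<union> {?n})" by (auto intro: span_base)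
    have "?p \<in> span {s, a, b, m}" "?n \<in> span {s, a, b, m}"
      by (intro span_add span_diff; auto intro: span_base)+
    then show "{a, b, ?p} \<union> {?n} \<subseteq> span {s, a, b, m}" by (auto intro: span_base)
  qed
  then have "span {s, a, b, m} = {v + w |v w. v \<in> span {a, b, ?p} \<and> w \<in> span {?n}}"
    by (simp only: span_Un)
  then show ?thesis unfolding has_signature_def
    using dP dN posP negN orth by (intro exI[of _ "span {a, b, ?p}"] exI[of _ "span {?n}"]) auto
qed

lemma signature_nondegenerate:
  assumes "has_signature W k l" "x \<in> W" "\<And>y. y \<in> W \<Longrightarrow> lor x y = 0"
  shows "x = 0"
proof -
  obtain P N where PN: "subspace P" "subspace N" "\<forall>v\<in>P. v \<noteq> 0 \<longrightarrow> lor v v > 0"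
    "\<forall>v\<in>N. v \<noteq> 0 \<longrightarrow> lor v v < 0" "\<forall>v\<in>P. \<forall>w\<in>N. lor v w = 0"
    "W = {v + w | v w. v \<in> P \<and> w \<in> N}"
    using assms(1) unfolding has_signature_def by blast
  obtain v w where vw: "x = v + w" "v \<in> P" "w \<in> N" using PN(6) assms(2) by blast
  have "v + 0 \<in> W" "0 + w \<in> W"
    unfolding PN(6) using vw subspace_0[OF PN(1)] subspace_0[OF PN(2)] by blast+
  then have "v \<in> W" "w \<in> W" by simp_all
  then have "lor x v = 0" "lor x w = 0" using assms(3) by auto
  then have "lor v v = 0" "lor w w = 0"
    using vw PN(5) lor_commute[of w v] by (auto simp: lor_simps)
  then show ?thesis using PN(3,4) vw by force
qed

text \<open>From \<open>x\<close> the components along \<open>a\<close> and \<open>b\<close> are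
  removed and the rest is scaled to pair to -1 with \<open>s\<close>, giving \<open>y\<close>.
  Adding \<open>c *\<^sub>R s\<close> changes the square of \<open>y\<close> by -2c without
  affecting these pairings, so c is half the square of \<open>y\<close>.\<close>

lemma null_frame_exists:
  assumes "lor s s = 0" "lor a a = 1" "lor b b = 1" "lor a b = 0" "lor s a = 0" "lor s b = 0"
    and x: "lor s x \<noteq> 0"
  shows "\<exists>m. null_frame s a b m \<and> m \<in> span {s, a, b, x}"
proof -
  define y where "y = (- 1 / lor s x) *\<^sub>R (x - lor a x *\<^sub>R a - lor b x *\<^sub>R b)"
  define m where "m = y + (lor y y / 2) *\<^sub>R s"
  have c: "lor b a = 0" "lor a s = 0" "lor b s = 0" using assms lor_commute by metis+
  have y: "lor s y = -1" "lor a y = 0" "lor b y = 0"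
    unfolding y_def using assms c by (simp_all add: lor_simps)
  then have y': "lor y s = -1" "lor y a = 0" "lor y b = 0" using lor_commute by metis+
  have "null_frame s a b m"
    unfolding null_frame_def m_def using assms y y' by (simp add: lor_simps)
  moreover have "m \<in> span {s, a, b, x}"
    unfolding m_def y_def by (intro span_add span_diff span_scale) (auto intro: span_base)
  ultimately show ?thesis by blast
qed

lemma null_frame_in_signature:
  assumes "has_signature W 3 1" "subspace W" "dim W = 4" "s \<noteq> 0" "{s, a, b} \<subseteq> W"
    "lor s s = 0" "lor a a = 1" "lor b b = 1" "lor a b = 0" "lor s a = 0" "lor s b = 0"
  shows "\<exists>m. null_frame s a b m \<and> W = span {s, a, b, m}"
proof -
  obtain x where x: "x \<in> W" "lor s x \<noteq> 0"
    using signature_nondegenerate[OF assms(1), of s] assms(4,5) by blast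
  obtain m where m: "null_frame s a b m" "m \<in> span {s, a, b, x}"
    using null_frame_exists[OF assms(6-11) x(2)] by blast
  have "span {s, a, b, x} \<subseteq> W" using x(1) assms(2,5) by (intro span_minimal) auto
  then show ?thesis using null_frame_span_eq[OF m(1) assms(2,3)] m assms(5) by blast
qed

text \<open>The projection of \<open>w\<close> to the frame is a multiple of \<open>s\<close>. The
  remainder is orthogonal to the frame and, by \<open>xi\<close>, to its complement, so
  nondegeneracy of the form makes it vanish.\<close>

lemma null_frame_span_criterion:
  assumes "null_frame s a b m" "lor w s = 0" "lor w a = 0" "lor w b = 0"
    and xi: "\<And>\<xi>. \<xi> \<in> lor_perp (span {s, a, b, m}) \<Longrightarrow> lor w \<xi> = 0"
  shows "w = - lor w m *\<^sub>R s"
proof -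
  let ?P = "frame_proj s a b m"
  let ?\<xi> = "w - ?P w"
  have P: "?P w = - lor w m *\<^sub>R s" by (simp add: frame_proj_def assms)
  have "lor ?\<xi> y = 0" for y
  proof -
    have "lor ?\<xi> (?P y) = 0"
      using frame_proj_perp[OF assms(1)] frame_proj_in unfolding lor_perp_def by blast
    moreover have "lor ?\<xi> (y - ?P y) = 0"
    proof -
      have "lor w (y - ?P y) = 0" using xi frame_proj_perp[OF assms(1)] by blast
      moreover have "lor s (y - ?P y) = 0"
        using frame_proj_perp[OF assms(1), of y] lor_commute[of s] by (simp add: lor_perp_span_iff)
      ultimately show ?thesis unfolding P by (simp add: lor_simps)
    qed
    ultimately show ?thesis by (simp add: lor_simps)
  qed
  then have "?\<xi> = 0" by (rule lor_nondegenerate)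
  then show ?thesis using P eq_iff_diff_eq_0 by metis
qed

section \<open>The nilradical of the stabiliser of a null line\<close>

definition wedge :: "(real^'m) \<times> real \<Rightarrow> (real^'m) \<times> real \<Rightarrow>
    ((real^'m) \<times> real) \<Rightarrow>\<^sub>L ((real^'m) \<times> real)" where
  "wedge a b = Blinfun (\<lambda>v. lor a v *\<^sub>R b - lor b v *\<^sub>R a)"

lemma wedge_apply: "blinfun_apply (wedge a b) v = lor a v *\<^sub>R b - lor b v *\<^sub>R a"
proof -
  have "linear (\<lambda>v. lor a v *\<^sub>R b - lor b v *\<^sub>R a)"
    by (rule linearI) (simp_all add: lor_simps algebra_simps)
  then show ?thesis
    unfolding wedge_def by (simp add: bounded_linear_Blinfun_apply linear_conv_bounded_linear)
qed

lemma bounded_bilinear_wedge: "bounded_bilinear wedge"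
proof -
  have "bilinear wedge"
    unfolding bilinear_def
    by (intro conjI allI linearI blinfun_eqI)
       (simp_all add: wedge_apply lor_simps blinfun.add_left blinfun.scaleR_left algebra_simps)
  then show ?thesis by (simp add: bilinear_conv_bounded_bilinear)
qed

lemmas wedge_simps =
  bounded_bilinear.add_left[OF bounded_bilinear_wedge] bounded_bilinear.add_right[OF bounded_bilinear_wedge]
  bounded_bilinear.diff_left[OF bounded_bilinear_wedge] bounded_bilinear.diff_right[OF bounded_bilinear_wedge]
  bounded_bilinear.scaleR_left[OF bounded_bilinear_wedge] bounded_bilinear.scaleR_right[OF bounded_bilinear_wedge]
  bounded_bilinear.zero_left[OF bounded_bilinear_wedge] bounded_bilinear.zero_right[OF bounded_bilinear_wedge]

lemma wedge_self: "wedge a a = 0"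
  by (rule blinfun_eqI) (simp add: wedge_apply)

lemma wedge_flip: "wedge a b = - wedge b a"
  by (rule blinfun_eqI) (simp add: wedge_apply blinfun.minus_left)

lemma wedge_so_lor: "wedge a b \<in> so_lor"
  unfolding so_lor_def using lor_commute[of _ a] lor_commute[of _ b]
  by (auto simp: wedge_apply lor_simps algebra_simps)

lemma wedge_stab_perp:
  assumes "L = span {s}" "lor s s = 0" "lor s b = 0"
  shows "wedge s b \<in> stab_perp L"
proof -
  have "lor b s = 0" using assms(3) lor_commute by metis
  have 1: "blinfun_apply (wedge s b) v = 0" if "v \<in> L" for v
    using that assms \<open>lor b s = 0\<close> by (auto simp: wedge_apply lor_simps span_singleton)
  have 2: "blinfun_apply (wedge s b) v \<in> L" if "v \<in> lor_perp L" for v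
  proof -
    have "lor s v = 0"
      using that assms(1) lor_commute[of v s] by (simp add: lor_perp_span_iff)
    then show ?thesis by (simp add: assms(1) wedge_apply span_neg span_scale span_base)
  qed
  show ?thesis unfolding stab_perp_def using wedge_so_lor 1 2 by blast
qed

text \<open>An element of the nilradical is determined by its value at one \<open>t\<close> not
  orthogonal to \<open>s\<close>. Any \<open>v\<close> is a multiple of \<open>t\<close> plus some
  \<open>u\<close> orthogonal to \<open>s\<close>; \<open>S\<close> maps \<open>u\<close> to a
  multiple of \<open>s\<close>, and skewness computes the factor by pairing with
  \<open>t\<close>.\<close>

lemma stab_perp_eq_wedge:
  assumes "L = span {s}" "S \<in> stab_perp L" "lor s t \<noteq> 0"
  shows "S = wedge s ((1 / lor s t) *\<^sub>R blinfun_apply S t)"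
    and "lor s (blinfun_apply S t) = 0"
proof -
  let ?S = "blinfun_apply S"
  have so: "lor (?S v) w = - lor v (?S w)" for v w
    using assms(2) unfolding stab_perp_def so_lor_def by (smt (verit) mem_Collect_eq)
  have s0: "?S s = 0" using assms by (simp add: stab_perp_def span_base)
  show "lor s (?S t) = 0" using so[of s t] s0 by (simp add: lor_simps)
  show "S = wedge s ((1 / lor s t) *\<^sub>R ?S t)"
  proof (rule blinfun_eqI)
    fix v
    define c where "c = lor s v / lor s t"
    define u where "u = v - c *\<^sub>R t"
    have "lor s u = 0" using assms(3) by (simp add: u_def c_def lor_simps)
    then have "u \<in> lor_perp L"
      using assms(1) lor_commute[of s u] by (simp add: lor_perp_span_iff)
    then have "?S u \<in> L" using assms(2) by (simp add: stab_perp_def)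
    then obtain k where k: "?S u = k *\<^sub>R s" using assms(1) by (auto simp: span_singleton)
    have "k * lor s t = - lor u (?S t)" using so[of u t] by (simp add: k lor_simps)
    also have "\<dots> = - lor v (?S t)"
    proof -
      have "lor t (?S t) = 0" using so[of t t] lor_commute[of t] by (smt (verit))
      then show ?thesis by (simp add: u_def lor_simps)
    qed
    finally have k': "k = - lor v (?S t) / lor s t" using assms(3) by (simp add: field_simps)
    have "?S v = c *\<^sub>R ?S t + ?S u" by (simp add: u_def blinfun.diff_right blinfun.scaleR_right)
    then show "?S v = blinfun_apply (wedge s ((1 / lor s t) *\<^sub>R ?S t)) v"
      using lor_commute[of v] by (simp add: k k' c_def wedge_apply lor_simps)
  qed
qed

text \<open>Both sides equal \<open>- (lor s v * lor a b) *\<^sub>R s\<close>; this is why the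
  nilradical is abelian.\<close>

lemma wedge_null_commute:
  assumes "lor s s = 0" "lor s a = 0" "lor s b = 0"
  shows "blinfun_apply (wedge s a) (blinfun_apply (wedge s b) v)
    = blinfun_apply (wedge s b) (blinfun_apply (wedge s a) v)"
  using assms lor_commute[of a s] lor_commute[of b s] lor_commute[of a b]
  by (simp add: wedge_apply lor_simps)

text \<open>One constant vector serves as the \<open>t\<close> of \<open>stab_perp_eq_wedge\<close>
  at all points, so the extracted factor varies smoothly.\<close>

lemma half_cone_partner: "s \<in> half_cone \<Longrightarrow> lor s (0, 1) \<noteq> 0"
  by (simp add: half_cone_def lor_def)

lemma wedge_eq_0:
  assumes "wedge s w = 0" "lor s x \<noteq> 0"
  shows "w = (lor w x / lor s x) *\<^sub>R s"
proof -
  have "lor s x *\<^sub>R w = lor w x *\<^sub>R s"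
    using arg_cong[OF assms(1), of "\<lambda>S. blinfun_apply S x"] by (simp add: wedge_apply)
  then have "(1 / lor s x) *\<^sub>R (lor s x *\<^sub>R w) = (1 / lor s x) *\<^sub>R (lor w x *\<^sub>R s)" by simp
  then show ?thesis using assms(2) by simp
qed

lemma null_line_eq_span:
  assumes "null_line L" "s \<in> L" "s \<noteq> 0"
  shows "L = span {s}"
proof -
  have "span {s} \<subseteq> L" using assms by (simp add: null_line_def span_minimal)
  moreover have "dim (span {s}) = 1" using assms(3) by (simp add: dim_eq_card_independent)
  ultimately show ?thesis
    using assms(1) subspace_dim_equal[OF subspace_span, of L "{s}"] by (simp add: null_line_def)
qed

section \<open>Immersed surface patches\<close>

abbreviation pd :: "real^2 \<Rightarrow> (real^2 \<Rightarrow> 'b::real_normed_vector) \<Rightarrow> real^2 \<Rightarrow> 'b" where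
  "pd u f \<equiv> \<lambda>x. frechet_derivative f (at x) u"

lemma pd_lor:
  assumes "f differentiable at x" "g differentiable at x"
  shows "pd u (\<lambda>y. lor (f y) (g y)) x = lor (f x) (pd u g x) + lor (pd u f x) (g x)"
  using frechet_derivative_bounded_bilinear[OF bounded_bilinear_lor assms] .

lemma pd_add:
  assumes "f differentiable at x" "g differentiable at x"
  shows "pd u (\<lambda>y. f y + g y) x = pd u f x + pd u g x"
proof -
  have "((\<lambda>y. f y + g y) has_derivative
      (\<lambda>h. frechet_derivative f (at x) h + frechet_derivative g (at x) h)) (at x)"
    using assms by (intro has_derivative_add) (simp_all add: frechet_derivative_works[symmetric])
  from frechet_derivative_at[OF this] show ?thesis by metis
qed

lemma linear_pd: "f differentiable at x \<Longrightarrow> linear (\<lambda>u. pd u f x)"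
  using linear_frechet_derivative[of f "at x"] by (simp add: eta_contract_eq)

lemma pd_const_on:
  assumes "open U" "x \<in> U" "\<And>y. y \<in> U \<Longrightarrow> f y = c"
  shows "pd u f x = 0"
  using frechet_derivative_cong_open[OF assms(1,2), of f "\<lambda>_. c"] assms(3) by simp

text \<open>Linearity in the inner direction comes from differentiating the identities for the first
  derivative, which hold on all of \<open>U\<close>.\<close>

lemma linear_pd_arg:
  assumes "open U" "smooth_on U f" "x \<in> U"
  shows "linear (\<lambda>v. pd u (pd v f) x)"
proof (rule linearI)
  have d: "f differentiable at y" if "y \<in> U" for y
    using smooth_on_differentiable[OF assms(1,2) that] .
  have d': "pd v f differentiable at x" for v
    using smooth_on_differentiable[OF assms(1) smooth_on_deriv[OF assms(2)] assms(3)] .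
  show "pd u (pd (a + b) f) x = pd u (pd a f) x + pd u (pd b f) x" for a b
    using frechet_derivative_cong_open[OF assms(1,3), of "pd (a + b) f" "\<lambda>y. pd a f y + pd b f y"]
      linear_add[OF linear_frechet_derivative[OF d]] pd_add[OF d' d'] by simp
  show "pd u (pd (c *\<^sub>R a) f) x = c *\<^sub>R pd u (pd a f) x" for c a
    using frechet_derivative_cong_open[OF assms(1,3), of "pd (c *\<^sub>R a) f" "\<lambda>y. c *\<^sub>R pd a f y"]
      linear_cmul[OF linear_frechet_derivative[OF d]]
      frechet_derivative_bounded_linear[OF bounded_linear_scaleR_right d'] by simp
qed

text \<open>A positive section read in a chart: \<open>F\<close> stands for
  \<open>\<sigma> \<circ> param \<kappa>\<close> and \<open>span {F x}\<close> for the fibre of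
  \<Lambda>.\<close>

locale surface_patch =
  fixes U :: "(real^2) set" and F :: "real^2 \<Rightarrow> (real^'m) \<times> real"
  assumes open_U: "open U" and smooth_F: "smooth_on U F"
    and cone_F: "\<And>x. x \<in> U \<Longrightarrow> F x \<in> half_cone"
    and immersed_F: "\<And>x u. x \<in> U \<Longrightarrow> frechet_derivative F (at x) u \<in> span {F x} \<Longrightarrow> u = 0"
begin

definition met :: "real^2 \<Rightarrow> real^2 \<Rightarrow> real^2 \<Rightarrow> real" where
  "met x u v = lor (pd u F x) (pd v F x)"

text \<open>As in the Gauss formula, the Christoffel map is the tangential part of the second
  derivative of \<open>F\<close>. This replaces the Koszul formula and ties the Levi-Civita
  connection to the derivatives of the section.\<close>

definition chris :: "real^2 \<Rightarrow> real^2 \<Rightarrow> real^2 \<Rightarrow> real^2" where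
  "chris x u v = riesz2 (met x) (\<lambda>z. lor (pd u (pd v F) x) (pd z F x))"

lemma smooth_pd_F: "smooth_on U (pd u F)"
  by (rule smooth_on_deriv[OF smooth_F])

lemma diff_F: "x \<in> U \<Longrightarrow> F differentiable at x"
  by (rule smooth_on_differentiable[OF open_U smooth_F])

lemma diff_pd_F: "x \<in> U \<Longrightarrow> pd u F differentiable at x"
  by (rule smooth_on_differentiable[OF open_U smooth_pd_F])

lemma null_F: "x \<in> U \<Longrightarrow> lor (F x) (F x) = 0"
  using cone_F by (simp add: half_cone_def)

lemma F_nonzero: "x \<in> U \<Longrightarrow> F x \<noteq> 0"
  using cone_F[of x] by (auto simp: half_cone_def)

lemma linear_dF: "x \<in> U \<Longrightarrow> linear (\<lambda>u. pd u F x)"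
  using linear_pd diff_F by blast

lemma d2F_linear: "x \<in> U \<Longrightarrow> linear (\<lambda>u. pd u (pd v F) x)" "x \<in> U \<Longrightarrow> linear (\<lambda>v. pd u (pd v F) x)"
  using linear_pd[OF diff_pd_F] linear_pd_arg[OF open_U smooth_F] by blast+

lemma d2F_sym: "x \<in> U \<Longrightarrow> pd u (pd v F) x = pd v (pd u F) x"
  using second_derivative_symmetric[OF open_U smooth_F] by blast

lemma lor_F_dF:
  assumes "x \<in> U"
  shows "lor (F x) (pd u F x) = 0" "lor (pd u F x) (F x) = 0"
proof -
  have "pd u (\<lambda>y. lor (F y) (F y)) x = 0"
    by (rule pd_const_on[OF open_U assms null_F])
  then show "lor (F x) (pd u F x) = 0" "lor (pd u F x) (F x) = 0"
    using pd_lor[OF diff_F[OF assms] diff_F[OF assms]] lor_commute[of "F x"] by simp_all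
qed

lemma lor_F_d2F:
  assumes "x \<in> U"
  shows "lor (F x) (pd u (pd v F) x) = - met x u v"
proof -
  have "pd u (\<lambda>y. lor (F y) (pd v F y)) x = 0"
    by (rule pd_const_on[OF open_U assms lor_F_dF(1)])
  then show ?thesis
    using pd_lor[OF diff_F[OF assms] diff_pd_F[OF assms]] by (simp add: met_def)
qed

text \<open>Derivatives of \<open>F\<close> are orthogonal to the null vector \<open>F x\<close>, so
  \<open>null_orthogonal\<close> gives nonnegative squares; a zero square would put the derivative
  into the null line, against the immersion condition.\<close>

lemma met_inner:
  assumes "x \<in> U"
  shows "inner_prod2 (met x)"
proof -
  note l = linear_add[OF linear_dF[OF assms]] linear_cmul[OF linear_dF[OF assms]]
  have "bilinear (met x)"
    unfolding bilinear_def by (auto intro!: linearI simp: met_def l lor_simps)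
  moreover have "met x u v = met x v u" for u v by (simp add: met_def lor_commute)
  moreover have "met x u u > 0" if "u \<noteq> 0" for u
  proof -
    have "pd u F x \<notin> span {F x}" using immersed_F[OF assms] that by blast
    then have "pd u F x \<noteq> (snd (pd u F x) / snd (F x)) *\<^sub>R F x"
      by (metis span_base span_scale singletonI)
    then show ?thesis
      using null_orthogonal[OF cone_F[OF assms] lor_F_dF(1)[OF assms], of u]
      unfolding met_def by linarith
  qed
  ultimately show ?thesis by (simp add: inner_prod2_def)
qed

lemma met_bilinear: "x \<in> U \<Longrightarrow> bilinear (met x)"
  using inner_prod2D(1)[OF met_inner] .

lemma smooth_met: "smooth_on U (\<lambda>x. met x u v)"
  unfolding met_def
  by (rule smooth_on_bounded_bilinear[OF bounded_bilinear_lor open_U smooth_pd_F smooth_pd_F])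

lemma smooth_gdet: "smooth_on U (\<lambda>x. gdet (met x))"
  unfolding gdet_def by (intro smooth_on_diff smooth_on_mult smooth_met open_U)

lemma smooth_inverse_gdet: "smooth_on U (\<lambda>x. inverse (gdet (met x)))"
  using gdet_pos[OF met_inner] by (intro smooth_on_inverse smooth_gdet open_U) fastforce

lemma pd_met:
  assumes "x \<in> U"
  shows "pd u (\<lambda>y. met y v w) x =
    lor (pd v F x) (pd u (pd w F) x) + lor (pd u (pd v F) x) (pd w F x)"
  unfolding met_def using pd_lor[OF diff_pd_F[OF assms] diff_pd_F[OF assms]] .

lemma linear_lor_dF: "x \<in> U \<Longrightarrow> linear (\<lambda>z. lor w (pd z F x))"
  using linear_compose[OF linear_dF linear_lor_right] by (simp add: comp_def)

lemma met_chris: "x \<in> U \<Longrightarrow> met x (chris x u v) z = lor (pd u (pd v F) x) (pd z F x)"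
  unfolding chris_def by (rule riesz2[OF met_inner linear_lor_dF])

lemma chris_sym: "x \<in> U \<Longrightarrow> chris x u v = chris x v u"
  unfolding chris_def using d2F_sym by metis

lemma bilinear_chris:
  assumes "x \<in> U"
  shows "bilinear (chris x)"
proof -
  note bl = bilinear_simps[OF met_bilinear[OF assms]]
  note l = linear_add[OF d2F_linear(1)[OF assms]] linear_cmul[OF d2F_linear(1)[OF assms]]
     linear_add[OF d2F_linear(2)[OF assms]] linear_cmul[OF d2F_linear(2)[OF assms]]
  show ?thesis
    unfolding bilinear_def
    by (intro conjI allI linearI inner_prod2_cancel[OF met_inner[OF assms]])
       (simp_all add: bl l met_chris[OF assms] lor_simps)
qed

lemma chris_unique:
  assumes "x \<in> U"
  shows "(THE \<Gamma>. bilinear \<Gamma> \<and> (\<forall>u v. \<Gamma> u v = \<Gamma> v u) \<and>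
     (\<forall>u v w. pd u (\<lambda>y. met y v w) x = met x (\<Gamma> u v) w + met x v (\<Gamma> u w))) = chris x"
proof (rule the_equality)
  have c: "met x v (chris x u w) = lor (pd v F x) (pd u (pd w F) x)" for u v w
    using met_chris[OF assms, of u w v] inner_prod2D(2)[OF met_inner[OF assms]] lor_commute by metis
  show "bilinear (chris x) \<and> (\<forall>u v. chris x u v = chris x v u) \<and>
     (\<forall>u v w. pd u (\<lambda>y. met y v w) x = met x (chris x u v) w + met x v (chris x u w))"
    using bilinear_chris[OF assms] chris_sym[OF assms] by (simp add: pd_met[OF assms] met_chris[OF assms] c)
  fix \<Gamma> :: "real^2 \<Rightarrow> real^2 \<Rightarrow> real^2"
  assume \<Gamma>: "bilinear \<Gamma> \<and> (\<forall>u v. \<Gamma> u v = \<Gamma> v u) \<and>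
     (\<forall>u v w. pd u (\<lambda>y. met y v w) x = met x (\<Gamma> u v) w + met x v (\<Gamma> u w))"
  note bl = bilinear_simps[OF met_bilinear[OF assms]]
  define T where "T u v w = met x (\<Gamma> u v) w - met x (chris x u v) w" for u v w
  have s: "met x u v = met x v u" for u v using inner_prod2D(2)[OF met_inner[OF assms]] .
  have T1: "T u v w = - T u w v" for u v w
  proof -
    have "met x (\<Gamma> u v) w + met x v (\<Gamma> u w) = met x (chris x u v) w + met x v (chris x u w)"
    proof -
      have "met x (\<Gamma> u v) w + met x v (\<Gamma> u w) = pd u (\<lambda>y. met y v w) x"
        using \<Gamma> by simp
      then show ?thesis by (simp add: pd_met[OF assms] met_chris[OF assms] c)
    qed
    then show ?thesis unfolding T_def s[of _ v] by simp
  qed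
  have T2: "T u v w = T v u w" for u v w
    using \<Gamma> chris_sym[OF assms, of u v] by (simp add: T_def)
  \<comment> \<open>Skewness in the last two slots and symmetry in the first two, applied
    alternately six times, return to the same arguments with the opposite sign.\<close>
  have "T u v w = 0" for u v w
    using T1[of u v w] T2[of u w v] T1[of w u v] T2[of w v u] T1[of v w u] T2[of v u w] by linarith
  then show "\<Gamma> = chris x"
    unfolding T_def by (intro ext inner_prod2_cancel[OF met_inner[OF assms]]) simp
qed

lemma orthonormal_dF:
  assumes "orthonormal2 (met x) a b"
  shows "lor (pd a F x) (pd a F x) = 1" "lor (pd b F x) (pd b F x) = 1" "lor (pd a F x) (pd b F x) = 0"
  using assms by (simp_all add: orthonormal2_def met_def)

lemma dF_in_span:
  assumes "x \<in> U" "orthonormal2 (met x) a b"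
  shows "pd u F x \<in> span {pd a F x, pd b F x}"
proof -
  have "pd u F x = pd (met x u a *\<^sub>R a + met x u b *\<^sub>R b) F x"
    using orthonormal2_expand[OF met_inner[OF assms(1)] assms(2), of u] by simp
  also have "\<dots> = met x u a *\<^sub>R pd a F x + met x u b *\<^sub>R pd b F x"
    by (simp add: linear_add[OF linear_dF[OF assms(1)]] linear_cmul[OF linear_dF[OF assms(1)]])
  finally show ?thesis by (auto intro: span_base span_add span_scale)
qed

lemma patch_span_criterion:
  assumes x: "x \<in> U" and f: "orthonormal2 (met x) a b" "null_frame (F x) (pd a F x) (pd b F x) m"
    and w: "lor w (F x) = 0" "\<And>u. lor w (pd u F x) = 0"
      "\<And>\<xi>. \<xi> \<in> lor_perp (span {F x, pd a F x, pd b F x, m}) \<Longrightarrow> lor w \<xi> = 0"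
  shows "wedge (F x) w = 0"
  using null_frame_span_criterion[OF f(2) w(1) w(2) w(2) w(3)]
  by (metis scaleR_zero_right wedge_self wedge_simps(6))

lemma patch_perp:
  assumes x: "x \<in> U" and f: "orthonormal2 (met x) a b"
    and \<xi>: "\<xi> \<in> lor_perp (span {F x, pd a F x, pd b F x, m})"
  shows "lor \<xi> (F x) = 0" "lor \<xi> (pd u F x) = 0" "lor (F x) \<xi> = 0" "lor (pd u F x) \<xi> = 0"
proof -
  show 1: "lor \<xi> (F x) = 0" using \<xi> by (simp add: lor_perp_span_iff)
  show 2: "lor \<xi> (pd u F x) = 0"
    by (rule lor_span_zero[OF dF_in_span[OF x f, of u]]) (use \<xi> in \<open>auto simp del: split_paired_All simp: lor_perp_span_iff\<close>)
  show "lor (F x) \<xi> = 0" "lor (pd u F x) \<xi> = 0" using 1 2 lor_commute by metis+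
qed

end

section \<open>Patches with a quadratic differential\<close>

locale patch_qd = surface_patch U F for U and F :: "real^2 \<Rightarrow> (real^'m) \<times> real" +
  fixes q :: "real^2 \<Rightarrow> real^2 \<Rightarrow> real^2 \<Rightarrow> real"
  assumes bilinear_q: "\<And>x. x \<in> U \<Longrightarrow> bilinear (q x)"
    and sym_q: "\<And>x u v. x \<in> U \<Longrightarrow> q x u v = q x v u"
    and trace_q: "\<And>x. x \<in> U \<Longrightarrow> metric_trace (met x) (q x) = 0"
    and smooth_q: "\<And>u v. smooth_on U (\<lambda>x. q x u v)"
begin

definition endo :: "real^2 \<Rightarrow> real^2 \<Rightarrow> real^2" where
  "endo x v = riesz2 (met x) (q x v)"

definition alpha :: "real^2 \<Rightarrow> real^2 \<Rightarrow> (real^'m) \<times> real" where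
  "alpha v x = pd (endo x v) F x"

definition frm :: "real^2 \<Rightarrow> real^2 \<Rightarrow> ((real^'m) \<times> real) \<Rightarrow>\<^sub>L ((real^'m) \<times> real)" where
  "frm v x = wedge (F x) (alpha v x)"

lemma met_endo: "x \<in> U \<Longrightarrow> met x (endo x v) w = q x v w"
  unfolding endo_def using bilinear_q by (intro riesz2 met_inner) (auto simp: bilinear_def)

lemma lor_alpha_dF: "x \<in> U \<Longrightarrow> lor (alpha v x) (pd w F x) = q x v w"
  using met_endo[of x v w] by (simp add: alpha_def met_def)

lemma lor_alpha_F: "x \<in> U \<Longrightarrow> lor (alpha v x) (F x) = 0" "x \<in> U \<Longrightarrow> lor (F x) (alpha v x) = 0"
  by (simp_all add: alpha_def lor_F_dF)

lemma linear_endo: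
  assumes "x \<in> U"
  shows "linear (endo x)"
  using bilinear_simps[OF met_bilinear[OF assms]] bilinear_simps[OF bilinear_q[OF assms]]
  by (intro linearI inner_prod2_cancel[OF met_inner[OF assms]]) (simp_all add: met_endo[OF assms])

lemma linear_alpha:
  assumes "x \<in> U"
  shows "linear (\<lambda>v. alpha v x)"
  unfolding alpha_def using linear_compose[OF linear_endo linear_dF] assms by (simp add: comp_def)

lemma smooth_endo: "smooth_on U (\<lambda>x. endo x v $ 1)" "smooth_on U (\<lambda>x. endo x v $ 2)"
proof -
  have "smooth_on U (\<lambda>x. (met x e2 e2 * q x v e1 - met x e1 e2 * q x v e2) * inverse (gdet (met x)))"
    "smooth_on U (\<lambda>x. (met x e1 e1 * q x v e2 - met x e1 e2 * q x v e1) * inverse (gdet (met x)))"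
    by (intro smooth_on_mult smooth_on_diff smooth_inverse_gdet smooth_met smooth_q open_U)+
  then show "smooth_on U (\<lambda>x. endo x v $ 1)" "smooth_on U (\<lambda>x. endo x v $ 2)"
    by (simp_all add: endo_def riesz2_def axis_def divide_inverse)
qed

text \<open>Before \<open>alpha\<close> can be differentiated, the direction
  \<open>endo x v\<close>, which moves with \<open>x\<close>, is expanded in the constant
  directions.\<close>

lemma alpha_expand:
  "x \<in> U \<Longrightarrow> alpha v x = (endo x v $ 1) *\<^sub>R pd e1 F x + (endo x v $ 2) *\<^sub>R pd e2 F x"
  unfolding alpha_def by (rule linear_real2[OF linear_dF])

lemma smooth_alpha: "smooth_on U (alpha v)"
proof -
  have "smooth_on U (\<lambda>x. (endo x v $ 1) *\<^sub>R pd e1 F x + (endo x v $ 2) *\<^sub>R pd e2 F x)"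
    by (intro smooth_on_add smooth_on_scaleR smooth_endo smooth_pd_F open_U)
  then show ?thesis using smooth_on_cong[OF open_U, of "alpha v", OF alpha_expand] by simp
qed

lemma diff_alpha: "x \<in> U \<Longrightarrow> alpha v differentiable at x"
  by (rule smooth_on_differentiable[OF open_U smooth_alpha])

lemma smooth_frm: "smooth_on U (frm v)"
  unfolding frm_def
  by (rule smooth_on_bounded_bilinear[OF bounded_bilinear_wedge open_U smooth_F smooth_alpha])

text \<open>The difference of the two sides is the trace of \<open>endo x\<close> times an area bivector, because the
  surface is two-dimensional.\<close>

lemma wedge_dF_alpha:
  assumes "x \<in> U"
  shows "wedge (pd u F x) (alpha v x) = wedge (pd v F x) (alpha u x)"
proof -
  let ?F1 = "pd e1 F x" and ?F2 = "pd e2 F x"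
  have s: "q x e2 e1 = q x e1 e2" using sym_q[OF assms] .
  have "metric_trace (met x) (q x) = (endo x e1 $ 1) + (endo x e2 $ 2)"
    unfolding metric_trace_coord[OF met_inner[OF assms] bilinear_q[OF assms]]
    by (simp add: endo_def riesz2_def axis_def s add_divide_distrib diff_divide_distrib algebra_simps)
  then have t: "endo x e2 $ 2 = - (endo x e1 $ 1)" using trace_q[OF assms] by simp
  have e: "wedge ?F1 (alpha e2 x) = wedge ?F2 (alpha e1 x)"
    unfolding alpha_expand[OF assms]
    by (simp add: wedge_simps wedge_self t wedge_flip[of ?F2 ?F1])
  have du: "pd u F x = (u$1) *\<^sub>R ?F1 + (u$2) *\<^sub>R ?F2" for u
    by (rule linear_real2[OF linear_dF[OF assms]])
  have au: "alpha u x = (u$1) *\<^sub>R alpha e1 x + (u$2) *\<^sub>R alpha e2 x" for u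
    by (rule linear_real2[OF linear_alpha[OF assms]])
  show ?thesis
    unfolding du[of u] du[of v] au[of u] au[of v]
    by (simp add: wedge_simps e algebra_simps)
qed

text \<open>The 2-form d(d\<sigma>(Q)) of the overview, evaluated on \<open>u\<close> and
  \<open>v\<close>.\<close>

definition skew_alpha :: "real^2 \<Rightarrow> real^2 \<Rightarrow> real^2 \<Rightarrow> (real^'m) \<times> real" where
  "skew_alpha u v x = pd u (alpha v) x - pd v (alpha u) x"

lemma ext_deriv_frm:
  assumes "x \<in> U"
  shows "pd u (frm v) x - pd v (frm u) x = wedge (F x) (skew_alpha u v x)"
proof -
  have "pd u (frm v) x = wedge (F x) (pd u (alpha v) x) + wedge (pd u F x) (alpha v x)" for u v
    unfolding frm_def
    using frechet_derivative_bounded_bilinear[OF bounded_bilinear_wedge diff_F[OF assms] diff_alpha[OF assms]] .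
  then show ?thesis
    using wedge_dF_alpha[OF assms, of u v] by (simp add: skew_alpha_def wedge_simps)
qed

text \<open>Differentiating \<open>lor (alpha v) F = 0\<close> along \<open>u\<close> gives
  \<open>- q x v u\<close> for the component, and this is symmetric in \<open>u\<close> and
  \<open>v\<close>.\<close>

lemma skew_alpha_F:
  assumes "x \<in> U"
  shows "lor (skew_alpha u v x) (F x) = 0"
proof -
  have "lor (pd u (alpha v) x) (F x) = - q x v u" for u v
  proof -
    have "pd u (\<lambda>y. lor (alpha v y) (F y)) x = 0"
      by (rule pd_const_on[OF open_U assms lor_alpha_F(1)])
    then show ?thesis
      using pd_lor[OF diff_alpha[OF assms] diff_F[OF assms]] lor_alpha_dF[OF assms]
      by (simp add: eq_neg_iff_add_eq_0 add.commute)
  qed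
  then show ?thesis using sym_q[OF assms, of u v] by (simp add: skew_alpha_def lor_simps)
qed

text \<open>This is the covariant derivative of \<open>q\<close> up to the term
  \<open>q x (chris x u v) w\<close>, which is symmetric in \<open>u\<close> and \<open>v\<close>
  and therefore disappears on skewing.\<close>

lemma pd_alpha_dF:
  assumes "x \<in> U"
  shows "lor (pd u (alpha v) x) (pd w F x) = pd u (\<lambda>y. q y v w) x - q x v (chris x u w)"
proof -
  have "pd u (\<lambda>y. q y v w) x = pd u (\<lambda>y. lor (alpha v y) (pd w F y)) x"
    by (rule fun_cong[OF frechet_derivative_cong_open[OF open_U assms]]) (simp add: lor_alpha_dF)
  also have "\<dots> = lor (alpha v x) (pd u (pd w F) x) + lor (pd u (alpha v) x) (pd w F x)"
    using pd_lor[OF diff_alpha[OF assms] diff_pd_F[OF assms]] .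
  also have "lor (alpha v x) (pd u (pd w F) x) = q x v (chris x u w)"
    using met_chris[OF assms, of u w "endo x v"] met_endo[OF assms, of v "chris x u w"]
      inner_prod2D(2)[OF met_inner[OF assms]] lor_commute unfolding alpha_def by metis
  finally show ?thesis by simp
qed

text \<open>The derivatives of the coefficients of \<open>alpha\<close> multiply tangent vectors,
  which \<xi> annihilates; the direction \<open>endo x v\<close> may thus be frozen at
  \<open>x\<close>.\<close>

lemma pd_alpha_perp:
  assumes "x \<in> U" "\<And>u. lor \<xi> (pd u F x) = 0"
  shows "lor \<xi> (pd u (alpha v) x) = lor \<xi> (pd u (pd (endo x v) F) x)"
proof -
  let ?c = "\<lambda>i x. endo x v $ i"
  have dc: "?c 1 differentiable at x" "?c 2 differentiable at x"
    using smooth_on_differentiable[OF open_U _ assms(1)] smooth_endo by blast+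
  note b = differentiable_bounded_bilinear[OF bounded_bilinear_scaleR]
    frechet_derivative_bounded_bilinear[OF bounded_bilinear_scaleR]
  have "pd u (alpha v) x = pd u (\<lambda>x. ?c 1 x *\<^sub>R pd e1 F x + ?c 2 x *\<^sub>R pd e2 F x) x"
    using frechet_derivative_cong_open[OF open_U assms(1), of "alpha v", OF alpha_expand] by simp
  also have "\<dots> = pd u (\<lambda>x. ?c 1 x *\<^sub>R pd e1 F x) x + pd u (\<lambda>x. ?c 2 x *\<^sub>R pd e2 F x) x"
    by (rule pd_add[OF b(1)[OF dc(1) diff_pd_F[OF assms(1)]] b(1)[OF dc(2) diff_pd_F[OF assms(1)]]])
  finally have "lor \<xi> (pd u (alpha v) x) =
      ?c 1 x * lor \<xi> (pd u (pd e1 F) x) + ?c 2 x * lor \<xi> (pd u (pd e2 F) x)"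
    using b(2)[OF dc(1) diff_pd_F[OF assms(1)], where v = u] b(2)[OF dc(2) diff_pd_F[OF assms(1)], where v = u]
    by (simp add: lor_simps assms(2))
  also have "\<dots> = lor \<xi> (pd u (pd (endo x v) F) x)"
    using linear_real2[OF d2F_linear(2)[OF assms(1), of u], of "endo x v"] by (simp add: lor_simps)
  finally show ?thesis .
qed

text \<open>The derivative of \<open>frm\<close> is \<open>F x\<close> wedged with
  \<open>skew_alpha\<close>, so it vanishes iff \<open>skew_alpha\<close> is a multiple of
  \<open>F x\<close>. This is tested by pairing with F, with its derivatives and with the complement
  of the frame: the first pairing is always 0, the others are the two conditions on the right. The
  span of the frame will be the central sphere.\<close>

lemma frm_closed_iff:
  assumes x: "x \<in> U" and f: "orthonormal2 (met x) a b" "null_frame (F x) (pd a F x) (pd b F x) m"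
  shows "(\<forall>u v. pd u (frm v) x = pd v (frm u) x) \<longleftrightarrow>
    (\<forall>u v w. pd u (\<lambda>y. q y v w) x - q x v (chris x u w) = pd v (\<lambda>y. q y u w) x - q x u (chris x v w)) \<and>
    (\<forall>u v. \<forall>\<xi>\<in>lor_perp (span {F x, pd a F x, pd b F x, m}).
      lor \<xi> (pd u (pd (endo x v) F) x) = lor \<xi> (pd v (pd (endo x u) F) x))"
    (is "?C \<longleftrightarrow> ?H \<and> ?K")
proof -
  have C: "?C \<longleftrightarrow> (\<forall>u v. wedge (F x) (skew_alpha u v x) = 0)"
    using ext_deriv_frm[OF x] eq_iff_diff_eq_0 by metis
  have H: "?H \<longleftrightarrow> (\<forall>u v w. lor (skew_alpha u v x) (pd w F x) = 0)"
    unfolding skew_alpha_def lor_simps pd_alpha_dF[OF x] by simp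
  have K: "?K \<longleftrightarrow> (\<forall>u v. \<forall>\<xi>\<in>lor_perp (span {F x, pd a F x, pd b F x, m}). lor (skew_alpha u v x) \<xi> = 0)"
    using pd_alpha_perp[OF x patch_perp(2)[OF x f(1)]] lor_commute[of "skew_alpha _ _ x"]
    by (simp add: skew_alpha_def lor_simps)
  show ?thesis
  proof
    assume ?C
    have "\<exists>c. skew_alpha u v x = c *\<^sub>R F x" for u v
      using wedge_eq_0[OF _ half_cone_partner[OF cone_F[OF x]]] \<open>?C\<close> C by metis
    then have "lor (skew_alpha u v x) y = 0" if "lor (F x) y = 0" for u v y
      using that by (metis lor_simps(7) mult_zero_right)
    then show "?H \<and> ?K"
      unfolding H K using lor_F_dF[OF x] patch_perp(3)[OF x f(1)] by blast
  next
    assume "?H \<and> ?K"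
    then show ?C
      unfolding H K C using patch_span_criterion[OF x f skew_alpha_F[OF x]] by blast
  qed
qed

end

section \<open>Patches with a closed form: recovering its tensor\<close>

locale patch_form = surface_patch U F for U and F :: "real^2 \<Rightarrow> (real^'m) \<times> real" +
  fixes \<eta> :: "real^2 \<Rightarrow> real^2 \<Rightarrow> ((real^'m) \<times> real) \<Rightarrow>\<^sub>L ((real^'m) \<times> real)"
  assumes linear_eta: "\<And>x. x \<in> U \<Longrightarrow> linear (\<lambda>v. \<eta> v x)"
    and smooth_eta: "\<And>v. smooth_on U (\<eta> v)"
    and stab_eta: "\<And>v x. x \<in> U \<Longrightarrow> \<eta> v x \<in> stab_perp (span {F x})"
    and closed_eta: "\<And>u v x. x \<in> U \<Longrightarrow> pd u (\<eta> v) x = pd v (\<eta> u) x"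
begin

text \<open>The second factor of \<eta> is determined only modulo \<open>F x\<close>; evaluation at
  (0, 1) selects a representative that is linear in \<open>v\<close> and smooth in
  \<open>x\<close>.\<close>

definition beta :: "real^2 \<Rightarrow> real^2 \<Rightarrow> (real^'m) \<times> real" where
  "beta v x = inverse (lor (F x) (0, 1)) *\<^sub>R blinfun_apply (\<eta> v x) (0, 1)"

lemma partner: "x \<in> U \<Longrightarrow> lor (F x) (0, 1) \<noteq> 0"
  using half_cone_partner cone_F by blast

lemma eta_wedge: "x \<in> U \<Longrightarrow> \<eta> v x = wedge (F x) (beta v x)"
  unfolding beta_def using stab_perp_eq_wedge(1)[OF refl stab_eta partner] by (simp add: inverse_eq_divide)

lemma lor_beta_F: "x \<in> U \<Longrightarrow> lor (F x) (beta v x) = 0" "x \<in> U \<Longrightarrow> lor (beta v x) (F x) = 0"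
  unfolding beta_def using stab_perp_eq_wedge(2)[OF refl stab_eta partner] lor_commute[of _ "F x"]
  by (simp_all add: lor_simps)

lemma linear_beta: "x \<in> U \<Longrightarrow> linear (\<lambda>v. beta v x)"
  unfolding beta_def
  by (rule linearI) (simp_all add: linear_add[OF linear_eta] linear_cmul[OF linear_eta]
      blinfun.add_left blinfun.scaleR_left scaleR_add_right)

lemma smooth_beta: "smooth_on U (beta v)"
  unfolding beta_def
  using partner
  by (intro smooth_on_scaleR smooth_on_inverse open_U smooth_eta
      smooth_on_bounded_linear[OF blinfun.bounded_linear_left]
      smooth_on_bounded_linear[OF bounded_bilinear.bounded_linear_left[OF bounded_bilinear_lor]] smooth_F)
    auto

lemma diff_beta: "x \<in> U \<Longrightarrow> beta v differentiable at x"
  by (rule smooth_on_differentiable[OF open_U smooth_beta])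

definition btensor :: "real^2 \<Rightarrow> real^2 \<Rightarrow> real^2 \<Rightarrow> real" where
  "btensor x u v = lor (beta u x) (pd v F x)"

lemma bilinear_btensor:
  assumes "x \<in> U"
  shows "bilinear (btensor x)"
  unfolding bilinear_def btensor_def
  by (intro conjI allI linearI) (simp_all add: lor_simps
      linear_add[OF linear_beta[OF assms]] linear_cmul[OF linear_beta[OF assms]]
      linear_add[OF linear_dF[OF assms]] linear_cmul[OF linear_dF[OF assms]])

lemma eta_dF: "x \<in> U \<Longrightarrow> blinfun_apply (\<eta> u x) (pd v F x) = - (btensor x u v *\<^sub>R F x)"
  by (simp add: eta_wedge wedge_apply btensor_def lor_F_dF)

text \<open>The Leibniz rule turns closedness of \<open>wedge F beta\<close> into an identity
  between endomorphisms, here contracted with \<open>X\<close> and \<open>Y\<close>. Suitable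
  choices of these vectors isolate the individual components of \<open>beta\<close>.\<close>

lemma closed_pairing:
  assumes "x \<in> U"
  defines "A u v \<equiv> pd u (beta v) x - pd v (beta u) x"
  shows "lor (F x) X * lor (A u v) Y - lor (A u v) X * lor (F x) Y
     + (lor (pd u F x) X * lor (beta v x) Y - lor (beta v x) X * lor (pd u F x) Y)
     - (lor (pd v F x) X * lor (beta u x) Y - lor (beta u x) X * lor (pd v F x) Y) = 0"
proof -
  have "pd u (\<eta> v) x = wedge (F x) (pd u (beta v) x) + wedge (pd u F x) (beta v x)" for u v
    using frechet_derivative_bounded_bilinear[OF bounded_bilinear_wedge diff_F[OF assms(1)] diff_beta[OF assms(1)]]
      frechet_derivative_cong_open[OF open_U assms(1), of "\<eta> v", OF eta_wedge] by simp
  then have "wedge (F x) (A u v) + wedge (pd u F x) (beta v x) - wedge (pd v F x) (beta u x) = 0"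
    using closed_eta[OF assms(1), of u v] by (simp add: A_def wedge_simps algebra_simps)
  from arg_cong[OF this, of "\<lambda>S. lor (blinfun_apply S X) Y"] show ?thesis
    by (simp add: blinfun.add_left blinfun.diff_left wedge_apply lor_simps)
qed

text \<open>With \<open>X = F x\<close> and \<open>Y = (0, 1)\<close> the pairing reduces to the
  F-component of the skewed derivative of \<open>beta\<close>, which must vanish because (0, 1) is
  not orthogonal to \<open>F x\<close>. Differentiating \<open>lor (beta v) F = 0\<close> identifies
  this component with the skew part of \<open>btensor\<close>.\<close>

lemma btensor_sym:
  assumes "x \<in> U"
  shows "btensor x u v = btensor x v u"
proof -
  have "lor (pd u (beta v) x) (F x) = lor (pd v (beta u) x) (F x)"
    using closed_pairing[OF assms, of "F x" u v "(0, 1)"] partner[OF assms]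
    by (simp add: null_F lor_beta_F lor_F_dF lor_simps assms)
  moreover have "lor (pd u (beta v) x) (F x) = - btensor x v u" for u v
  proof -
    have "pd u (\<lambda>y. lor (beta v y) (F y)) x = 0"
      by (rule pd_const_on[OF open_U assms lor_beta_F(2)])
    then show ?thesis
      using pd_lor[OF diff_beta[OF assms] diff_F[OF assms]]
      by (simp add: btensor_def eq_neg_iff_add_eq_0 add.commute)
  qed
  ultimately show ?thesis by (simp add: lor_simps)
qed

text \<open>Contracting with the two derivatives along an orthonormal pair leaves exactly the sum of
  the diagonal entries.\<close>

lemma btensor_trace:
  assumes "x \<in> U"
  shows "metric_trace (met x) (btensor x) = 0"
proof -
  obtain a b where ab: "orthonormal2 (met x) a b" using orthonormal2_exists[OF met_inner[OF assms]] by blast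
  have "met x b a = 0" using ab inner_prod2D(2)[OF met_inner[OF assms]] unfolding orthonormal2_def by metis
  then have "btensor x a a + btensor x b b = 0"
    using closed_pairing[OF assms, of "pd a F x" a b "pd b F x"] ab
    by (simp add: lor_F_dF assms btensor_def orthonormal2_def met_def)
  then show ?thesis
    using metric_trace_orthonormal[OF met_inner[OF assms] ab bilinear_btensor[OF assms]] by simp
qed

text \<open>The candidate has the same tangential components as \<open>beta\<close> by construction.
  The normal ones vanish: with \<open>X\<close> the derivative along one vector of an orthonormal
  pair and \<open>Y\<close> normal, \<open>closed_pairing\<close> leaves only the normal component
  of \<open>beta\<close> at the other. The two factors therefore differ by a multiple of
  \<open>F x\<close>, which the wedge ignores.\<close>

lemma eta_eq:
  assumes "x \<in> U"
  shows "\<eta> v x = wedge (F x) (pd (riesz2 (met x) (btensor x v)) F x)"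
proof -
  let ?w = "beta v x - pd (riesz2 (met x) (btensor x v)) F x"
  obtain a b where ab: "orthonormal2 (met x) a b" using orthonormal2_exists[OF met_inner[OF assms]] by blast
  obtain m where m: "null_frame (F x) (pd a F x) (pd b F x) m"
    using null_frame_exists[OF null_F[OF assms] orthonormal_dF[OF ab] lor_F_dF(1)[OF assms] lor_F_dF(1)[OF assms] partner[OF assms]]
    by blast
  have "wedge (F x) ?w = 0"
  proof (rule patch_span_criterion[OF assms ab m])
    show "lor ?w (F x) = 0" by (simp add: lor_simps lor_beta_F lor_F_dF assms)
    have "met x (riesz2 (met x) (btensor x v)) u = btensor x v u" for u
      using bilinear_btensor[OF assms] by (intro riesz2 met_inner assms) (simp add: bilinear_def)
    then show "lor ?w (pd u F x) = 0" for u
      by (simp add: lor_simps met_def btensor_def)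
    fix \<xi> assume "\<xi> \<in> lor_perp (span {F x, pd a F x, pd b F x, m})"
    note \<xi> = patch_perp[OF assms ab this]
    have ba: "met x b a = 0" using ab inner_prod2D(2)[OF met_inner[OF assms]] unfolding orthonormal2_def by metis
    have 1: "lor (beta a x) \<xi> = 0"
      using closed_pairing[OF assms, of "pd b F x" b a \<xi>] ab
      by (simp add: \<xi> lor_F_dF assms orthonormal2_def met_def)
    have 2: "lor (beta b x) \<xi> = 0"
      using closed_pairing[OF assms, of "pd a F x" a b \<xi>] ab ba
      by (simp add: \<xi> lor_F_dF assms orthonormal2_def met_def)
    have "beta v x = beta (met x v a *\<^sub>R a + met x v b *\<^sub>R b) x"
      using arg_cong[OF orthonormal2_expand[OF met_inner[OF assms] ab, of v]] .
    then have "beta v x = met x v a *\<^sub>R beta a x + met x v b *\<^sub>R beta b x"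
      by (simp add: linear_add[OF linear_beta[OF assms]] linear_cmul[OF linear_beta[OF assms]])
    then show "lor ?w \<xi> = 0" using 1 2 by (simp add: \<xi> lor_simps)
  qed
  then show ?thesis by (simp add: eta_wedge assms wedge_simps)
qed

end

section \<open>Charts\<close>

locale surface =
  fixes T :: "'a topology" and A :: "'a chart set"
  assumes smooth_surface: "smooth_surface T A"
begin

lemma chart_homeo:
  assumes "\<kappa> \<in> A"
  shows "openin T (dom_of \<kappa>)" "open (coord \<kappa> ` dom_of \<kappa>)"
    "homeomorphic_map (subtopology T (dom_of \<kappa>)) (top_of_set (coord \<kappa> ` dom_of \<kappa>)) (coord \<kappa>)"
  using smooth_surface assms unfolding smooth_surface_def by blast+

lemma inj_coord: "\<kappa> \<in> A \<Longrightarrow> inj_on (coord \<kappa>) (dom_of \<kappa>)"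
  using homeomorphic_imp_injective_map[OF chart_homeo(3)] chart_homeo(1)
  by (metis openin_subset topspace_subtopology_subset)

lemma param_coord: "\<kappa> \<in> A \<Longrightarrow> p \<in> dom_of \<kappa> \<Longrightarrow> param \<kappa> (coord \<kappa> p) = p"
  by (simp add: param_def inj_coord)

lemma dom_sub: "\<kappa> \<in> A \<Longrightarrow> dom_of \<kappa> \<subseteq> topspace T"
  using chart_homeo(1) openin_subset by blast

lemma chart_at:
  assumes "p \<in> topspace T"
  obtains \<kappa> where "\<kappa> \<in> A" "p \<in> dom_of \<kappa>"
  using assms smooth_surface unfolding smooth_surface_def by blast

lemma open_patch:
  assumes "\<kappa> \<in> A" "openin T W"
  shows "open (coord \<kappa> ` (W \<inter> dom_of \<kappa>))"
proof -
  have "openin (subtopology T (dom_of \<kappa>)) (W \<inter> dom_of \<kappa>)"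
    using assms(2) by (auto simp: openin_subtopology)
  then have "openin (top_of_set (coord \<kappa> ` dom_of \<kappa>)) (coord \<kappa> ` (W \<inter> dom_of \<kappa>))"
    using homeomorphic_imp_open_map[OF chart_homeo(3)[OF assms(1)]] unfolding open_map_def by blast
  then show ?thesis using chart_homeo(2)[OF assms(1)] openin_open_trans by blast
qed

lemma smooth_transition:
  "\<kappa> \<in> A \<Longrightarrow> \<kappa>' \<in> A \<Longrightarrow>
    smooth_on (coord \<kappa> ` (dom_of \<kappa> \<inter> dom_of \<kappa>')) (coord \<kappa>' \<circ> param \<kappa>)"
  using smooth_surface unfolding smooth_surface_def by blast

lemma dird_coord:
  assumes "\<kappa> \<in> A" "openin T W" "p \<in> W" "p \<in> dom_of \<kappa>"
    and "\<And>x. x \<in> W \<Longrightarrow> x \<in> dom_of \<kappa> \<Longrightarrow> f x = G (coord \<kappa> x)"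
  shows "dird \<kappa> f p u = pd u G (coord \<kappa> p)"
  unfolding dird_def
  by (rule fun_cong[OF frechet_derivative_cong_open[OF open_patch[OF assms(1,2)]]])
     (use assms param_coord[OF assms(1)] in auto)

lemma dird_cong:
  assumes "\<kappa> \<in> A" "openin T W" "p \<in> W" "p \<in> dom_of \<kappa>"
    and "\<And>x. x \<in> W \<Longrightarrow> x \<in> dom_of \<kappa> \<Longrightarrow> f x = g x"
  shows "dird \<kappa> f p u = dird \<kappa> g p u"
  unfolding dird_def
  by (rule fun_cong[OF frechet_derivative_cong_open[OF open_patch[OF assms(1,2)]]])
     (use assms param_coord[OF assms(1)] in auto)

lemma dird_dird:
  assumes "\<kappa> \<in> A" "p \<in> dom_of \<kappa>"
  shows "dird \<kappa> (\<lambda>x. dird \<kappa> f x v) p u = pd u (pd v (f \<circ> param \<kappa>)) (coord \<kappa> p)"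
  by (rule dird_coord[OF assms(1) chart_homeo(1)[OF assms(1)] assms(2,2)]) (simp add: dird_def)

lemma smooth_map_patch:
  "smooth_map_on A W f \<Longrightarrow> \<kappa> \<in> A \<Longrightarrow> smooth_on (coord \<kappa> ` (W \<inter> dom_of \<kappa>)) (f \<circ> param \<kappa>)"
  by (simp add: smooth_map_on_def)

lemma smooth_map_diff:
  assumes "smooth_map_on A W f" "\<kappa> \<in> A" "openin T W" "p \<in> W" "p \<in> dom_of \<kappa>"
  shows "(f \<circ> param \<kappa>) differentiable at (coord \<kappa> p)"
  by (rule smooth_on_differentiable[OF open_patch[OF assms(2,3)] smooth_map_patch[OF assms(1,2)]])
     (use assms in blast)

lemma transition_diff:
  assumes "\<kappa> \<in> A" "\<kappa>' \<in> A" "p \<in> dom_of \<kappa>" "p \<in> dom_of \<kappa>'"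
  shows "(coord \<kappa>' \<circ> param \<kappa>) differentiable at (coord \<kappa> p)"
proof -
  have "open (coord \<kappa> ` (dom_of \<kappa> \<inter> dom_of \<kappa>'))"
    using open_patch[OF assms(1) chart_homeo(1)[OF assms(2)]] by (simp add: Int_commute)
  then show ?thesis
    using smooth_on_differentiable[OF _ smooth_transition[OF assms(1,2)]] assms(3,4) by blast
qed

lemma dird_change:
  assumes "smooth_map_on A W f" "openin T W" "\<kappa> \<in> A" "\<kappa>' \<in> A" "p \<in> W" "p \<in> dom_of \<kappa>" "p \<in> dom_of \<kappa>'"
  shows "dird \<kappa> f p u = dird \<kappa>' f p (change_coord \<kappa> \<kappa>' p u)"
proof -
  have pk: "param \<kappa> (coord \<kappa> p) = p" using assms param_coord by blast
  have "dird \<kappa> f p u = pd u (\<lambda>y. (f \<circ> param \<kappa>') ((coord \<kappa>' \<circ> param \<kappa>) y)) (coord \<kappa> p)"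
    by (rule dird_coord[OF assms(3) chart_homeo(1)[OF assms(4)] assms(7,6)])
       (use assms param_coord[OF assms(3)] param_coord[OF assms(4)] in auto)
  also have "\<dots> = dird \<kappa>' f p (change_coord \<kappa> \<kappa>' p u)"
    unfolding dird_def change_coord_def
    using frechet_derivative_chain[OF transition_diff[OF assms(3,4,6,7)], of "f \<circ> param \<kappa>'" u]
      smooth_map_diff[OF assms(1,4,2,5,7)] by (simp add: pk)
  finally show ?thesis .
qed

lemma linear_dird:
  assumes "smooth_map_on A W f" "\<kappa> \<in> A" "openin T W" "p \<in> W" "p \<in> dom_of \<kappa>"
  shows "linear (dird \<kappa> f p)"
  using linear_frechet_derivative[OF smooth_map_diff[OF assms]] by (simp add: dird_def[abs_def])

lemma linear_change_coord:
  assumes "\<kappa> \<in> A" "\<kappa>' \<in> A" "p \<in> dom_of \<kappa>" "p \<in> dom_of \<kappa>'"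
  shows "linear (change_coord \<kappa> \<kappa>' p)"
  using linear_frechet_derivative[OF transition_diff[OF assms]]
  by (simp add: change_coord_def[abs_def] dird_def[abs_def])

lemma dird_bounded_bilinear:
  assumes "bounded_bilinear h" "smooth_map_on A W f" "smooth_map_on A W g"
    "\<kappa> \<in> A" "openin T W" "p \<in> W" "p \<in> dom_of \<kappa>"
  shows "dird \<kappa> (\<lambda>x. h (f x) (g x)) p u = h (f p) (dird \<kappa> g p u) + h (dird \<kappa> f p u) (g p)"
  unfolding dird_def
  using frechet_derivative_bounded_bilinear[OF assms(1) smooth_map_diff[OF assms(2,4-7)] smooth_map_diff[OF assms(3,4-7)], of u]
    param_coord[OF assms(4,7)] by (simp add: comp_def)

lemma dird_add:
  assumes "smooth_map_on A W f" "smooth_map_on A W g" "\<kappa> \<in> A" "openin T W" "p \<in> W" "p \<in> dom_of \<kappa>"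
  shows "dird \<kappa> (\<lambda>x. f x + g x) p u = dird \<kappa> f p u + dird \<kappa> g p u"
  unfolding dird_def
  using pd_add[OF smooth_map_diff[OF assms(1,3-6)] smooth_map_diff[OF assms(2,3-6)], of u]
  by (simp add: comp_def)

text \<open>One chart containing \<open>W\<close> suffices, since the expressions in other charts
  arise by composition with transition maps.\<close>

lemma smooth_map_on_chart:
  assumes "\<kappa> \<in> A" "openin T W" "W \<subseteq> dom_of \<kappa>" "smooth_on (coord \<kappa> ` W) G"
    "\<And>x. x \<in> W \<Longrightarrow> f x = G (coord \<kappa> x)"
  shows "smooth_map_on A W f"
  unfolding smooth_map_on_def
proof
  fix \<kappa>' assume k': "\<kappa>' \<in> A"
  let ?V = "coord \<kappa>' ` (W \<inter> dom_of \<kappa>')"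
  have o: "open ?V" "open (coord \<kappa> ` W)"
    using open_patch[OF k' assms(2)] open_patch[OF assms(1,2)] assms(3) by (simp_all add: Int_absorb2)
  have par: "param \<kappa>' y \<in> W \<and> param \<kappa>' y \<in> dom_of \<kappa>'" if "y \<in> ?V" for y
    using that param_coord[OF k'] by auto
  have "smooth_on ?V (coord \<kappa> \<circ> param \<kappa>')"
    by (rule smooth_on_subset[OF smooth_transition[OF k' assms(1)]]) (use assms(3) in auto)
  then have "smooth_on ?V (\<lambda>y. G ((coord \<kappa> \<circ> param \<kappa>') y))"
    using par by (intro smooth_on_compose[OF o _ _ assms(4)]) (auto simp: comp_def)
  then show "smooth_on ?V (f \<circ> param \<kappa>')"
    using smooth_on_cong[OF o(1), of "f \<circ> param \<kappa>'" "\<lambda>y. G ((coord \<kappa> \<circ> param \<kappa>') y)"] par assms(5)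
    by simp
qed

lemma smooth_map_on_dird:
  assumes "smooth_map_on A W f" "\<kappa> \<in> A" "openin T W"
  shows "smooth_map_on A (W \<inter> dom_of \<kappa>) (\<lambda>x. dird \<kappa> f x v)"
  by (rule smooth_map_on_chart[OF assms(2) _ _ smooth_on_deriv[OF smooth_map_patch[OF assms(1,2)], of v]])
     (use assms chart_homeo(1)[OF assms(2)] in \<open>auto simp: dird_def\<close>)

lemma smooth_map_on_subset: "smooth_map_on A W f \<Longrightarrow> W' \<subseteq> W \<Longrightarrow> smooth_map_on A W' f"
  unfolding smooth_map_on_def by (meson Int_mono image_mono order_refl smooth_on_subset)

lemma smooth_map_on_bounded_bilinear:
  assumes "bounded_bilinear h" "openin T W" "smooth_map_on A W f" "smooth_map_on A W g"
  shows "smooth_map_on A W (\<lambda>x. h (f x) (g x))"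
  unfolding smooth_map_on_def
  using smooth_on_bounded_bilinear[OF assms(1) open_patch[OF _ assms(2)] smooth_map_patch[OF assms(3)] smooth_map_patch[OF assms(4)]]
  by (simp add: comp_def)

lemma smooth_map_on_bounded_linear:
  assumes "bounded_linear h" "openin T W" "smooth_map_on A W f"
  shows "smooth_map_on A W (\<lambda>x. h (f x))"
  unfolding smooth_map_on_def
  using smooth_on_bounded_linear[OF assms(1) open_patch[OF _ assms(2)] smooth_map_patch[OF assms(3)]]
  by (simp add: comp_def)

lemma dird_dird_sym:
  fixes f :: "'a \<Rightarrow> 'b::euclidean_space"
  assumes "smooth_map_on A W f" "\<kappa> \<in> A" "openin T W" "p \<in> W" "p \<in> dom_of \<kappa>"
  shows "dird \<kappa> (\<lambda>x. dird \<kappa> f x v) p u = dird \<kappa> (\<lambda>x. dird \<kappa> f x u) p v"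
  unfolding dird_dird[OF assms(2,5)]
  by (rule second_derivative_symmetric[OF open_patch[OF assms(2,3)] smooth_map_patch[OF assms(1,2)]])
     (use assms in blast)

lemma bilinear_dird_dird:
  fixes f :: "'a \<Rightarrow> 'b::euclidean_space"
  assumes "smooth_map_on A W f" "\<kappa> \<in> A" "openin T W" "p \<in> W" "p \<in> dom_of \<kappa>"
  shows "bilinear (\<lambda>u v. dird \<kappa> (\<lambda>x. dird \<kappa> f x v) p u)"
proof -
  have x: "coord \<kappa> p \<in> coord \<kappa> ` (W \<inter> dom_of \<kappa>)" using assms by blast
  note o = open_patch[OF assms(2,3)] and s = smooth_map_patch[OF assms(1,2)]
  show ?thesis
    unfolding bilinear_def dird_dird[OF assms(2,5)]
    using linear_pd[OF smooth_on_differentiable[OF o smooth_on_deriv[OF s] x]] linear_pd_arg[OF o s x]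
    by blast
qed

text \<open>The second derivative in coordinates is not tensorial: differentiating the Jacobian of
  the transition map adds a first derivative of \<open>f\<close>. Its direction \<open>w\<close> is
  left unspecified, as all first derivatives of a section lie in \<open>Lambda1\<close>.\<close>

lemma dird_dird_change:
  assumes "smooth_map_on A W f" "openin T W" "\<kappa> \<in> A" "\<kappa>' \<in> A" "p \<in> W" "p \<in> dom_of \<kappa>" "p \<in> dom_of \<kappa>'"
  shows "\<exists>w. dird \<kappa> (\<lambda>x. dird \<kappa> f x v) p u =
    dird \<kappa>' (\<lambda>x. dird \<kappa>' f x (change_coord \<kappa> \<kappa>' p v)) p (change_coord \<kappa> \<kappa>' p u) + dird \<kappa>' f p w"
proof -
  let ?J = "change_coord \<kappa> \<kappa>'"
  let ?W = "W \<inter> (dom_of \<kappa> \<inter> dom_of \<kappa>')"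
  have oW: "openin T ?W" using assms chart_homeo(1) by blast
  have pW: "p \<in> ?W" using assms by blast
  define D where "D i x = dird \<kappa>' f x (axis i 1)" for i :: 2 and x
  have sD: "smooth_map_on A ?W (D i)" for i
    unfolding D_def by (rule smooth_map_on_subset[OF smooth_map_on_dird[OF assms(1,4,2)]]) blast
  define c where "c i x = ?J x v $ i" for i :: 2 and x
  have sJ: "smooth_map_on A ?W (\<lambda>x. ?J x v)"
  proof -
    have "smooth_on (coord \<kappa> ` ?W) (pd v (coord \<kappa>' \<circ> param \<kappa>))"
      by (rule smooth_on_subset[OF smooth_on_deriv[OF smooth_transition[OF assms(3,4)]]]) blast
    then show ?thesis
      by (intro smooth_map_on_chart[OF assms(3) oW, of "pd v (coord \<kappa>' \<circ> param \<kappa>)"])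
         (auto simp: change_coord_def dird_def)
  qed
  have sc: "smooth_map_on A ?W (c i)" for i
    unfolding c_def by (rule smooth_map_on_bounded_linear[OF bounded_linear_vec_nth oW sJ])
  note sR = smooth_map_on_bounded_bilinear[OF bounded_bilinear_scaleR oW sc sD]
  note dR = dird_bounded_bilinear[OF bounded_bilinear_scaleR sc sD assms(3) oW pW assms(6)]
  have lin: "linear (dird \<kappa>' f x)" if "x \<in> ?W" for x
    using linear_dird[OF assms(1,4,2)] that by blast
  have "dird \<kappa> (\<lambda>x. dird \<kappa> f x v) p u = dird \<kappa> (\<lambda>x. c 1 x *\<^sub>R D 1 x + c 2 x *\<^sub>R D 2 x) p u"
  proof (rule dird_cong[OF assms(3) oW pW assms(6)])
    fix x assume x: "x \<in> ?W" "x \<in> dom_of \<kappa>"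
    then have "dird \<kappa> f x v = dird \<kappa>' f x (?J x v)"
      by (intro dird_change[OF assms(1-4)]) auto
    then show "dird \<kappa> f x v = c 1 x *\<^sub>R D 1 x + c 2 x *\<^sub>R D 2 x"
      using linear_real2[OF lin[OF x(1)], of "?J x v"] by (simp add: c_def D_def)
  qed
  also have "\<dots> = (c 1 p *\<^sub>R dird \<kappa> (D 1) p u + c 2 p *\<^sub>R dird \<kappa> (D 2) p u)
      + (dird \<kappa> (c 1) p u *\<^sub>R D 1 p + dird \<kappa> (c 2) p u *\<^sub>R D 2 p)"
    by (simp add: dird_add[OF sR sR assms(3) oW pW assms(6)] dR)
  also have "c 1 p *\<^sub>R dird \<kappa> (D 1) p u + c 2 p *\<^sub>R dird \<kappa> (D 2) p u
      = dird \<kappa>' (\<lambda>x. dird \<kappa>' f x (?J p v)) p (?J p u)"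
  proof -
    have "dird \<kappa> (D i) p u = dird \<kappa>' (\<lambda>x. dird \<kappa>' f x (axis i 1)) p (?J p u)" for i
      using dird_change[OF sD oW assms(3,4) pW assms(6,7)] unfolding D_def .
    moreover have "linear (\<lambda>w. dird \<kappa>' (\<lambda>x. dird \<kappa>' f x w) p (?J p u))"
      unfolding dird_dird[OF assms(4,7)]
      by (rule linear_pd_arg[OF open_patch[OF assms(4,2)] smooth_map_patch[OF assms(1,4)]]) (use assms in blast)
    from linear_real2[OF this, of "?J p v"]
    have "dird \<kappa>' (\<lambda>x. dird \<kappa>' f x (?J p v)) p (?J p u) =
      c 1 p *\<^sub>R dird \<kappa>' (\<lambda>x. dird \<kappa>' f x e1) p (?J p u) + c 2 p *\<^sub>R dird \<kappa>' (\<lambda>x. dird \<kappa>' f x e2) p (?J p u)"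
      by (simp add: c_def)
    ultimately show ?thesis by simp
  qed
  also have "dird \<kappa> (c 1) p u *\<^sub>R D 1 p + dird \<kappa> (c 2) p u *\<^sub>R D 2 p
      = dird \<kappa>' f p (dird \<kappa> (c 1) p u *\<^sub>R e1 + dird \<kappa> (c 2) p u *\<^sub>R e2)"
    by (simp add: D_def linear_add[OF lin[OF pW]] linear_cmul[OF lin[OF pW]])
  finally show ?thesis by blast
qed

end

section \<open>The central sphere congruence\<close>

locale sphere_surface = surface T A for T :: "'a topology" and A :: "'a chart set" +
  fixes \<Lambda> :: "'a \<Rightarrow> ((real^'m) \<times> real) set"
  assumes immersed: "immersed_surface T A \<Lambda>"
begin

lemma null_line_Lambda: "p \<in> topspace T \<Longrightarrow> null_line (\<Lambda> p)"
  using immersed by (simp add: immersed_surface_def)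

lemma section_sub: "positive_section T A \<Lambda> W \<sigma> \<Longrightarrow> W \<subseteq> topspace T"
  unfolding positive_section_def using openin_subset by blast

lemma positive_sectionD:
  assumes "positive_section T A \<Lambda> W \<sigma>"
  shows "openin T W" "smooth_map_on A W \<sigma>" "p \<in> W \<Longrightarrow> \<sigma> p \<in> \<Lambda> p" "p \<in> W \<Longrightarrow> \<sigma> p \<in> half_cone"
  using assms by (auto simp: positive_section_def)

lemma half_cone_nonzero: "v \<in> half_cone \<Longrightarrow> v \<noteq> 0"
  by (auto simp: half_cone_def)

lemma Lambda_span:
  assumes "positive_section T A \<Lambda> W \<sigma>" "p \<in> W"
  shows "\<Lambda> p = span {\<sigma> p}"
  using null_line_eq_span[OF null_line_Lambda] positive_sectionD[OF assms(1)] section_sub[OF assms(1)]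
    assms(2) half_cone_nonzero by blast

lemma patch:
  assumes "positive_section T A \<Lambda> W \<sigma>" "\<kappa> \<in> A"
  shows "surface_patch (coord \<kappa> ` (W \<inter> dom_of \<kappa>)) (\<sigma> \<circ> param \<kappa>)"
proof
  note s = positive_sectionD[OF assms(1)]
  show "open (coord \<kappa> ` (W \<inter> dom_of \<kappa>))" by (rule open_patch[OF assms(2) s(1)])
  show "smooth_on (coord \<kappa> ` (W \<inter> dom_of \<kappa>)) (\<sigma> \<circ> param \<kappa>)"
    by (rule smooth_map_patch[OF s(2) assms(2)])
  fix x assume "x \<in> coord \<kappa> ` (W \<inter> dom_of \<kappa>)"
  then obtain p where p: "p \<in> W" "p \<in> dom_of \<kappa>" "x = coord \<kappa> p" by blast
  have px: "param \<kappa> x = p" using p param_coord[OF assms(2)] by simp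
  show "(\<sigma> \<circ> param \<kappa>) x \<in> half_cone" using s(4) p px by simp
  fix u assume "frechet_derivative (\<sigma> \<circ> param \<kappa>) (at x) u \<in> span {(\<sigma> \<circ> param \<kappa>) x}"
  then have "dird \<kappa> \<sigma> p u \<in> \<Lambda> p"
    using Lambda_span[OF assms(1) p(1)] px p by (simp add: dird_def)
  then show "u = 0" using immersed assms p unfolding immersed_surface_def by blast
qed

lemma ind_metric_met:
  "ind_metric \<sigma> \<kappa> p = surface_patch.met (\<sigma> \<circ> param \<kappa>) (coord \<kappa> p)"
  if "positive_section T A \<Lambda> W \<sigma>" "\<kappa> \<in> A"
  unfolding surface_patch.met_def[OF patch[OF that]] ind_metric_def[abs_def] dird_def ..

lemma ind_metric_inner:
  assumes "positive_section T A \<Lambda> W \<sigma>" "\<kappa> \<in> A" "p \<in> W" "p \<in> dom_of \<kappa>"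
  shows "inner_prod2 (ind_metric \<sigma> \<kappa> p)"
  unfolding ind_metric_met[OF assms(1,2)]
  by (rule surface_patch.met_inner[OF patch[OF assms(1,2)]]) (use assms in blast)

text \<open>Each null line meets the hyperplane of time component 1 in exactly one point, so this is
  a positive section over the whole surface and needs no partition of unity.\<close>

definition sec0 :: "'a \<Rightarrow> (real^'m) \<times> real" where
  "sec0 p = (SOME v. v \<in> \<Lambda> p \<and> snd v = 1)"

lemma null_snd_nonzero:
  assumes "null_line L" "v \<in> L" "v \<noteq> 0"
  shows "snd v \<noteq> 0"
proof
  assume "snd v = 0"
  moreover have "lor v v = 0" using assms by (simp add: null_line_def)
  ultimately show False using assms(3) by (simp add: lor_def prod_eq_iff)
qed

lemma normalized_unique:
  assumes "null_line L" "v \<in> L" "w \<in> L" "snd v = 1" "snd w = 1"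
  shows "v = w"
proof (rule ccontr)
  assume "v \<noteq> w"
  moreover have "v - w \<in> L" using assms by (simp add: null_line_def subspace_diff)
  ultimately show False using null_snd_nonzero[OF assms(1), of "v - w"] assms(4,5) by simp
qed

lemma sec0:
  assumes "p \<in> topspace T"
  shows "sec0 p \<in> \<Lambda> p" "snd (sec0 p) = 1"
proof -
  have "subspace (\<Lambda> p)" "dim (\<Lambda> p) = 1"
    using null_line_Lambda[OF assms] by (simp_all add: null_line_def)
  then have "\<not> \<Lambda> p \<subseteq> {0}" using dim_eq_0[of "\<Lambda> p"] by simp
  then obtain v where v: "v \<in> \<Lambda> p" "v \<noteq> 0" by blast
  then have "inverse (snd v) *\<^sub>R v \<in> \<Lambda> p \<and> snd (inverse (snd v) *\<^sub>R v) = 1"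
    using null_snd_nonzero[OF null_line_Lambda[OF assms] v] \<open>subspace (\<Lambda> p)\<close> by (simp add: subspace_scale)
  from someI[of "\<lambda>v. v \<in> \<Lambda> p \<and> snd v = 1", OF this]
  show "sec0 p \<in> \<Lambda> p" "snd (sec0 p) = 1" by (simp_all add: sec0_def)
qed

lemma sec0_eq:
  assumes "p \<in> topspace T" "v \<in> \<Lambda> p" "v \<noteq> 0"
  shows "sec0 p = inverse (snd v) *\<^sub>R v"
proof (rule normalized_unique[OF null_line_Lambda[OF assms(1)] sec0(1)[OF assms(1)] _ sec0(2)[OF assms(1)]])
  show "inverse (snd v) *\<^sub>R v \<in> \<Lambda> p"
    using null_line_Lambda[OF assms(1)] assms(2) by (simp add: null_line_def subspace_scale)
  show "snd (inverse (snd v) *\<^sub>R v) = 1"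
    using null_snd_nonzero[OF null_line_Lambda[OF assms(1)] assms(2,3)] by simp
qed

text \<open>Locally \<open>sec0\<close> is a spanning section divided by its time component; the
  quotient is insensitive to the scale and the sign of that section.\<close>

lemma sec0_smooth: "smooth_map_on A (topspace T) sec0"
  unfolding smooth_map_on_def
proof
  fix \<kappa> assume k: "\<kappa> \<in> A"
  show "smooth_on (coord \<kappa> ` (topspace T \<inter> dom_of \<kappa>)) (sec0 \<circ> param \<kappa>)"
  proof (rule smooth_on_local)
    fix x assume "x \<in> coord \<kappa> ` (topspace T \<inter> dom_of \<kappa>)"
    then obtain p where p: "p \<in> topspace T" "p \<in> dom_of \<kappa>" "x = coord \<kappa> p" by blast
    obtain W s where W: "openin T W" "p \<in> W" "smooth_map_on A W (s (0::nat))"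
      "\<And>x. x \<in> W \<Longrightarrow> \<Lambda> x = span {s 0 x} \<and> dim (\<Lambda> x) = 1"
    proof -
      have "{..<Suc 0} = {0::nat}" by auto
      then show thesis
        using immersed p(1) that unfolding immersed_surface_def smooth_subbundle_def
        by (metis (no_types, lifting) One_nat_def image_empty image_insert zero_less_one)
    qed
    let ?N = "coord \<kappa> ` (W \<inter> dom_of \<kappa>)"
    let ?s = "s 0 \<circ> param \<kappa>"
    have oN: "open ?N" by (rule open_patch[OF k W(1)])
    have sub: "W \<subseteq> topspace T" using W(1) openin_subset by blast
    have s: "s 0 y \<in> \<Lambda> y" "s 0 y \<noteq> 0" if "y \<in> W" for y
      using W(4)[OF that] by (auto intro: span_base)
    have par: "param \<kappa> y \<in> W" if "y \<in> ?N" for y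
      using that param_coord[OF k] by auto
    have ss: "smooth_on ?N ?s" by (rule smooth_map_patch[OF W(3) k])
    have "smooth_on ?N (\<lambda>y. inverse (snd (?s y)) *\<^sub>R ?s y)"
      using null_snd_nonzero[OF null_line_Lambda s] par sub
      by (intro smooth_on_scaleR smooth_on_inverse oN ss smooth_on_bounded_linear[OF bounded_linear_snd]) auto
    then have "smooth_on ?N (sec0 \<circ> param \<kappa>)"
      using smooth_on_cong[OF oN, of "sec0 \<circ> param \<kappa>" "\<lambda>y. inverse (snd (?s y)) *\<^sub>R ?s y"]
        sec0_eq[OF _ s] par sub by (simp add: subset_iff)
    then show "\<exists>N. open N \<and> x \<in> N \<and> N \<subseteq> coord \<kappa> ` (topspace T \<inter> dom_of \<kappa>) \<and> smooth_on N (sec0 \<circ> param \<kappa>)"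
      using oN p W(2) sub by (intro exI[of _ ?N]) auto
  qed
qed

lemma sec0_positive: "positive_section T A \<Lambda> (topspace T) sec0"
  unfolding positive_section_def half_cone_def
  using sec0_smooth sec0 null_line_Lambda by (auto simp: null_line_def)

lemma dom_topspace: "\<kappa> \<in> A \<Longrightarrow> p \<in> dom_of \<kappa> \<Longrightarrow> p \<in> topspace T"
  using dom_sub by blast

lemma lor_section:
  assumes "positive_section T A \<Lambda> W \<sigma>" "\<kappa> \<in> A" "p \<in> W" "p \<in> dom_of \<kappa>"
  shows "lor (\<sigma> p) (\<sigma> p) = 0" "lor (\<sigma> p) (dird \<kappa> \<sigma> p u) = 0" "lor (dird \<kappa> \<sigma> p u) (\<sigma> p) = 0"
    "lor (\<sigma> p) (dird \<kappa> (\<lambda>x. dird \<kappa> \<sigma> x v) p u) = - ind_metric \<sigma> \<kappa> p u v"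
proof -
  interpret P: surface_patch "coord \<kappa> ` (W \<inter> dom_of \<kappa>)" "\<sigma> \<circ> param \<kappa>"
    by (rule patch[OF assms(1,2)])
  have x: "coord \<kappa> p \<in> coord \<kappa> ` (W \<inter> dom_of \<kappa>)" and px: "param \<kappa> (coord \<kappa> p) = p"
    using assms param_coord by blast+
  show "lor (\<sigma> p) (\<sigma> p) = 0" using P.null_F[OF x] px by simp
  show "lor (\<sigma> p) (dird \<kappa> \<sigma> p u) = 0" "lor (dird \<kappa> \<sigma> p u) (\<sigma> p) = 0"
    using P.lor_F_dF[OF x] px by (simp_all add: dird_def)
  show "lor (\<sigma> p) (dird \<kappa> (\<lambda>x. dird \<kappa> \<sigma> x v) p u) = - ind_metric \<sigma> \<kappa> p u v"
    using P.lor_F_d2F[OF x] px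
    by (simp add: dird_dird[OF assms(2,4)] ind_metric_met[OF assms(1,2)])
qed

lemma section_scale:
  assumes "positive_section T A \<Lambda> W \<sigma>" "p \<in> W"
  shows "\<sigma> p = snd (\<sigma> p) *\<^sub>R sec0 p" "snd (\<sigma> p) > 0"
proof -
  have s: "\<sigma> p \<in> half_cone" "\<sigma> p \<in> \<Lambda> p" using positive_sectionD[OF assms(1)] assms(2) by auto
  show pos: "snd (\<sigma> p) > 0" using s(1) by (simp add: half_cone_def)
  show "\<sigma> p = snd (\<sigma> p) *\<^sub>R sec0 p"
    using sec0_eq[OF _ s(2) half_cone_nonzero[OF s(1)]] section_sub[OF assms(1)] assms(2) pos
    by (simp add: subset_iff)
qed

section \<open>Derivatives under rescaling of the section\<close>

lemma smooth_snd:
  assumes "positive_section T A \<Lambda> W \<sigma>"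
  shows "smooth_map_on A W (\<lambda>x. snd (\<sigma> x))"
  using smooth_map_on_bounded_linear[OF bounded_linear_snd] positive_sectionD[OF assms] by blast

lemma sec0_smooth_on:
  assumes "positive_section T A \<Lambda> W \<sigma>"
  shows "smooth_map_on A W sec0"
  by (rule smooth_map_on_subset[OF sec0_smooth section_sub[OF assms]])

lemma dird_section:
  assumes "positive_section T A \<Lambda> W \<sigma>" "\<kappa> \<in> A" "p \<in> W" "p \<in> dom_of \<kappa>"
  defines "f \<equiv> \<lambda>x. snd (\<sigma> x)"
  shows "dird \<kappa> \<sigma> p u = f p *\<^sub>R dird \<kappa> sec0 p u + dird \<kappa> f p u *\<^sub>R sec0 p"
proof -
  note o = positive_sectionD(1)[OF assms(1)]
  have "dird \<kappa> \<sigma> p u = dird \<kappa> (\<lambda>x. f x *\<^sub>R sec0 x) p u"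
    unfolding f_def using section_scale(1)[OF assms(1)] by (intro dird_cong[OF assms(2) o assms(3,4)])
  also have "\<dots> = f p *\<^sub>R dird \<kappa> sec0 p u + dird \<kappa> f p u *\<^sub>R sec0 p"
    unfolding f_def
    by (rule dird_bounded_bilinear[OF bounded_bilinear_scaleR smooth_snd[OF assms(1)] sec0_smooth_on[OF assms(1)] assms(2) o assms(3,4)])
  finally show ?thesis .
qed

text \<open>Apart from the first, rescaled term, everything lies in the span of \<open>sec0\<close>
  and its first derivatives.\<close>

lemma dird_dird_section:
  assumes "positive_section T A \<Lambda> W \<sigma>" "\<kappa> \<in> A" "p \<in> W" "p \<in> dom_of \<kappa>"
  defines "f \<equiv> \<lambda>x. snd (\<sigma> x)"
  shows "dird \<kappa> (\<lambda>x. dird \<kappa> \<sigma> x v) p u =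
      (f p *\<^sub>R dird \<kappa> (\<lambda>x. dird \<kappa> sec0 x v) p u + dird \<kappa> f p u *\<^sub>R dird \<kappa> sec0 p v)
    + (dird \<kappa> f p v *\<^sub>R dird \<kappa> sec0 p u + dird \<kappa> (\<lambda>x. dird \<kappa> f x v) p u *\<^sub>R sec0 p)"
proof -
  let ?W = "W \<inter> dom_of \<kappa>"
  have oW: "openin T W" by (rule positive_sectionD(1)[OF assms(1)])
  have o: "openin T ?W" using oW chart_homeo(1)[OF assms(2)] by blast
  have p: "p \<in> ?W" using assms by blast
  have sf: "smooth_map_on A W f" unfolding f_def by (rule smooth_snd[OF assms(1)])
  note s0 = sec0_smooth_on[OF assms(1)]
  have s: "smooth_map_on A ?W f" "smooth_map_on A ?W sec0"
    using sf s0 by (auto intro: smooth_map_on_subset)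
  have sd: "smooth_map_on A ?W (\<lambda>x. dird \<kappa> f x v)" "smooth_map_on A ?W (\<lambda>x. dird \<kappa> sec0 x v)"
    using smooth_map_on_dird[OF sf assms(2) oW] smooth_map_on_dird[OF s0 assms(2) oW] by blast+
  note R = smooth_map_on_bounded_bilinear[OF bounded_bilinear_scaleR o]
    dird_bounded_bilinear[OF bounded_bilinear_scaleR _ _ assms(2) o p assms(4)]
  have "dird \<kappa> (\<lambda>x. dird \<kappa> \<sigma> x v) p u
      = dird \<kappa> (\<lambda>x. f x *\<^sub>R dird \<kappa> sec0 x v + dird \<kappa> f x v *\<^sub>R sec0 x) p u"
    unfolding f_def using dird_section[OF assms(1,2)] by (intro dird_cong[OF assms(2) o p assms(4)]) auto
  also have "\<dots> = dird \<kappa> (\<lambda>x. f x *\<^sub>R dird \<kappa> sec0 x v) p u + dird \<kappa> (\<lambda>x. dird \<kappa> f x v *\<^sub>R sec0 x) p u"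
    by (rule dird_add[OF R(1)[OF s(1) sd(2)] R(1)[OF sd(1) s(2)] assms(2) o p assms(4)])
  finally show ?thesis by (simp add: R(2)[OF s(1) sd(2)] R(2)[OF sd(1) s(2)])
qed

lemma ind_metric_section:
  assumes "positive_section T A \<Lambda> W \<sigma>" "\<kappa> \<in> A" "p \<in> W" "p \<in> dom_of \<kappa>"
  shows "ind_metric \<sigma> \<kappa> p u v = snd (\<sigma> p) * snd (\<sigma> p) * ind_metric sec0 \<kappa> p u v"
  using lor_section[OF sec0_positive assms(2) dom_topspace[OF assms(2,4)] assms(4)]
  by (simp add: ind_metric_def dird_section[OF assms] lor_simps)

text \<open>The trace of the coordinate second derivatives, without Christoffel correction; the
  correction would be a first derivative of \<sigma> and so would not affect the spans formed
  below.\<close>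

definition lap :: "('a \<Rightarrow> (real^'m) \<times> real) \<Rightarrow> 'a chart \<Rightarrow> 'a \<Rightarrow> (real^'m) \<times> real" where
  "lap \<sigma> \<kappa> p = metric_trace (ind_metric \<sigma> \<kappa> p) (\<lambda>u v. dird \<kappa> (\<lambda>x. dird \<kappa> \<sigma> x v) p u)"

lemma bilinear_d2_section:
  assumes "positive_section T A \<Lambda> W \<sigma>" "\<kappa> \<in> A" "p \<in> W" "p \<in> dom_of \<kappa>"
  shows "bilinear (\<lambda>u v. dird \<kappa> (\<lambda>x. dird \<kappa> \<sigma> x v) p u)"
  using bilinear_dird_dird[OF positive_sectionD(2)[OF assms(1)] assms(2) positive_sectionD(1)[OF assms(1)] assms(3,4)] .

lemma lap_orthonormal:
  assumes "positive_section T A \<Lambda> W \<sigma>" "\<kappa> \<in> A" "p \<in> W" "p \<in> dom_of \<kappa>"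
    "orthonormal2 (ind_metric \<sigma> \<kappa> p) x y"
  shows "lap \<sigma> \<kappa> p = dird \<kappa> (\<lambda>z. dird \<kappa> \<sigma> z x) p x + dird \<kappa> (\<lambda>z. dird \<kappa> \<sigma> z y) p y"
  unfolding lap_def
  by (rule metric_trace_orthonormal[OF ind_metric_inner[OF assms(1-4)] assms(5) bilinear_d2_section[OF assms(1-4)]])

text \<open>The classical mean curvature sphere: the span of a section, its derivatives and its
  Laplacian.\<close>

definition csphere :: "'a chart \<Rightarrow> 'a \<Rightarrow> ((real^'m) \<times> real) set" where
  "csphere \<kappa> p = span {sec0 p, dird \<kappa> sec0 p e1, dird \<kappa> sec0 p e2, lap sec0 \<kappa> p}"

lemma csphere_in:
  assumes "\<kappa> \<in> A" "p \<in> dom_of \<kappa>"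
  shows "sec0 p \<in> csphere \<kappa> p" "dird \<kappa> sec0 p u \<in> csphere \<kappa> p" "lap sec0 \<kappa> p \<in> csphere \<kappa> p"
proof -
  show "sec0 p \<in> csphere \<kappa> p" "lap sec0 \<kappa> p \<in> csphere \<kappa> p"
    unfolding csphere_def by (rule span_base, simp)+
  have "dird \<kappa> sec0 p u = (u$1) *\<^sub>R dird \<kappa> sec0 p e1 + (u$2) *\<^sub>R dird \<kappa> sec0 p e2"
    by (rule linear_real2[OF linear_dird[OF sec0_smooth assms(1) openin_topspace dom_topspace[OF assms] assms(2)]])
  then show "dird \<kappa> sec0 p u \<in> csphere \<kappa> p"
    unfolding csphere_def by (auto intro!: span_add span_scale intro: span_base)
qed

lemma subspace_csphere: "subspace (csphere \<kappa> p)"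
  unfolding csphere_def by simp

text \<open>If c is the time component of \<sigma> at p, multiplication by c turns orthonormal pairs
  for \<sigma> into orthonormal pairs for \<open>sec0\<close>. The traces thus agree up to a factor
  and terms of first order.\<close>

lemma lap_in_csphere:
  assumes "positive_section T A \<Lambda> W \<sigma>" "\<kappa> \<in> A" "p \<in> W" "p \<in> dom_of \<kappa>"
  shows "lap \<sigma> \<kappa> p \<in> csphere \<kappa> p"
proof -
  note in0 = csphere_in[OF assms(2,4)]
  note pt = dom_topspace[OF assms(2,4)]
  obtain x y where xy: "orthonormal2 (ind_metric \<sigma> \<kappa> p) x y"
    using orthonormal2_exists[OF ind_metric_inner[OF assms]] by blast
  define c where "c = snd (\<sigma> p)"
  have c: "c > 0" unfolding c_def by (rule section_scale(2)[OF assms(1,3)])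
  let ?D = "\<lambda>u v. dird \<kappa> (\<lambda>x. dird \<kappa> sec0 x v) p u"
  note bl = bilinear_simps[OF inner_prod2D(1)[OF ind_metric_inner[OF sec0_positive assms(2) pt assms(4)]]]
  have "orthonormal2 (ind_metric sec0 \<kappa> p) (c *\<^sub>R x) (c *\<^sub>R y)"
    using xy ind_metric_section[OF assms] c
    unfolding orthonormal2_def by (simp add: c_def[symmetric] bl mult.assoc)
  from lap_orthonormal[OF sec0_positive assms(2) pt assms(4) this]
  have "lap sec0 \<kappa> p = (c * c) *\<^sub>R (?D x x + ?D y y)"
    using bilinear_simps[OF bilinear_d2_section[OF sec0_positive assms(2) pt assms(4)]]
    by (simp add: scaleR_add_right)
  then have "?D x x + ?D y y = (1 / (c * c)) *\<^sub>R lap sec0 \<kappa> p" using c by simp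
  then have D: "?D x x + ?D y y \<in> csphere \<kappa> p"
    using in0(3) subspace_csphere by (simp add: subspace_scale)
  have "\<exists>w\<in>csphere \<kappa> p. dird \<kappa> (\<lambda>x. dird \<kappa> \<sigma> x u) p u = c *\<^sub>R ?D u u + w" for u
    unfolding dird_dird_section[OF assms, of u u] c_def[symmetric] add.assoc
    by (rule bexI, rule refl) (intro subspace_add[OF subspace_csphere] subspace_scale[OF subspace_csphere] in0)
  then obtain w w' where w: "w \<in> csphere \<kappa> p" "dird \<kappa> (\<lambda>z. dird \<kappa> \<sigma> z x) p x = c *\<^sub>R ?D x x + w"
    "w' \<in> csphere \<kappa> p" "dird \<kappa> (\<lambda>z. dird \<kappa> \<sigma> z y) p y = c *\<^sub>R ?D y y + w'" by metis
  have "lap \<sigma> \<kappa> p = c *\<^sub>R (?D x x + ?D y y) + (w + w')"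
    unfolding lap_orthonormal[OF assms xy] w by (simp add: algebra_simps)
  then show ?thesis
    using D w(1,3) subspace_csphere by (simp add: subspace_add subspace_scale)
qed

text \<open>The Jacobian of the transition map preserves the induced metric, hence orthonormal
  pairs, and the defect in \<open>dird_dird_change\<close> is a first derivative, already in the
  span. Exchanging the charts gives equality.\<close>

lemma csphere_subset:
  assumes "\<kappa> \<in> A" "\<kappa>' \<in> A" "p \<in> dom_of \<kappa>" "p \<in> dom_of \<kappa>'"
  shows "csphere \<kappa> p \<subseteq> csphere \<kappa>' p"
proof -
  note pt = dom_topspace[OF assms(1,3)]
  note in' = csphere_in[OF assms(2,4)]
  let ?J = "change_coord \<kappa> \<kappa>' p"
  have ch: "dird \<kappa> sec0 p u = dird \<kappa>' sec0 p (?J u)" for u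
    by (rule dird_change[OF sec0_smooth openin_topspace assms(1,2) pt assms(3,4)])
  obtain x y where xy: "orthonormal2 (ind_metric sec0 \<kappa> p) x y"
    using orthonormal2_exists[OF ind_metric_inner[OF sec0_positive assms(1) pt assms(3)]] by blast
  then have xy': "orthonormal2 (ind_metric sec0 \<kappa>' p) (?J x) (?J y)"
    unfolding orthonormal2_def ind_metric_def ch .
  note d2 = dird_dird_change[OF sec0_smooth openin_topspace assms(1,2) pt assms(3,4)]
  obtain w w' where w:
    "dird \<kappa> (\<lambda>z. dird \<kappa> sec0 z x) p x = dird \<kappa>' (\<lambda>z. dird \<kappa>' sec0 z (?J x)) p (?J x) + dird \<kappa>' sec0 p w"
    "dird \<kappa> (\<lambda>z. dird \<kappa> sec0 z y) p y = dird \<kappa>' (\<lambda>z. dird \<kappa>' sec0 z (?J y)) p (?J y) + dird \<kappa>' sec0 p w'"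
    using d2 by meson
  have "lap sec0 \<kappa> p = lap sec0 \<kappa>' p + (dird \<kappa>' sec0 p w + dird \<kappa>' sec0 p w')"
    unfolding lap_orthonormal[OF sec0_positive assms(1) pt assms(3) xy]
      lap_orthonormal[OF sec0_positive assms(2) pt assms(4) xy'] w by (simp add: algebra_simps)
  then have "lap sec0 \<kappa> p \<in> csphere \<kappa>' p"
    using in' subspace_csphere by (simp add: subspace_add)
  then show ?thesis
    unfolding csphere_def[of \<kappa>] using in' ch subspace_csphere by (intro span_minimal) auto
qed

text \<open>Pairing \<open>sec0\<close> with its second derivatives gives minus the metric, whose
  trace is 2; so \<open>lap\<close> pairs to -2 with \<open>sec0\<close> and can be completed to the
  null vector \<open>m\<close>. The resulting frame has dimension 4, and \<open>csphere\<close> is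
  spanned by four vectors.\<close>

lemma csphere_frame:
  assumes "\<kappa> \<in> A" "p \<in> dom_of \<kappa>"
  shows "\<exists>a b m. null_frame (sec0 p) a b m \<and> csphere \<kappa> p = span {sec0 p, a, b, m}"
proof -
  note pt = dom_topspace[OF assms]
  note ls = lor_section[OF sec0_positive assms(1) pt assms(2)]
  note in' = csphere_in[OF assms]
  obtain x y where xy: "orthonormal2 (ind_metric sec0 \<kappa> p) x y"
    using orthonormal2_exists[OF ind_metric_inner[OF sec0_positive assms(1) pt assms(2)]] by blast
  let ?a = "dird \<kappa> sec0 p x" and ?b = "dird \<kappa> sec0 p y"
  have "lor (sec0 p) (lap sec0 \<kappa> p) = -2"
    using xy unfolding lap_orthonormal[OF sec0_positive assms(1) pt assms(2) xy]
    by (simp add: lor_simps ls orthonormal2_def)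
  moreover have "lor ?a ?a = 1" "lor ?b ?b = 1" "lor ?a ?b = 0"
    using xy by (simp_all add: orthonormal2_def ind_metric_def)
  ultimately obtain m where m: "null_frame (sec0 p) ?a ?b m" "m \<in> span {sec0 p, ?a, ?b, lap sec0 \<kappa> p}"
    using null_frame_exists[of "sec0 p" ?a ?b "lap sec0 \<kappa> p"] ls by auto
  have "span {sec0 p, ?a, ?b, lap sec0 \<kappa> p} \<subseteq> csphere \<kappa> p"
    using in' subspace_csphere by (intro span_minimal) auto
  then have sub: "{sec0 p, ?a, ?b, m} \<subseteq> csphere \<kappa> p" using m(2) in' by blast
  then have "span {sec0 p, ?a, ?b, m} \<subseteq> csphere \<kappa> p" using subspace_csphere by (rule span_minimal)
  moreover have "dim (csphere \<kappa> p) \<le> 4"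
  proof -
    have "dim (csphere \<kappa> p) \<le> card {sec0 p, dird \<kappa> sec0 p e1, dird \<kappa> sec0 p e2, lap sec0 \<kappa> p}"
      unfolding csphere_def dim_span by (rule dim_le_card') simp
    also have "\<dots> \<le> 4" by (simp add: card_insert_if)
    finally show ?thesis .
  qed
  ultimately have "csphere \<kappa> p = span {sec0 p, ?a, ?b, m}"
    using null_frame_dim[OF m(1)] subspace_dim_equal[OF subspace_span subspace_csphere] by metis
  then show ?thesis using m(1) by blast
qed

definition VC :: "'a \<Rightarrow> ((real^'m) \<times> real) set" where
  "VC p = csphere (SOME \<kappa>. \<kappa> \<in> A \<and> p \<in> dom_of \<kappa>) p"

lemma VC_chart:
  assumes "\<kappa> \<in> A" "p \<in> dom_of \<kappa>"
  shows "VC p = csphere \<kappa> p"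
proof -
  let ?k = "SOME \<kappa>. \<kappa> \<in> A \<and> p \<in> dom_of \<kappa>"
  have k: "?k \<in> A \<and> p \<in> dom_of ?k" by (rule someI[of _ \<kappa>]) (use assms in blast)
  show ?thesis
    unfolding VC_def using k assms csphere_subset[of ?k \<kappa> p] csphere_subset[of \<kappa> ?k p] by blast
qed

lemma VC_signature:
  assumes "p \<in> topspace T"
  shows "has_signature (VC p) 3 1" "subspace (VC p)" "dim (VC p) = 4"
proof -
  obtain \<kappa> where k: "\<kappa> \<in> A" "p \<in> dom_of \<kappa>" using chart_at[OF assms] .
  obtain a b m where f: "null_frame (sec0 p) a b m" "csphere \<kappa> p = span {sec0 p, a, b, m}"
    using csphere_frame[OF k] by blast
  show "has_signature (VC p) 3 1" "subspace (VC p)" "dim (VC p) = 4"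
    unfolding VC_chart[OF k] f(2) using null_frame_signature[OF f(1)] null_frame_dim[OF f(1)] by auto
qed

lemma Lambda1_VC:
  assumes "p \<in> topspace T"
  shows "Lambda1 T A \<Lambda> p \<subseteq> VC p"
  unfolding Lambda1_def
proof (rule span_minimal[OF _ VC_signature(2)[OF assms]], intro Un_least subsetI)
  obtain \<kappa> where k: "\<kappa> \<in> A" "p \<in> dom_of \<kappa>" using chart_at[OF assms] .
  fix v assume "v \<in> {\<sigma> p |W \<sigma>. positive_section T A \<Lambda> W \<sigma> \<and> p \<in> W}"
  then obtain W \<sigma> where "v = \<sigma> p" "positive_section T A \<Lambda> W \<sigma>" "p \<in> W" by blast
  then have "v = snd (\<sigma> p) *\<^sub>R sec0 p" using section_scale by blast
  then show "v \<in> VC p"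
    unfolding VC_chart[OF k] using csphere_in(1)[OF k] subspace_csphere by (simp add: subspace_scale)
next
  fix v assume "v \<in> {dird \<kappa> \<sigma> p u |W \<sigma> \<kappa> u. positive_section T A \<Lambda> W \<sigma> \<and> p \<in> W \<and> \<kappa> \<in> A \<and> p \<in> dom_of \<kappa>}"
  then obtain W \<sigma> \<kappa> u where v: "v = dird \<kappa> \<sigma> p u" "positive_section T A \<Lambda> W \<sigma>" "p \<in> W"
    and k: "\<kappa> \<in> A" "p \<in> dom_of \<kappa>" by auto
  show "v \<in> VC p"
    unfolding v(1) VC_chart[OF k] dird_section[OF v(2) k(1) v(3) k(2)]
    by (intro subspace_add[OF subspace_csphere] subspace_scale[OF subspace_csphere] csphere_in k)
qed

lemma smooth_lap:
  assumes "\<kappa> \<in> A"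
  shows "smooth_map_on A (dom_of \<kappa>) (lap sec0 \<kappa>)"
proof -
  interpret P: surface_patch "coord \<kappa> ` (topspace T \<inter> dom_of \<kappa>)" "sec0 \<circ> param \<kappa>"
    by (rule patch[OF sec0_positive assms])
  let ?F = "sec0 \<circ> param \<kappa>"
  let ?U = "coord \<kappa> ` dom_of \<kappa>"
  have U: "coord \<kappa> ` (topspace T \<inter> dom_of \<kappa>) = ?U" using dom_sub[OF assms] by (simp add: Int_absorb1)
  note sm = P.smooth_inverse_gdet[unfolded U] P.smooth_met[unfolded U] P.smooth_pd_F[unfolded U]
    and o = P.open_U[unfolded U]
  have "smooth_on ?U (\<lambda>x. inverse (gdet (P.met x)) *\<^sub>R
    (P.met x e2 e2 *\<^sub>R pd e1 (pd e1 ?F) x - P.met x e1 e2 *\<^sub>R (pd e1 (pd e2 ?F) x + pd e2 (pd e1 ?F) x)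
      + P.met x e1 e1 *\<^sub>R pd e2 (pd e2 ?F) x))"
    by (intro smooth_on_scaleR smooth_on_add smooth_on_diff smooth_on_deriv[OF sm(3)] sm o)
  then show ?thesis
  proof (rule smooth_map_on_chart[OF assms chart_homeo(1)[OF assms] order_refl])
    fix p assume p: "p \<in> dom_of \<kappa>"
    note pt = dom_topspace[OF assms p]
    show "lap sec0 \<kappa> p = inverse (gdet (P.met (coord \<kappa> p))) *\<^sub>R
      (P.met (coord \<kappa> p) e2 e2 *\<^sub>R pd e1 (pd e1 ?F) (coord \<kappa> p)
       - P.met (coord \<kappa> p) e1 e2 *\<^sub>R (pd e1 (pd e2 ?F) (coord \<kappa> p) + pd e2 (pd e1 ?F) (coord \<kappa> p))
       + P.met (coord \<kappa> p) e1 e1 *\<^sub>R pd e2 (pd e2 ?F) (coord \<kappa> p))"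
      unfolding lap_def
        metric_trace_coord[OF ind_metric_inner[OF sec0_positive assms pt p] bilinear_d2_section[OF sec0_positive assms pt p]]
      unfolding ind_metric_met[OF sec0_positive assms] dird_dird[OF assms p] by (simp add: inverse_eq_divide)
  qed
qed

lemma sphere_congruence_VC: "sphere_congruence T A \<Lambda> VC"
  unfolding sphere_congruence_def smooth_subbundle_def
proof (intro conjI ballI)
  fix p assume p: "p \<in> topspace T"
  show "has_signature (VC p) 3 1" "Lambda1 T A \<Lambda> p \<subseteq> VC p"
    using VC_signature[OF p] Lambda1_VC[OF p] by auto
  obtain \<kappa> where k: "\<kappa> \<in> A" "p \<in> dom_of \<kappa>" using chart_at[OF p] .
  define s where "s = (\<lambda>i::nat. if i = 0 then sec0 else if i = 1 then (\<lambda>x. dird \<kappa> sec0 x e1)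
      else if i = 2 then (\<lambda>x. dird \<kappa> sec0 x e2) else lap sec0 \<kappa>)"
  have "smooth_map_on A (topspace T \<inter> dom_of \<kappa>) (\<lambda>x. dird \<kappa> sec0 x u)" for u
    by (rule smooth_map_on_dird[OF sec0_smooth k(1) openin_topspace])
  then have sd: "smooth_map_on A (dom_of \<kappa>) (\<lambda>x. dird \<kappa> sec0 x u)" for u
    using dom_sub[OF k(1)] by (simp add: Int_absorb1)
  have "smooth_map_on A (dom_of \<kappa>) (s i)" for i
    unfolding s_def using sd smooth_lap[OF k(1)] smooth_map_on_subset[OF sec0_smooth dom_sub[OF k(1)]] by simp
  moreover have "VC x = span ((\<lambda>i. s i x) ` {..<4}) \<and> dim (VC x) = 4" if "x \<in> dom_of \<kappa>" for x
  proof -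
    have "{..<4::nat} = {0, 1, 2, 3}" by auto
    then have "(\<lambda>i. s i x) ` {..<4} = {sec0 x, dird \<kappa> sec0 x e1, dird \<kappa> sec0 x e2, lap sec0 \<kappa> x}"
      by (simp add: s_def)
    then show ?thesis
      using VC_chart[OF k(1) that] VC_signature(3)[OF dom_topspace[OF k(1) that]] by (simp add: csphere_def)
  qed
  ultimately show "\<exists>W s. openin T W \<and> p \<in> W \<and> (\<forall>i<(4::nat). smooth_map_on A W (s i)) \<and>
      (\<forall>x\<in>W. VC x = span ((\<lambda>i. s i x) ` {..<4}) \<and> dim (VC x) = 4)"
    using chart_homeo(1)[OF k(1)] k(2) by (intro exI[of _ "dom_of \<kappa>"] exI[of _ s]) blast
qed

section \<open>Existence and uniqueness of the central sphere congruence\<close>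

lemma congruence_fibre:
  assumes "sphere_congruence T A \<Lambda> V" "p \<in> topspace T"
  shows "has_signature (V p) 3 1" "subspace (V p)" "dim (V p) = 4" "Lambda1 T A \<Lambda> p \<subseteq> V p"
proof -
  show "has_signature (V p) 3 1" "Lambda1 T A \<Lambda> p \<subseteq> V p"
    using assms by (auto simp: sphere_congruence_def)
  have "smooth_subbundle T A 4 V" using assms(1) by (simp add: sphere_congruence_def)
  from bspec[OF this[unfolded smooth_subbundle_def] assms(2)]
  obtain W s where "p \<in> W" "\<forall>x\<in>W. V x = span ((\<lambda>i. s i x) ` {..<4::nat}) \<and> dim (V x) = 4"
    by (elim exE conjE)
  then have e: "V p = span ((\<lambda>i. s i p) ` {..<4}) \<and> dim (V p) = 4" by (rule bspec[rotated])
  show "subspace (V p)" by (subst conjunct1[OF e]) (rule subspace_span)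
  show "dim (V p) = 4" by (rule conjunct2[OF e])
qed

lemma section_in_Lambda1:
  assumes "positive_section T A \<Lambda> W \<sigma>" "\<kappa> \<in> A" "p \<in> W" "p \<in> dom_of \<kappa>"
  shows "\<sigma> p \<in> Lambda1 T A \<Lambda> p" "dird \<kappa> \<sigma> p u \<in> Lambda1 T A \<Lambda> p"
  unfolding Lambda1_def using assms by (blast intro: span_base)+

lemma congruence_frame:
  assumes "sphere_congruence T A \<Lambda> V"
    and "positive_section T A \<Lambda> W \<sigma>" "\<kappa> \<in> A" "p \<in> W" "p \<in> dom_of \<kappa>"
    and "orthonormal2 (ind_metric \<sigma> \<kappa> p) x y"
  shows "\<exists>m. null_frame (\<sigma> p) (dird \<kappa> \<sigma> p x) (dird \<kappa> \<sigma> p y) m \<and>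
    V p = span {\<sigma> p, dird \<kappa> \<sigma> p x, dird \<kappa> \<sigma> p y, m}"
proof -
  note V = congruence_fibre[OF assms(1) dom_topspace[OF assms(3,5)]]
  note i = section_in_Lambda1[OF assms(2-5)]
  show ?thesis
    using V i lor_section[OF assms(2-5)] assms(6)
      half_cone_nonzero[OF positive_sectionD(4)[OF assms(2,4)]]
    by (intro null_frame_in_signature) (auto simp: orthonormal2_def ind_metric_def)
qed

text \<open>The projection to the complement of \<open>V p\<close> is linear and commutes with the
  trace, so the trace of the second fundamental form is minus the normal part of
  \<open>lap\<close>.\<close>

lemma trace_second_form:
  assumes "sphere_congruence T A \<Lambda> V"
    and "positive_section T A \<Lambda> W \<sigma>" "\<kappa> \<in> A" "p \<in> W" "p \<in> dom_of \<kappa>"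
  shows "metric_trace (ind_metric \<sigma> \<kappa> p) (second_form V \<sigma> \<kappa> p) = 0 \<longleftrightarrow> lap \<sigma> \<kappa> p \<in> V p"
proof -
  obtain x y where xy: "orthonormal2 (ind_metric \<sigma> \<kappa> p) x y"
    using orthonormal2_exists[OF ind_metric_inner[OF assms(2-5)]] by blast
  let ?a = "dird \<kappa> \<sigma> p x" and ?b = "dird \<kappa> \<sigma> p y"
  obtain m where m: "null_frame (\<sigma> p) ?a ?b m" "V p = span {\<sigma> p, ?a, ?b, m}"
    using congruence_frame[OF assms xy] by blast
  let ?P = "frame_proj (\<sigma> p) ?a ?b m"
  have pp: "- perp_part (V p) w = ?P w - w" for w
    unfolding m(2) by (simp add: perp_part_frame[OF m(1)])
  have l: "linear (\<lambda>w. ?P w - w)"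
    using linear_frame_proj by (intro linear_compose_sub linear_ident)
  have "metric_trace (ind_metric \<sigma> \<kappa> p) (second_form V \<sigma> \<kappa> p) = ?P (lap \<sigma> \<kappa> p) - lap \<sigma> \<kappa> p"
    unfolding lap_def second_form_def[abs_def] pp
    by (rule metric_trace_linear[OF ind_metric_inner[OF assms(2-5)] bilinear_d2_section[OF assms(2-5)] l])
  moreover have "?P w = w \<longleftrightarrow> w \<in> V p" for w
    using frame_proj_id[OF m(1)] frame_proj_in m(2) by metis
  ultimately show ?thesis by simp
qed

lemma central_VC: "central_congruence T A \<Lambda> VC"
  unfolding central_congruence_def
  using sphere_congruence_VC trace_second_form[OF sphere_congruence_VC] lap_in_csphere VC_chart by auto

text \<open>A central \<open>V\<close> contains \<open>Lambda1\<close> and, by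
  \<open>trace_second_form\<close>, \<open>lap\<close>; it therefore contains
  \<open>csphere\<close>, which has the same dimension.\<close>

lemma central_unique:
  assumes "central_congruence T A \<Lambda> V" "p \<in> topspace T"
  shows "V p = VC p"
proof -
  obtain \<kappa> where k: "\<kappa> \<in> A" "p \<in> dom_of \<kappa>" using chart_at[OF assms(2)] .
  have sc: "sphere_congruence T A \<Lambda> V" using assms(1) by (simp add: central_congruence_def)
  note V = congruence_fibre[OF sc assms(2)]
  have "metric_trace (ind_metric sec0 \<kappa> p) (second_form V sec0 \<kappa> p) = 0"
    using assms sec0_positive k unfolding central_congruence_def by blast
  then have "lap sec0 \<kappa> p \<in> V p"
    using trace_second_form[OF sc sec0_positive k(1) assms(2) k(2)] by simp
  then have "csphere \<kappa> p \<subseteq> V p"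
    unfolding csphere_def
    using section_in_Lambda1[OF sec0_positive k(1) assms(2) k(2)] V(2,4) by (intro span_minimal) auto
  then show ?thesis
    using VC_chart[OF k] VC_signature[OF assms(2)] V(2,3) by (metis order_refl subspace_dim_equal)
qed

lemma central_sphere_eq:
  assumes "p \<in> topspace T"
  shows "central_sphere T A \<Lambda> p = VC p"
  unfolding central_sphere_def
  by (rule the_equality) (use central_VC central_unique[OF _ assms] in blast)+

end

section \<open>The form determined by a quadratic differential\<close>

locale surface_qd = sphere_surface T A \<Lambda>
  for T :: "'a topology" and A :: "'a chart set" and \<Lambda> :: "'a \<Rightarrow> ((real^'m) \<times> real) set" +
  fixes q :: "('a, real) form2"
  assumes qd: "quadratic_differential T A \<Lambda> q"
begin

lemma q_props:
  assumes "\<kappa> \<in> A" "p \<in> dom_of \<kappa>"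
  shows "bilinear (q \<kappa> p)" "q \<kappa> p u v = q \<kappa> p v u"
    and "\<kappa>' \<in> A \<Longrightarrow> p \<in> dom_of \<kappa>' \<Longrightarrow>
      q \<kappa> p u v = q \<kappa>' p (change_coord \<kappa> \<kappa>' p u) (change_coord \<kappa> \<kappa>' p v)"
    and "positive_section T A \<Lambda> W \<sigma> \<Longrightarrow> p \<in> W \<Longrightarrow> metric_trace (ind_metric \<sigma> \<kappa> p) (q \<kappa> p) = 0"
proof -
  have s: "smooth_2tensor A q" using qd by (simp add: quadratic_differential_def)
  show "bilinear (q \<kappa> p)" using s assms by (simp add: smooth_2tensor_def)
  show "q \<kappa> p u v = q \<kappa> p v u" using qd assms unfolding quadratic_differential_def by blast
  show "q \<kappa> p u v = q \<kappa>' p (change_coord \<kappa> \<kappa>' p u) (change_coord \<kappa> \<kappa>' p v)"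
    if "\<kappa>' \<in> A" "p \<in> dom_of \<kappa>'"
    using s assms that unfolding smooth_2tensor_def by blast
  show "metric_trace (ind_metric \<sigma> \<kappa> p) (q \<kappa> p) = 0"
    if "positive_section T A \<Lambda> W \<sigma>" "p \<in> W"
    using qd assms that unfolding quadratic_differential_def by blast
qed

lemma patch_qd:
  assumes "positive_section T A \<Lambda> W \<sigma>" "\<kappa> \<in> A"
  shows "patch_qd (coord \<kappa> ` (W \<inter> dom_of \<kappa>)) (\<sigma> \<circ> param \<kappa>) (\<lambda>y. q \<kappa> (param \<kappa> y))"
proof -
  interpret P: surface_patch "coord \<kappa> ` (W \<inter> dom_of \<kappa>)" "\<sigma> \<circ> param \<kappa>"
    by (rule patch[OF assms])
  show ?thesis
  proof
    fix x assume "x \<in> coord \<kappa> ` (W \<inter> dom_of \<kappa>)"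
    then obtain p where p: "p \<in> W" "p \<in> dom_of \<kappa>" "x = coord \<kappa> p" by blast
    have px: "param \<kappa> x = p" using p param_coord[OF assms(2)] by simp
    show "bilinear (q \<kappa> (param \<kappa> x))" "q \<kappa> (param \<kappa> x) u v = q \<kappa> (param \<kappa> x) v u" for u v
      unfolding px by (rule q_props[OF assms(2) p(2)])+
    show "metric_trace (P.met x) (q \<kappa> (param \<kappa> x)) = 0"
      using q_props(4)[OF assms(2) p(2) assms(1) p(1)]
      by (simp add: px ind_metric_met[OF assms] flip: p(3))
  next
    fix u v
    have "smooth_on (coord \<kappa> ` dom_of \<kappa>) ((\<lambda>x. q \<kappa> x u v) \<circ> param \<kappa>)"
      using qd assms(2) by (simp add: quadratic_differential_def smooth_2tensor_def)
    then have "smooth_on (coord \<kappa> ` (W \<inter> dom_of \<kappa>)) ((\<lambda>x. q \<kappa> x u v) \<circ> param \<kappa>)"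
      by (rule smooth_on_subset) blast
    then show "smooth_on (coord \<kappa> ` (W \<inter> dom_of \<kappa>)) (\<lambda>x. q \<kappa> (param \<kappa> x) u v)"
      by (simp add: comp_def)
  qed
qed

definition qd_form :: "('a \<Rightarrow> (real^'m) \<times> real) \<Rightarrow>
    ('a, ((real^'m) \<times> real) \<Rightarrow>\<^sub>L ((real^'m) \<times> real)) form1" where
  "qd_form \<sigma> \<kappa> p u = wedge (\<sigma> p) (dird \<kappa> \<sigma> p (riesz2 (ind_metric \<sigma> \<kappa> p) (q \<kappa> p u)))"

section \<open>Isothermicity expressed through the form of a section\<close>

lemma christoffel_chris:
  assumes "positive_section T A \<Lambda> W \<sigma>" "\<kappa> \<in> A" "p \<in> W" "p \<in> dom_of \<kappa>"
  shows "christoffel (ind_metric \<sigma>) \<kappa> p = surface_patch.chris (\<sigma> \<circ> param \<kappa>) (coord \<kappa> p)"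
proof -
  interpret P: surface_patch "coord \<kappa> ` (W \<inter> dom_of \<kappa>)" "\<sigma> \<circ> param \<kappa>"
    by (rule patch[OF assms(1,2)])
  have x: "coord \<kappa> p \<in> coord \<kappa> ` (W \<inter> dom_of \<kappa>)" using assms by blast
  have "dird \<kappa> (\<lambda>x. ind_metric \<sigma> \<kappa> x v w) p u = pd u (\<lambda>y. P.met y v w) (coord \<kappa> p)" for u v w
    by (rule dird_coord[OF assms(2) positive_sectionD(1)[OF assms(1)] assms(3,4)])
       (simp add: ind_metric_met[OF assms(1,2)])
  then show ?thesis
    unfolding christoffel_def ind_metric_met[OF assms(1,2)] using P.chris_unique[OF x] by simp
qed

text \<open>Since \<open>q\<close> is the metric with \<open>Q\<close> inserted in one slot, pairing
  with the shape operator evaluates the second fundamental form on \<open>v\<close> and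
  \<open>Q\<close>. The projection inside it is invisible to a normal vector, which leaves a plain
  second derivative of \<sigma>.\<close>

lemma shape_pairing:
  fixes u v :: "real^2"
  assumes "positive_section T A \<Lambda> W \<sigma>" "\<kappa> \<in> A" "p \<in> W" "p \<in> dom_of \<kappa>"
    and N: "N (\<sigma> p) \<in> lor_perp (VC p)"
  defines "Q \<equiv> riesz2 (ind_metric \<sigma> \<kappa> p) (q \<kappa> p u)"
  shows "q \<kappa> p u (shape_op (central_sphere T A \<Lambda>) \<sigma> \<kappa> p v N)
    = - lor (N (\<sigma> p)) (dird \<kappa> (\<lambda>x. dird \<kappa> \<sigma> x Q) p v)"
proof -
  let ?g = "ind_metric \<sigma> \<kappa> p"
  let ?D = "\<lambda>y. dird \<kappa> (\<lambda>x. dird \<kappa> \<sigma> x y) p v"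
  let ?\<xi> = "N (\<sigma> p)"
  note g = ind_metric_inner[OF assms(1-4)]
  note pt = dom_topspace[OF assms(2,4)]
  obtain x y where xy: "orthonormal2 ?g x y" using orthonormal2_exists[OF g] by blast
  obtain m where m: "null_frame (\<sigma> p) (dird \<kappa> \<sigma> p x) (dird \<kappa> \<sigma> p y) m"
      "VC p = span {\<sigma> p, dird \<kappa> \<sigma> p x, dird \<kappa> \<sigma> p y, m}"
    using congruence_frame[OF sphere_congruence_VC assms(1-4) xy] by blast
  have pp: "lor ?\<xi> (perp_part (VC p) w) = lor ?\<xi> w" for w
  proof -
    have "lor ?\<xi> (frame_proj (\<sigma> p) (dird \<kappa> \<sigma> p x) (dird \<kappa> \<sigma> p y) m w) = 0"
      using N frame_proj_in unfolding lor_perp_def m(2) by blast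
    then show ?thesis unfolding m(2) perp_part_frame[OF m(1)] by (simp add: lor_simps)
  qed
  have sf: "lor ?\<xi> (second_form (central_sphere T A \<Lambda>) \<sigma> \<kappa> p v y) = - lor ?\<xi> (?D y)" for y
    by (simp add: second_form_def central_sphere_eq[OF pt] lor_simps pp)
  have lD: "linear ?D" using bilinear_d2_section[OF assms(1-4)] by (simp add: bilinear_def)
  have lin: "linear (\<lambda>y. - lor ?\<xi> (?D y))"
    by (rule linearI) (simp_all add: linear_add[OF lD] linear_cmul[OF lD] lor_simps)
  have lq: "linear (q \<kappa> p u)" using q_props(1)[OF assms(2,4)] by (simp add: bilinear_def)
  have "shape_op (central_sphere T A \<Lambda>) \<sigma> \<kappa> p v N = riesz2 ?g (\<lambda>y. - lor ?\<xi> (?D y))"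
    unfolding shape_op_def sf using riesz2[OF g lin] riesz2_unique[OF g lin] by (intro the_equality) auto
  moreover have "q \<kappa> p u w = ?g w Q" for w
    unfolding Q_def using riesz2[OF g lq, of w] inner_prod2D(2)[OF g] by simp
  ultimately show ?thesis using riesz2[OF g lin, of Q] by simp
qed

text \<open>Normal vectors are represented by linear maps on the whole space; the quotient of time
  components is a linear functional with value 1 at \<open>\<sigma> p\<close>.\<close>

lemma normal_vector_extension:
  assumes "positive_section T A \<Lambda> W \<sigma>" "p \<in> W" "\<xi> \<in> lor_perp V"
  shows "\<exists>N\<in>normal_vectors (\<Lambda> p) V. N (\<sigma> p) = \<xi>"
proof -
  let ?N = "\<lambda>v. (snd v / snd (\<sigma> p)) *\<^sub>R \<xi>"
  have "?N (\<sigma> p) = \<xi>" using section_scale(2)[OF assms(1,2)] by simp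
  moreover have "linear ?N" by (rule linearI) (simp_all add: add_divide_distrib scaleR_add_left)
  moreover have "c *\<^sub>R \<xi> \<in> lor_perp V" for c using assms(3) by (simp add: lor_perp_def lor_simps)
  ultimately show ?thesis by (intro bexI[of _ ?N]) (auto simp: normal_vectors_def)
qed

text \<open>Translation of \<open>frm_closed_iff\<close> from the patch to the surface: the
  tangential condition becomes \<open>holomorphic_qd\<close>, the normal one
  \<open>commuting_qd\<close>, both at \<open>p\<close> and for one section.\<close>

lemma isothermic_at_iff:
  assumes "positive_section T A \<Lambda> W \<sigma>" "\<kappa> \<in> A" "p \<in> W" "p \<in> dom_of \<kappa>"
  shows "(\<forall>u v w. cov_deriv_2tensor (ind_metric \<sigma>) q \<kappa> p u v w
             - cov_deriv_2tensor (ind_metric \<sigma>) q \<kappa> p v u w = 0) \<and>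
         (\<forall>u v. \<forall>N\<in>normal_vectors (\<Lambda> p) (central_sphere T A \<Lambda> p).
             q \<kappa> p u (shape_op (central_sphere T A \<Lambda>) \<sigma> \<kappa> p v N)
               = q \<kappa> p v (shape_op (central_sphere T A \<Lambda>) \<sigma> \<kappa> p u N))
     \<longleftrightarrow> (\<forall>u v. ext_deriv (qd_form \<sigma>) \<kappa> p u v = 0)" (is "?H \<and> ?K \<longleftrightarrow> ?C")
proof -
  interpret P: patch_qd "coord \<kappa> ` (W \<inter> dom_of \<kappa>)" "\<sigma> \<circ> param \<kappa>" "\<lambda>y. q \<kappa> (param \<kappa> y)"
    by (rule patch_qd[OF assms(1,2)])
  let ?x = "coord \<kappa> p"
  have x: "?x \<in> coord \<kappa> ` (W \<inter> dom_of \<kappa>)" and px: "param \<kappa> ?x = p"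
    using assms param_coord by blast+
  note met = ind_metric_met[OF assms(1,2)]
  note pt = dom_topspace[OF assms(2,4)]
  obtain a b where ab: "orthonormal2 (ind_metric \<sigma> \<kappa> p) a b"
    using orthonormal2_exists[OF ind_metric_inner[OF assms]] by blast
  obtain m where m: "null_frame (\<sigma> p) (dird \<kappa> \<sigma> p a) (dird \<kappa> \<sigma> p b) m"
      "VC p = span {\<sigma> p, dird \<kappa> \<sigma> p a, dird \<kappa> \<sigma> p b, m}"
    using congruence_frame[OF sphere_congruence_VC assms ab] by blast
  have frm: "dird \<kappa> (\<lambda>x. qd_form \<sigma> \<kappa> x v) p u = pd u (P.frm v) ?x" for u v
  proof (rule dird_coord[OF assms(2) positive_sectionD(1)[OF assms(1)] assms(3,4)])
    fix z assume "z \<in> W" "z \<in> dom_of \<kappa>"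
    then show "qd_form \<sigma> \<kappa> z v = P.frm v (coord \<kappa> z)"
      using param_coord[OF assms(2)]
      by (simp add: qd_form_def P.frm_def P.alpha_def P.endo_def met dird_def)
  qed
  have C: "?C \<longleftrightarrow> (\<forall>u v. pd u (P.frm v) ?x = pd v (P.frm u) ?x)"
    by (simp add: ext_deriv_def frm)
  have dq: "dird \<kappa> (\<lambda>x. q \<kappa> x v w) p u = pd u (\<lambda>y. q \<kappa> (param \<kappa> y) v w) ?x" for u v w
    by (simp add: dird_def comp_def)
  have H: "?H \<longleftrightarrow> (\<forall>u v w. pd u (\<lambda>y. q \<kappa> (param \<kappa> y) v w) ?x - q \<kappa> (param \<kappa> ?x) v (P.chris ?x u w)
      = pd v (\<lambda>y. q \<kappa> (param \<kappa> y) u w) ?x - q \<kappa> (param \<kappa> ?x) u (P.chris ?x v w))"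
  proof -
    \<comment> \<open>The terms with the Christoffel map of \<open>u\<close> and \<open>v\<close> in
      the first slot of \<open>q\<close> cancel, because that map is symmetric.\<close>
    have "cov_deriv_2tensor (ind_metric \<sigma>) q \<kappa> p u v w - cov_deriv_2tensor (ind_metric \<sigma>) q \<kappa> p v u w
      = (pd u (\<lambda>y. q \<kappa> (param \<kappa> y) v w) ?x - q \<kappa> (param \<kappa> ?x) v (P.chris ?x u w))
        - (pd v (\<lambda>y. q \<kappa> (param \<kappa> y) u w) ?x - q \<kappa> (param \<kappa> ?x) u (P.chris ?x v w))" for u v w
      unfolding cov_deriv_2tensor_def christoffel_chris[OF assms] dq px
      using P.chris_sym[OF x, of u v] by simp
    then show ?thesis by simp
  qed
  have d2: "pd u (pd v (\<sigma> \<circ> param \<kappa>)) ?x = dird \<kappa> (\<lambda>x. dird \<kappa> \<sigma> x v) p u" for u v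
    by (rule dird_dird[OF assms(2,4), symmetric])
  have Q: "P.endo ?x u = riesz2 (ind_metric \<sigma> \<kappa> p) (q \<kappa> p u)" for u
    by (simp add: P.endo_def met px)
  have K: "?K \<longleftrightarrow> (\<forall>u v. \<forall>\<xi>\<in>lor_perp (VC p).
      lor \<xi> (pd u (pd (P.endo ?x v) (\<sigma> \<circ> param \<kappa>)) ?x) = lor \<xi> (pd v (pd (P.endo ?x u) (\<sigma> \<circ> param \<kappa>)) ?x))"
    (is "_ \<longleftrightarrow> ?R")
  proof -
    have nv: "N (\<sigma> p) \<in> lor_perp (VC p)" if "N \<in> normal_vectors (\<Lambda> p) (VC p)" for N
      using that positive_sectionD(3)[OF assms(1,3)] by (auto simp: normal_vectors_def)
    have sp: "q \<kappa> p u (shape_op (central_sphere T A \<Lambda>) \<sigma> \<kappa> p v N)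
        = - lor (N (\<sigma> p)) (pd v (pd (P.endo ?x u) (\<sigma> \<circ> param \<kappa>)) ?x)"
      if "N \<in> normal_vectors (\<Lambda> p) (VC p)" for N u v
      unfolding d2 Q by (rule shape_pairing[OF assms, where N = N, OF nv[OF that]])
    show ?thesis
      unfolding central_sphere_eq[OF pt]
    proof (intro iffI allI ballI)
      fix u v \<xi> assume L: "\<forall>u v. \<forall>N\<in>normal_vectors (\<Lambda> p) (VC p).
         q \<kappa> p u (shape_op (central_sphere T A \<Lambda>) \<sigma> \<kappa> p v N)
               = q \<kappa> p v (shape_op (central_sphere T A \<Lambda>) \<sigma> \<kappa> p u N)"
        and \<xi>: "\<xi> \<in> lor_perp (VC p)"
      obtain N where N: "N \<in> normal_vectors (\<Lambda> p) (VC p)" "N (\<sigma> p) = \<xi>"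
        using normal_vector_extension[OF assms(1,3) \<xi>] by blast
      have "q \<kappa> p v (shape_op (central_sphere T A \<Lambda>) \<sigma> \<kappa> p u N)
               = q \<kappa> p u (shape_op (central_sphere T A \<Lambda>) \<sigma> \<kappa> p v N)"
        using L N(1) by blast
      then show "lor \<xi> (pd u (pd (P.endo ?x v) (\<sigma> \<circ> param \<kappa>)) ?x) = lor \<xi> (pd v (pd (P.endo ?x u) (\<sigma> \<circ> param \<kappa>)) ?x)"
        unfolding sp[OF N(1)] N(2) by simp
    next
      fix u v N assume R: ?R and N: "N \<in> normal_vectors (\<Lambda> p) (VC p)"
      then show "q \<kappa> p u (shape_op (central_sphere T A \<Lambda>) \<sigma> \<kappa> p v N)
               = q \<kappa> p v (shape_op (central_sphere T A \<Lambda>) \<sigma> \<kappa> p u N)"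
        unfolding sp[OF N] using nv[OF N] by simp
    qed
  qed
  have f: "orthonormal2 (P.met ?x) a b" "null_frame ((\<sigma> \<circ> param \<kappa>) ?x) (pd a (\<sigma> \<circ> param \<kappa>) ?x) (pd b (\<sigma> \<circ> param \<kappa>) ?x) m"
    using ab m(1) by (simp_all add: met px dird_def)
  have V: "VC p = span {(\<sigma> \<circ> param \<kappa>) ?x, pd a (\<sigma> \<circ> param \<kappa>) ?x, pd b (\<sigma> \<circ> param \<kappa>) ?x, m}"
    using m(2) by (simp add: px dird_def)
  show ?thesis unfolding H K C V by (rule P.frm_closed_iff[OF x f, symmetric])
qed

lemma isothermic_iff:
  "isothermic_with T A \<Lambda> q \<longleftrightarrow> (\<forall>W \<sigma>. positive_section T A \<Lambda> W \<sigma> \<longrightarrow>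
     (\<forall>\<kappa>\<in>A. \<forall>p\<in>W \<inter> dom_of \<kappa>. \<forall>u v. ext_deriv (qd_form \<sigma>) \<kappa> p u v = 0))"
  (is "_ \<longleftrightarrow> ?R")
proof
  assume i: "isothermic_with T A \<Lambda> q"
  show ?R
  proof (intro allI impI ballI)
    fix W \<sigma> \<kappa> p u v
    assume a: "positive_section T A \<Lambda> W \<sigma>" "\<kappa> \<in> A" "p \<in> W \<inter> dom_of \<kappa>"
    then have p: "p \<in> W" "p \<in> dom_of \<kappa>" by auto
    have "\<forall>u v. ext_deriv (qd_form \<sigma>) \<kappa> p u v = 0"
      unfolding isothermic_at_iff[OF a(1,2) p, symmetric]
      using i a unfolding isothermic_with_def holomorphic_qd_def commuting_qd_def by simp
    then show "ext_deriv (qd_form \<sigma>) \<kappa> p u v = 0" by blast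
  qed
next
  assume R: ?R
  have "(\<forall>u v w. cov_deriv_2tensor (ind_metric \<sigma>) q \<kappa> p u v w
             - cov_deriv_2tensor (ind_metric \<sigma>) q \<kappa> p v u w = 0) \<and>
         (\<forall>u v. \<forall>N\<in>normal_vectors (\<Lambda> p) (central_sphere T A \<Lambda> p).
             q \<kappa> p u (shape_op (central_sphere T A \<Lambda>) \<sigma> \<kappa> p v N)
               = q \<kappa> p v (shape_op (central_sphere T A \<Lambda>) \<sigma> \<kappa> p u N))"
    if "positive_section T A \<Lambda> W \<sigma>" "\<kappa> \<in> A" "p \<in> W" "p \<in> dom_of \<kappa>" for W \<sigma> \<kappa> p
    unfolding isothermic_at_iff[OF that] using R that by simp
  then show "isothermic_with T A \<Lambda> q"
    unfolding isothermic_with_def holomorphic_qd_def commuting_qd_def by blast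
qed

section \<open>A closed form is determined by its class\<close>

lemma sym_tracefree_id:
  assumes "\<And>u v. b u v = b v u" "metric_trace g b = 0"
  shows "sym_tracefree g b u v = b u v"
  using assms(1)[of u v] by (simp add: sym_tracefree_def assms(2))

text \<open>Passing to the class loses no information on closed forms: their tensor is already
  symmetric and tracefree, hence equal to \<open>q\<close>, and \<open>eta_eq\<close> rebuilds
  \<eta> from it.\<close>

lemma closed_form_unique:
  assumes \<eta>: "smooth_1form A \<eta>" "form_in A \<eta> (\<lambda>p. stab_perp (\<Lambda> p))"
      "homology_class_eq T A \<Lambda> \<eta> q" "closed_1form A \<eta>"
    and s: "positive_section T A \<Lambda> W \<sigma>" "\<kappa> \<in> A" "p \<in> W" "p \<in> dom_of \<kappa>"
  shows "\<eta> \<kappa> p u = qd_form \<sigma> \<kappa> p u"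
proof -
  let ?U = "coord \<kappa> ` (W \<inter> dom_of \<kappa>)"
  interpret P: patch_form ?U "\<sigma> \<circ> param \<kappa>" "\<lambda>v y. \<eta> \<kappa> (param \<kappa> y) v"
  proof (rule patch_form.intro[OF patch[OF s(1,2)]], rule patch_form_axioms.intro)
    fix x assume "x \<in> ?U"
    then obtain p where p: "p \<in> W" "p \<in> dom_of \<kappa>" "x = coord \<kappa> p" by blast
    have px: "param \<kappa> x = p" using p param_coord[OF s(2)] by simp
    show "linear (\<lambda>v. \<eta> \<kappa> (param \<kappa> x) v)"
      unfolding px using \<eta>(1) s(2) p(2) unfolding smooth_1form_def by blast
    have "\<eta> \<kappa> p v \<in> stab_perp (\<Lambda> p)" for v using \<eta>(2) s(2) p(2) by (simp add: form_in_def)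
    then show "\<eta> \<kappa> (param \<kappa> x) v \<in> stab_perp (span {(\<sigma> \<circ> param \<kappa>) x})" for v
      using Lambda_span[OF s(1) p(1)] px by simp
    have "ext_deriv \<eta> \<kappa> p u v = 0" for u v using \<eta>(4) s(2) p(2) by (simp add: closed_1form_def)
    then show "pd u (\<lambda>y. \<eta> \<kappa> (param \<kappa> y) v) x = pd v (\<lambda>y. \<eta> \<kappa> (param \<kappa> y) u) x" for u v
      by (simp add: ext_deriv_def dird_def comp_def p(3))
  next
    fix v
    have "smooth_on (coord \<kappa> ` dom_of \<kappa>) ((\<lambda>x. \<eta> \<kappa> x v) \<circ> param \<kappa>)"
      using \<eta>(1) s(2) by (simp add: smooth_1form_def)
    then have "smooth_on ?U ((\<lambda>x. \<eta> \<kappa> x v) \<circ> param \<kappa>)" by (rule smooth_on_subset) blast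
    then show "smooth_on ?U (\<lambda>y. \<eta> \<kappa> (param \<kappa> y) v)" by (simp add: comp_def)
  qed
  let ?x = "coord \<kappa> p"
  have x: "?x \<in> ?U" and px: "param \<kappa> ?x = p" using s param_coord by blast+
  have met: "ind_metric \<sigma> \<kappa> p = P.met ?x" by (rule ind_metric_met[OF s(1,2)])
  have sold: "soldered \<sigma> \<eta> \<kappa> p = P.btensor ?x"
  proof (intro ext)
    fix u v
    have e: "blinfun_apply (\<eta> \<kappa> p u) (dird \<kappa> \<sigma> p v) = - (P.btensor ?x u v *\<^sub>R \<sigma> p)"
      using P.eta_dF[OF x, of u v] by (simp add: px dird_def)
    show "soldered \<sigma> \<eta> \<kappa> p u v = P.btensor ?x u v"
      unfolding soldered_def e using P.F_nonzero[OF x] px by (intro the_equality) auto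
  qed
  have "q \<kappa> p u v = P.btensor ?x u v" for u v
  proof -
    have "q \<kappa> p u v = sym_tracefree (ind_metric \<sigma> \<kappa> p) (soldered \<sigma> \<eta> \<kappa> p) u v"
      using \<eta>(3) s by (simp add: homology_class_eq_def)
    also have "\<dots> = P.btensor ?x u v"
      unfolding sold met by (rule sym_tracefree_id[OF P.btensor_sym[OF x] P.btensor_trace[OF x]])
    finally show ?thesis .
  qed
  then have "q \<kappa> p u = P.btensor ?x u" by blast
  then show ?thesis
    using P.eta_eq[OF x, of u] by (simp add: qd_form_def met px dird_def)
qed

text \<open>By uniqueness \<eta> agrees on \<open>W\<close> with the form of each positive section,
  so all these forms inherit closedness.\<close>

lemma closed_form_isothermic:
  assumes "smooth_1form A \<eta>" "form_in A \<eta> (\<lambda>p. stab_perp (\<Lambda> p))"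
      "homology_class_eq T A \<Lambda> \<eta> q" "closed_1form A \<eta>"
  shows "isothermic_with T A \<Lambda> q"
  unfolding isothermic_iff
proof (intro allI impI ballI)
  fix W \<sigma> \<kappa> p u v
  assume a: "positive_section T A \<Lambda> W \<sigma>" "\<kappa> \<in> A" "p \<in> W \<inter> dom_of \<kappa>"
  have "dird \<kappa> (\<lambda>x. qd_form \<sigma> \<kappa> x v) p u = dird \<kappa> (\<lambda>x. \<eta> \<kappa> x v) p u" for u v
    by (rule dird_cong[OF a(2) positive_sectionD(1)[OF a(1)]])
       (use a closed_form_unique[OF assms a(1,2)] in auto)
  then have "ext_deriv (qd_form \<sigma>) \<kappa> p u v = ext_deriv \<eta> \<kappa> p u v" by (simp add: ext_deriv_def)
  also have "\<dots> = 0" using assms(4) a by (simp add: closed_1form_def)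
  finally show "ext_deriv (qd_form \<sigma>) \<kappa> p u v = 0" .
qed

section \<open>The form of the global section\<close>

lemma qd_form_section:
  assumes "\<kappa> \<in> A" "p \<in> dom_of \<kappa>"
  defines "Q u \<equiv> riesz2 (ind_metric sec0 \<kappa> p) (q \<kappa> p u)"
  shows "linear (qd_form sec0 \<kappa> p)"
    and "lor (dird \<kappa> sec0 p (Q u)) (dird \<kappa> sec0 p v) = q \<kappa> p u v"
proof -
  note pt = dom_topspace[OF assms(1,2)]
  interpret P: patch_qd "coord \<kappa> ` (topspace T \<inter> dom_of \<kappa>)" "sec0 \<circ> param \<kappa>" "\<lambda>y. q \<kappa> (param \<kappa> y)"
    by (rule patch_qd[OF sec0_positive assms(1)])
  have x: "coord \<kappa> p \<in> coord \<kappa> ` (topspace T \<inter> dom_of \<kappa>)" and px: "param \<kappa> (coord \<kappa> p) = p"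
    using assms pt param_coord by blast+
  have Q: "dird \<kappa> sec0 p (Q u) = P.alpha u (coord \<kappa> p)" for u
    by (simp add: Q_def P.alpha_def P.endo_def px ind_metric_met[OF sec0_positive assms(1)] dird_def)
  show "lor (dird \<kappa> sec0 p (Q u)) (dird \<kappa> sec0 p v) = q \<kappa> p u v"
    unfolding Q using P.lor_alpha_dF[OF x] by (simp add: px dird_def)
  have e: "qd_form sec0 \<kappa> p = (\<lambda>u. wedge (sec0 p) (P.alpha u (coord \<kappa> p)))"
    by (simp add: fun_eq_iff qd_form_def flip: Q Q_def)
  show "linear (qd_form sec0 \<kappa> p)"
    unfolding e by (rule linearI)
      (simp_all add: linear_add[OF P.linear_alpha[OF x]] linear_cmul[OF P.linear_alpha[OF x]] wedge_simps)
qed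

lemma smooth_qd_form: "smooth_1form A (qd_form sec0)"
  unfolding smooth_1form_def
proof (intro conjI ballI allI)
  fix \<kappa> p assume k: "\<kappa> \<in> A" "p \<in> dom_of \<kappa>"
  show "linear (qd_form sec0 \<kappa> p)" by (rule qd_form_section(1)[OF k])
next
  fix \<kappa> u assume k: "\<kappa> \<in> A"
  let ?U = "coord \<kappa> ` dom_of \<kappa>"
  interpret P: patch_qd "coord \<kappa> ` (topspace T \<inter> dom_of \<kappa>)" "sec0 \<circ> param \<kappa>" "\<lambda>y. q \<kappa> (param \<kappa> y)"
    by (rule patch_qd[OF sec0_positive k])
  have U: "coord \<kappa> ` (topspace T \<inter> dom_of \<kappa>) = ?U" using dom_sub[OF k] by (simp add: Int_absorb1)
  have "((\<lambda>x. qd_form sec0 \<kappa> x u) \<circ> param \<kappa>) y = P.frm u y" if "y \<in> ?U" for y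
  proof -
    obtain p where "p \<in> dom_of \<kappa>" "y = coord \<kappa> p" using \<open>y \<in> ?U\<close> by blast
    then show ?thesis
      using param_coord[OF k]
      by (simp add: qd_form_def P.frm_def P.alpha_def P.endo_def ind_metric_met[OF sec0_positive k] dird_def)
  qed
  then show "smooth_on ?U ((\<lambda>x. qd_form sec0 \<kappa> x u) \<circ> param \<kappa>)"
    using smooth_on_cong[OF P.open_U[unfolded U], of "(\<lambda>x. qd_form sec0 \<kappa> x u) \<circ> param \<kappa>" "P.frm u"]
      P.smooth_frm[unfolded U] by simp
next
  fix \<kappa> \<kappa>' p u assume k: "\<kappa> \<in> A" "\<kappa>' \<in> A" "p \<in> dom_of \<kappa> \<inter> dom_of \<kappa>'"
  then have p: "p \<in> dom_of \<kappa>" "p \<in> dom_of \<kappa>'" by auto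
  note pt = dom_topspace[OF k(1) p(1)]
  let ?J = "change_coord \<kappa> \<kappa>' p"
  have ch: "dird \<kappa> sec0 p v = dird \<kappa>' sec0 p (?J v)" for v
    by (rule dird_change[OF sec0_smooth openin_topspace k(1,2) pt p])
  note g = ind_metric_inner[OF sec0_positive k(1) pt p(1)]
    and g' = ind_metric_inner[OF sec0_positive k(2) pt p(2)]
  have gJ: "ind_metric sec0 \<kappa> p v w = ind_metric sec0 \<kappa>' p (?J v) (?J w)" for v w
    by (simp add: ind_metric_def ch)
  have linJ: "linear ?J" by (rule linear_change_coord[OF k(1,2) p])
  have "inj ?J"
  proof (rule linear_injective_0[THEN iffD2, OF linJ], intro allI impI)
    fix v assume "?J v = 0"
    then have "ind_metric sec0 \<kappa> p v w = 0" for w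
      unfolding gJ using bilinear_lzero[OF inner_prod2D(1)[OF g']] by simp
    then show "v = 0" by (rule inner_prod2_eq_0[OF g])
  qed
  then have surj: "surj ?J" by (rule linear_injective_imp_surjective[OF linJ]) (rule refl)
  let ?Q = "riesz2 (ind_metric sec0 \<kappa> p) (q \<kappa> p u)"
  have lq: "linear (q \<kappa> p v)" "linear (q \<kappa>' p v)" for v
    using q_props(1)[OF k(1) p(1)] q_props(1)[OF k(2) p(2)] by (simp_all add: bilinear_def)
  \<comment> \<open>The Jacobian is an isometry carrying \<open>q\<close> to \<open>q\<close>, so it
    intertwines the endomorphisms representing \<open>q\<close> in the two charts. Testing against
    every \<open>y\<close> relies on the surjectivity shown above.\<close>
  have "?J ?Q = riesz2 (ind_metric sec0 \<kappa>' p) (q \<kappa>' p (?J u))"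
  proof (rule riesz2_unique[OF g' lq(2)])
    fix y
    obtain z where z: "y = ?J z" using surj by blast
    show "ind_metric sec0 \<kappa>' p (?J ?Q) y = q \<kappa>' p (?J u) y"
      unfolding z gJ[symmetric] riesz2[OF g lq(1)] by (rule q_props(3)[OF k(1) p(1) k(2) p(2)])
  qed
  then show "qd_form sec0 \<kappa> p u = qd_form sec0 \<kappa>' p (?J u)"
    unfolding qd_form_def ch by simp
qed

text \<open>Both factors of the wedge, a section and one of its derivatives, lie in the central
  sphere, so the endomorphism annihilates the orthogonal complement.\<close>

lemma qd_form_in: "form_in A (qd_form sec0) (\<lambda>p. stab_perp (\<Lambda> p) \<inter> so_sub (central_sphere T A \<Lambda> p))"
  unfolding form_in_def
proof (intro ballI allI IntI)
  fix \<kappa> p u assume k: "\<kappa> \<in> A" "p \<in> dom_of \<kappa>"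
  note pt = dom_topspace[OF k]
  note ls = lor_section[OF sec0_positive k(1) pt k(2)]
  show "qd_form sec0 \<kappa> p u \<in> stab_perp (\<Lambda> p)"
    unfolding qd_form_def by (rule wedge_stab_perp[OF Lambda_span[OF sec0_positive pt] ls(1,2)])
  show "qd_form sec0 \<kappa> p u \<in> so_sub (central_sphere T A \<Lambda> p)"
    unfolding so_sub_def central_sphere_eq[OF pt] VC_chart[OF k]
  proof (intro CollectI conjI ballI)
    show "qd_form sec0 \<kappa> p u \<in> so_lor" unfolding qd_form_def by (rule wedge_so_lor)
    fix v assume "v \<in> lor_perp (csphere \<kappa> p)"
    then have v: "lor w v = 0" if "w \<in> csphere \<kappa> p" for w
      using that lor_commute[of v w] by (simp add: lor_perp_def)
    show "blinfun_apply (qd_form sec0 \<kappa> p u) v = 0"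
      by (simp add: qd_form_def wedge_apply v[OF csphere_in(1)[OF k]] v[OF csphere_in(2)[OF k]])
  qed
qed

text \<open>The form is built from \<open>sec0\<close> but tested on an arbitrary \<sigma>: the part
  of the derivative of \<sigma> along \<open>sec0\<close> is annihilated, and the remaining scale
  factor turns \<open>sec0\<close> into \<sigma>.\<close>

lemma qd_form_class: "homology_class_eq T A \<Lambda> (qd_form sec0) q"
  unfolding homology_class_eq_def
proof (intro allI impI ballI)
  fix W \<sigma> \<kappa> p u v
  assume a: "positive_section T A \<Lambda> W \<sigma>" "\<kappa> \<in> A" "p \<in> W \<inter> dom_of \<kappa>"
  then have p: "p \<in> W" "p \<in> dom_of \<kappa>" by auto
  note pt = dom_topspace[OF a(2) p(2)]
  note ls = lor_section[OF sec0_positive a(2) pt p(2)]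
  have "soldered \<sigma> (qd_form sec0) \<kappa> p = q \<kappa> p"
  proof (intro ext)
    fix u v
    have "blinfun_apply (qd_form sec0 \<kappa> p u) (dird \<kappa> \<sigma> p v) = - (q \<kappa> p u v *\<^sub>R (snd (\<sigma> p) *\<^sub>R sec0 p))"
      by (simp add: qd_form_def wedge_apply dird_section[OF a(1,2) p] lor_simps ls
          qd_form_section(2)[OF a(2) p(2)] mult.commute)
    then have e: "blinfun_apply (qd_form sec0 \<kappa> p u) (dird \<kappa> \<sigma> p v) = - (q \<kappa> p u v *\<^sub>R \<sigma> p)"
      using section_scale(1)[OF a(1) p(1)] by simp
    show "soldered \<sigma> (qd_form sec0) \<kappa> p u v = q \<kappa> p u v"
      unfolding soldered_def e
      using half_cone_nonzero[OF positive_sectionD(4)[OF a(1) p(1)]] by (intro the_equality) auto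
  qed
  then show "sym_tracefree (ind_metric \<sigma> \<kappa> p) (soldered \<sigma> (qd_form sec0) \<kappa> p) u v = q \<kappa> p u v"
    using sym_tracefree_id[of "q \<kappa> p" "ind_metric \<sigma> \<kappa> p", OF q_props(2)[OF a(2) p(2)] q_props(4)[OF a(2) p(2) a(1) p(1)]] by simp
qed

end

section \<open>Flatness of the pencil of connections\<close>

context sphere_surface
begin

lemma stab_perp_commute:
  assumes "p \<in> topspace T" "S \<in> stab_perp (\<Lambda> p)" "R \<in> stab_perp (\<Lambda> p)"
  shows "blinfun_apply S (blinfun_apply R v) = blinfun_apply R (blinfun_apply S v)"
proof -
  let ?s = "sec0 p" and ?t = "(0, 1) :: (real^'m) \<times> real"
  note L = Lambda_span[OF sec0_positive assms(1)]
  have cone: "?s \<in> half_cone" using positive_sectionD(4)[OF sec0_positive assms(1)] .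
  have t: "lor ?s ?t \<noteq> 0" by (rule half_cone_partner[OF cone])
  note S = stab_perp_eq_wedge[OF L assms(2) t] and R = stab_perp_eq_wedge[OF L assms(3) t]
  have "lor ?s ?s = 0" using cone by (simp add: half_cone_def)
  then show ?thesis
    by (subst (1 2) S(1), subst (1 2) R(1)) (rule wedge_null_commute, simp_all add: lor_simps S(2) R(2))
qed

text \<open>The expansion separates what is symmetric in \<open>u\<close> and \<open>v\<close> from
  the curvature. The second derivative and the first-order terms are symmetric, the quadratic term
  is so because the nilradical is abelian, and the last term skews to \<open>r\<close> times the
  exterior derivative of \<eta>.\<close>

lemma conn_conn:
  fixes r :: real
  assumes \<eta>: "smooth_1form A \<eta>"
    and s: "openin T W" "smooth_map_on A W s" "\<kappa> \<in> A" "p \<in> W" "p \<in> dom_of \<kappa>"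
  defines "\<omega> \<equiv> \<lambda>\<kappa> p u. (r::real) *\<^sub>R \<eta> \<kappa> p u"
  shows "conn \<omega> \<kappa> (\<lambda>x. conn \<omega> \<kappa> s x v) p u =
     dird \<kappa> (\<lambda>x. dird \<kappa> s x v) p u
     + r *\<^sub>R (blinfun_apply (\<eta> \<kappa> p v) (dird \<kappa> s p u) + blinfun_apply (\<eta> \<kappa> p u) (dird \<kappa> s p v))
     + (r * r) *\<^sub>R blinfun_apply (\<eta> \<kappa> p u) (blinfun_apply (\<eta> \<kappa> p v) (s p))
     + r *\<^sub>R blinfun_apply (dird \<kappa> (\<lambda>x. \<eta> \<kappa> x v) p u) (s p)"
proof -
  let ?W = "W \<inter> dom_of \<kappa>"
  have o: "openin T ?W" using s(1) chart_homeo(1)[OF s(3)] by blast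
  have p: "p \<in> ?W" using s by blast
  have "smooth_on (coord \<kappa> ` dom_of \<kappa>) ((\<lambda>x. \<eta> \<kappa> x v) \<circ> param \<kappa>)"
    using \<eta> s(3) by (simp add: smooth_1form_def)
  then have "smooth_on (coord \<kappa> ` ?W) ((\<lambda>x. \<eta> \<kappa> x v) \<circ> param \<kappa>)"
    by (rule smooth_on_subset) blast
  then have se: "smooth_map_on A ?W (\<lambda>x. \<eta> \<kappa> x v)"
    by (intro smooth_map_on_chart[OF s(3) o, of "(\<lambda>x. \<eta> \<kappa> x v) \<circ> param \<kappa>"])
       (use param_coord[OF s(3)] in auto)
  have ss: "smooth_map_on A ?W s" by (rule smooth_map_on_subset[OF s(2)]) blast
  have sd: "smooth_map_on A ?W (\<lambda>x. dird \<kappa> s x v)" by (rule smooth_map_on_dird[OF s(2,3,1)])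
  note sb = smooth_map_on_bounded_bilinear[OF bounded_bilinear_blinfun_apply o se ss]
  have sr: "smooth_map_on A ?W (\<lambda>x. r *\<^sub>R blinfun_apply (\<eta> \<kappa> x v) (s x))"
    by (rule smooth_map_on_bounded_linear[OF bounded_linear_scaleR_right o sb])
  have r: "dird \<kappa> (\<lambda>x. r *\<^sub>R blinfun_apply (\<eta> \<kappa> x v) (s x)) p u
      = r *\<^sub>R dird \<kappa> (\<lambda>x. blinfun_apply (\<eta> \<kappa> x v) (s x)) p u"
    unfolding dird_def
    using frechet_derivative_bounded_linear[OF bounded_linear_scaleR_right smooth_map_diff[OF sb s(3) o p s(5)], of r u]
    by (simp add: comp_def)
  have "dird \<kappa> (\<lambda>x. dird \<kappa> s x v + r *\<^sub>R blinfun_apply (\<eta> \<kappa> x v) (s x)) p u =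
      dird \<kappa> (\<lambda>x. dird \<kappa> s x v) p u + r *\<^sub>R (blinfun_apply (\<eta> \<kappa> p v) (dird \<kappa> s p u)
        + blinfun_apply (dird \<kappa> (\<lambda>x. \<eta> \<kappa> x v) p u) (s p))"
    unfolding dird_add[OF sd sr s(3) o p s(5)] r
      dird_bounded_bilinear[OF bounded_bilinear_blinfun_apply se ss s(3) o p s(5)] ..
  then show ?thesis
    unfolding conn_def \<omega>_def
    by (simp add: blinfun.scaleR_left blinfun.add_right blinfun.scaleR_right scaleR_add_right)
qed

text \<open>For closedness the parameter 1 and constant sections suffice: their derivatives vanish
  and they take every value at \<open>p\<close>.\<close>

lemma flat_iff_closed:
  assumes \<eta>: "smooth_1form A \<eta>" "form_in A \<eta> (\<lambda>p. stab_perp (\<Lambda> p))"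
  shows "(\<forall>r::real. flat_connection T A (\<lambda>\<kappa> p u. r *\<^sub>R \<eta> \<kappa> p u)) \<longleftrightarrow> closed_1form A \<eta>"
proof
  assume flat: "\<forall>r::real. flat_connection T A (\<lambda>\<kappa> p u. r *\<^sub>R \<eta> \<kappa> p u)"
  show "closed_1form A \<eta>"
    unfolding closed_1form_def
  proof (intro ballI allI)
    fix \<kappa> p u v assume k: "\<kappa> \<in> A" "p \<in> dom_of \<kappa>"
    note pt = dom_topspace[OF k]
    have "blinfun_apply (dird \<kappa> (\<lambda>x. \<eta> \<kappa> x v) p u) c = blinfun_apply (dird \<kappa> (\<lambda>x. \<eta> \<kappa> x u) p v) c" for c
    proof -
      let ?s = "\<lambda>_::'a. c"
      let ?\<omega> = "\<lambda>\<kappa> p u. (1::real) *\<^sub>R \<eta> \<kappa> p u"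
      have s: "smooth_map_on A (topspace T) ?s" by (simp add: smooth_map_on_def comp_def smooth_on_const)
      have z: "dird \<kappa> (\<lambda>_. d) p w = 0" for d :: "(real^'m) \<times> real" and p w by (simp add: dird_def comp_def)
      have "conn ?\<omega> \<kappa> (\<lambda>x. conn ?\<omega> \<kappa> ?s x v) p u = conn ?\<omega> \<kappa> (\<lambda>x. conn ?\<omega> \<kappa> ?s x u) p v"
        using flat[rule_format, of 1] s k pt unfolding flat_connection_def by blast
      then show ?thesis
        unfolding conn_conn[OF \<eta>(1) openin_topspace s k(1) pt k(2)]
        using stab_perp_commute[OF pt, of "\<eta> \<kappa> p u" "\<eta> \<kappa> p v" c] \<eta>(2) k by (simp add: z form_in_def blinfun.zero_right)
    qed
    then show "ext_deriv \<eta> \<kappa> p u v = 0" by (simp add: ext_deriv_def blinfun_eqI)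
  qed
next
  assume closed: "closed_1form A \<eta>"
  show "\<forall>r::real. flat_connection T A (\<lambda>\<kappa> p u. r *\<^sub>R \<eta> \<kappa> p u)"
    unfolding flat_connection_def
  proof (intro allI impI ballI)
    fix r :: real and W and s :: "'a \<Rightarrow> (real^'m) \<times> real" and \<kappa> p u v
    assume a: "openin T W \<and> smooth_map_on A W s" "\<kappa> \<in> A" "p \<in> W \<inter> dom_of \<kappa>"
    then have s: "openin T W" "smooth_map_on A W s" "\<kappa> \<in> A" "p \<in> W" "p \<in> dom_of \<kappa>" by auto
    note pt = dom_topspace[OF s(3,5)]
    have d: "dird \<kappa> (\<lambda>x. \<eta> \<kappa> x v) p u = dird \<kappa> (\<lambda>x. \<eta> \<kappa> x u) p v"
      using closed s by (simp add: closed_1form_def ext_deriv_def)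
    have c: "blinfun_apply (\<eta> \<kappa> p u) (blinfun_apply (\<eta> \<kappa> p v) (s p))
       = blinfun_apply (\<eta> \<kappa> p v) (blinfun_apply (\<eta> \<kappa> p u) (s p))"
      using stab_perp_commute[OF pt] \<eta>(2) s by (simp add: form_in_def)
    show "conn (\<lambda>\<kappa> p u. r *\<^sub>R \<eta> \<kappa> p u) \<kappa> (\<lambda>x. conn (\<lambda>\<kappa> p u. r *\<^sub>R \<eta> \<kappa> p u) \<kappa> s x v) p u =
          conn (\<lambda>\<kappa> p u. r *\<^sub>R \<eta> \<kappa> p u) \<kappa> (\<lambda>x. conn (\<lambda>\<kappa> p u. r *\<^sub>R \<eta> \<kappa> p u) \<kappa> s x u) p v"
      unfolding conn_conn[OF \<eta>(1) s] d c dird_dird_sym[OF s(2,3,1,4,5), of v u]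
      by (simp add: add.commute)
  qed
qed

end

theorem theorem15p4:
  fixes n :: nat
    and T :: "'a topology"
    and A :: "'a chart set"
    and \<Lambda> :: "'a \<Rightarrow> ((real^'m) \<times> real) set"
    and q :: "('a, real) form2"
  assumes "n > 2" and "CARD('m) = n + 1"
    and "smooth_surface T A"
    and "immersed_surface T A \<Lambda>"
    and "quadratic_differential T A \<Lambda> q"
    and "nonzero_tensor A q"
  shows
    "(isothermic_with T A \<Lambda> q
        \<longleftrightarrow>
      (\<exists>\<eta>. smooth_1form A \<eta> \<and> form_in A \<eta> (\<lambda>p. stab_perp (\<Lambda> p)) \<and>
         homology_class_eq T A \<Lambda> \<eta> q \<and> closed_1form A \<eta>))
     \<and>
     ((\<exists>\<eta>. smooth_1form A \<eta> \<and> form_in A \<eta> (\<lambda>p. stab_perp (\<Lambda> p)) \<and>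
         homology_class_eq T A \<Lambda> \<eta> q \<and> closed_1form A \<eta>)
        \<longleftrightarrow>
      (\<exists>\<eta>. smooth_1form A \<eta> \<and>
         form_in A \<eta> (\<lambda>p. stab_perp (\<Lambda> p) \<inter> so_sub (central_sphere T A \<Lambda> p)) \<and>
         homology_class_eq T A \<Lambda> \<eta> q \<and>
         (\<forall>r::real. flat_connection T A (\<lambda>\<kappa> p u. r *\<^sub>R \<eta> \<kappa> p u))))"
    (is "(?i \<longleftrightarrow> ?ii) \<and> (?ii \<longleftrightarrow> ?iii)")
proof -
  interpret surface_qd T A \<Lambda> q
    by unfold_locales (fact assms)+
  have stab: "form_in A \<eta> (\<lambda>p. stab_perp (\<Lambda> p))"
    if "form_in A \<eta> (\<lambda>p. stab_perp (\<Lambda> p) \<inter> so_sub (central_sphere T A \<Lambda> p))" for \<eta>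
    using that by (simp add: form_in_def)
  have "?ii \<Longrightarrow> ?i" using closed_form_isothermic by blast
  moreover have ?iii if ?i
  proof -
    \<comment> \<open>Isothermicity is used only for \<open>sec0\<close>, whose domain is the whole
      surface, so the resulting closed form is global.\<close>
    have "ext_deriv (qd_form sec0) \<kappa> p u v = 0" if "\<kappa> \<in> A" "p \<in> dom_of \<kappa>" for \<kappa> p u v
      using \<open>?i\<close> sec0_positive that dom_topspace[OF that] unfolding isothermic_iff by blast
    then have "closed_1form A (qd_form sec0)" by (simp add: closed_1form_def)
    then show ?iii
      using smooth_qd_form qd_form_in qd_form_class flat_iff_closed[OF smooth_qd_form stab[OF qd_form_in]]
      by blast
  qed
  moreover have "?iii \<Longrightarrow> ?ii" using flat_iff_closed stab by blast
  ultimately show ?thesis by blast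
qed

end
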